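(* Let $p$ be a prime, let $q$ be a power of $p$, and let $\alpha \in \mathbb{F}_q(\!(t)\!)$ be a nonzero element with $v_t(\alpha) > 0$. Then the existential theory $\mathrm{Th}_{\exists}(\mathbb{F}_q(\!(t)\!), \alpha, \alpha^{\mathbb{Z}})$ of the structure $(\mathbb{F}_q(\!(t)\!), \alpha, \alpha^{\mathbb{Z}})$ is undecidable.
   Context: $\mathbb{F}_q(\!(t)\!) = \{\sum_{i=-k}^{\infty} a_i t^i \mid a_i \in \mathbb{F}_q,\ k \in \mathbb{Z}\}$ is the field of formal Laurent series over the finite field $\mathbb{F}_q$ with $q$ elements, and $v_t$ is its $t$-adic valuation: for $x = \sum_i a_i t^i \neq 0$, $v_t(x) = \min\{i \mid a_i \neq 0\}$. $\alpha^{\mathbb{Z}} = \{\alpha^n \mid n \in \mathbb{Z}\}$ is the cyclic multiplicative subgroup of $\mathbb{F}_q(\!(t)\!)^{\times}$ generated by $\alpha$. The structure $(\mathbb{F}_q(\!(t)\!), \alpha, \alpha^{\mathbb{Z}})$ is the field $\mathbb{F}_q(\!(t)\!)$ viewed as a first-order structure in the language of rings $\{0, 1, +, \cdot\}$ expanded by a constant symbol interpreted as $\alpha$ and a unary predicate symbol interpreted as the set $\alpha^{\mathbb{Z}}$. The existential theory $\mathrm{Th}_{\exists}(\mathcal{M})$ of a structure $\mathcal{M}$ is the set of all existential sentences (sentences of the form $\exists x_1 \cdots \exists x_r\, \varphi$ with $\varphi$ quantifier-free) in the language of $\mathcal{M}$ that are true in $\mathcal{M}$. It is undecidable if there is no algorithm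 which, given an existential sentence of this language, decides whether it is true in $\mathcal{M}$. *)

theory Defs
  imports "HOL-Computational_Algebra.Computational_Algebra" "HOL-Library.Nat_Bijection"
    "HOL-Library.Cardinality"
begin

datatype recf =
    RZero
  | RSucc
  | RProj nat
  | RComp recf "recf list"
  | RPrec recf recf
  | RMin recf

text \<open>
  Algorithms are (indices of) partial recursive functions.
  \<open>rec_eval f xs y\<close>: the computation of \<open>f\<close> on the argument list \<open>xs\<close> terminates with value
  \<open>y\<close>. In primitive recursion the recursion variable comes first, followed (in the step case)
  by the previous value; in minimization the search variable comes first.
\<close>

inductive rec_eval :: "recf \<Rightarrow> nat list \<Rightarrow> nat \<Rightarrow> bool" where
  zero: "rec_eval RZero xs 0"
| succ: "rec_eval RSucc [x] (Suc x)"
| proj: "i < length xs \<Longrightarrow> rec_eval (RProj i) xs (xs ! i)"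
| comp: "list_all2 (\<lambda>g y. rec_eval g xs y) gs ys \<Longrightarrow> rec_eval f ys z
          \<Longrightarrow> rec_eval (RComp f gs) xs z"
| prec_0: "rec_eval f xs y \<Longrightarrow> rec_eval (RPrec f g) (0 # xs) y"
| prec_Suc: "rec_eval (RPrec f g) (n # xs) r \<Longrightarrow> rec_eval g (n # r # xs) y
          \<Longrightarrow> rec_eval (RPrec f g) (Suc n # xs) y"
| min: "rec_eval f (n # xs) 0 \<Longrightarrow> (\<And>i. i < n \<Longrightarrow> \<exists>v>0. rec_eval f (i # xs) v)
          \<Longrightarrow> rec_eval (RMin f) xs n"

lemma rec_eval_deterministic: "rec_eval f xs y \<Longrightarrow> rec_eval f xs z \<Longrightarrow> y = z"
proof (induction arbitrary: z rule: rec_eval.induct)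
  case (zero xs)
  from zero.prems show ?case by cases simp
next
  case (succ x)
  from succ.prems show ?case by cases simp
next
  case (proj i xs)
  from proj.prems show ?case by cases simp
next
  case (comp xs gs ys f y)
  from comp.prems obtain ys' where
    ys': "list_all2 (\<lambda>g y. rec_eval g xs y) gs ys'" "rec_eval f ys' z"
    by cases simp
  have "ys = ys'"
    using comp.IH(1) ys'(1) by (auto simp: list_all2_conv_all_nth intro!: nth_equalityI)
  then show ?case using comp.IH(2) ys'(2) by simp
next
  case (prec_0 f xs y g)
  from prec_0.prems have "rec_eval f xs z" by cases
  then show ?case by (rule prec_0.IH)
next
  case (prec_Suc f g n xs r y)
  from prec_Suc.prems obtain r' where
    r': "rec_eval (RPrec f g) (n # xs) r'" "rec_eval g (n # r' # xs) z"
    by cases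
  then have "r = r'" by (intro prec_Suc.IH(1))
  then show ?case using prec_Suc.IH(2) r'(2) by blast
next
  case (min f n xs)
  from min.prems have
    z: "rec_eval f (z # xs) 0" "\<And>i. i < z \<Longrightarrow> \<exists>v>0. rec_eval f (i # xs) v"
    by (cases, simp)+
  have "\<not> n < z"
  proof
    assume "n < z"
    then obtain v where "v > 0" "rec_eval f (n # xs) v" using z(2) by blast
    then show False using min.IH(1) by blast
  qed
  moreover have "\<not> z < n"
  proof
    assume "z < n"
    then obtain v where "v > 0" "\<forall>w. rec_eval f (z # xs) w \<longrightarrow> v = w" using min.IH(2) by blast
    then show False using z(1) by blast
  qed
  ultimately show ?case by simp
qed

text \<open>
  An algorithm has to give the right answer on all inputs from \<open>I\<close>; its behaviour on other
  inputs (including termination) is irrelevant.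
\<close>

definition decidable_within :: "nat set \<Rightarrow> nat set \<Rightarrow> bool" where
  "decidable_within I A \<longleftrightarrow> (\<exists>f. \<forall>n\<in>I. rec_eval f [n] (if n \<in> A then 1 else 0))"

datatype trm =
    Var nat
  | TZero
  | TOne
  | TConst
  | TAdd trm trm
  | TMul trm trm

datatype fm =
    FEq trm trm
  | FPred trm
  | FNot fm
  | FAnd fm fm
  | FOr fm fm
  | FEx nat fm
  | FAll nat fm

primrec tvars :: "trm \<Rightarrow> nat set" where
  "tvars (Var n) = {n}"
| "tvars TZero = {}"
| "tvars TOne = {}"
| "tvars TConst = {}"
| "tvars (TAdd s t) = tvars s \<union> tvars t"
| "tvars (TMul s t) = tvars s \<union> tvars t"

primrec free_vars :: "fm \<Rightarrow> nat set" where
  "free_vars (FEq s t) = tvars s \<union> tvars t"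
| "free_vars (FPred t) = tvars t"
| "free_vars (FNot \<phi>) = free_vars \<phi>"
| "free_vars (FAnd \<phi> \<psi>) = free_vars \<phi> \<union> free_vars \<psi>"
| "free_vars (FOr \<phi> \<psi>) = free_vars \<phi> \<union> free_vars \<psi>"
| "free_vars (FEx n \<phi>) = free_vars \<phi> - {n}"
| "free_vars (FAll n \<phi>) = free_vars \<phi> - {n}"

primrec quantifier_free :: "fm \<Rightarrow> bool" where
  "quantifier_free (FEq s t) \<longleftrightarrow> True"
| "quantifier_free (FPred t) \<longleftrightarrow> True"
| "quantifier_free (FNot \<phi>) \<longleftrightarrow> quantifier_free \<phi>"
| "quantifier_free (FAnd \<phi> \<psi>) \<longleftrightarrow> quantifier_free \<phi> \<and> quantifier_free \<psi>"
| "quantifier_free (FOr \<phi> \<psi>) \<longleftrightarrow> quantifier_free \<phi> \<and> quantifier_free \<psi>"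
| "quantifier_free (FEx n \<phi>) \<longleftrightarrow> False"
| "quantifier_free (FAll n \<phi>) \<longleftrightarrow> False"

definition existential_sentence :: "fm \<Rightarrow> bool" where
  "existential_sentence \<sigma> \<longleftrightarrow>
     free_vars \<sigma> = {} \<and> (\<exists>ns \<phi>. quantifier_free \<phi> \<and> \<sigma> = foldr FEx ns \<phi>)"

text \<open>
  First-order language of rings with one constant symbol \<open>TConst\<close> and one unary predicate symbol
  \<open>FPred\<close>. The universe of the structure is the whole type, with its ring operations; \<open>c\<close> and \<open>P\<close>
  interpret the constant symbol and the predicate symbol, \<open>e\<close> assigns values to the variables.
\<close>

primrec tval :: "'a \<Rightarrow> (nat \<Rightarrow> 'a) \<Rightarrow> trm \<Rightarrow> 'a::{zero,one,plus,times}" where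
  "tval c e (Var n) = e n"
| "tval c e TZero = 0"
| "tval c e TOne = 1"
| "tval c e TConst = c"
| "tval c e (TAdd s t) = tval c e s + tval c e t"
| "tval c e (TMul s t) = tval c e s * tval c e t"

primrec sat :: "'a::{zero,one,plus,times} \<Rightarrow> 'a set \<Rightarrow> (nat \<Rightarrow> 'a) \<Rightarrow> fm \<Rightarrow> bool" where
  "sat c P e (FEq s t) \<longleftrightarrow> tval c e s = tval c e t"
| "sat c P e (FPred t) \<longleftrightarrow> tval c e t \<in> P"
| "sat c P e (FNot \<phi>) \<longleftrightarrow> \<not> sat c P e \<phi>"
| "sat c P e (FAnd \<phi> \<psi>) \<longleftrightarrow> sat c P e \<phi> \<and> sat c P e \<psi>"
| "sat c P e (FOr \<phi> \<psi>) \<longleftrightarrow> sat c P e \<phi> \<or> sat c P e \<psi>"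
| "sat c P e (FEx n \<phi>) \<longleftrightarrow> (\<exists>x. sat c P (e(n := x)) \<phi>)"
| "sat c P e (FAll n \<phi>) \<longleftrightarrow> (\<forall>x. sat c P (e(n := x)) \<phi>)"

lemma tval_cong: "(\<And>n. n \<in> tvars t \<Longrightarrow> e n = e' n) \<Longrightarrow> tval c e t = tval c e' t"
  by (induction t) auto

lemma sat_cong:
  "(\<And>n. n \<in> free_vars \<phi> \<Longrightarrow> e n = e' n) \<Longrightarrow> sat c P e \<phi> \<longleftrightarrow> sat c P e' \<phi>"
proof (induction \<phi> arbitrary: e e')
  case (FEq s t)
  then show ?case using tval_cong[of s e e' c] tval_cong[of t e e' c] by simp
next
  case (FPred t)
  then show ?case using tval_cong[of t e e' c] by simp
next
  case (FNot \<phi>)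
  then show ?case by (metis free_vars.simps(3) sat.simps(3))
next
  case (FAnd \<phi> \<psi>)
  then show ?case by (metis UnCI free_vars.simps(4) sat.simps(4))
next
  case (FOr \<phi> \<psi>)
  then show ?case by (metis UnCI free_vars.simps(5) sat.simps(5))
next
  case (FEx n \<phi>)
  have "sat c P (e(n := x)) \<phi> \<longleftrightarrow> sat c P (e'(n := x)) \<phi>" for x
    by (rule FEx.IH) (use FEx.prems in auto)
  then show ?case by simp
next
  case (FAll n \<phi>)
  have "sat c P (e(n := x)) \<phi> \<longleftrightarrow> sat c P (e'(n := x)) \<phi>" for x
    by (rule FAll.IH) (use FAll.prems in auto)
  then show ?case by simp
qed

text \<open>By \<open>sat_cong\<close>, the truth value of a sentence does not depend on the assignment \<open>e\<close>.\<close>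

definition Th_ex :: "'a::{zero,one,plus,times} \<Rightarrow> 'a set \<Rightarrow> fm set" where
  "Th_ex c P = {\<sigma>. existential_sentence \<sigma> \<and> (\<forall>e. sat c P e \<sigma>)}"

text \<open>A Goedel numbering of the formulas, built on the Cantor pairing function.\<close>

primrec trm_code :: "trm \<Rightarrow> nat" where
  "trm_code (Var n) = prod_encode (0, n)"
| "trm_code TZero = prod_encode (1, 0)"
| "trm_code TOne = prod_encode (2, 0)"
| "trm_code TConst = prod_encode (3, 0)"
| "trm_code (TAdd s t) = prod_encode (4, prod_encode (trm_code s, trm_code t))"
| "trm_code (TMul s t) = prod_encode (5, prod_encode (trm_code s, trm_code t))"

primrec fm_code :: "fm \<Rightarrow> nat" where
  "fm_code (FEq s t) = prod_encode (0, prod_encode (trm_code s, trm_code t))"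
| "fm_code (FPred t) = prod_encode (1, trm_code t)"
| "fm_code (FNot \<phi>) = prod_encode (2, fm_code \<phi>)"
| "fm_code (FAnd \<phi> \<psi>) = prod_encode (3, prod_encode (fm_code \<phi>, fm_code \<psi>))"
| "fm_code (FOr \<phi> \<psi>) = prod_encode (4, prod_encode (fm_code \<phi>, fm_code \<psi>))"
| "fm_code (FEx n \<phi>) = prod_encode (5, prod_encode (n, fm_code \<phi>))"
| "fm_code (FAll n \<phi>) = prod_encode (6, prod_encode (n, fm_code \<phi>))"

lemma trm_code_eq_iff: "trm_code s = trm_code t \<longleftrightarrow> s = t"
  by (induction s arbitrary: t; case_tac t; simp)

lemma fm_code_eq_iff: "fm_code \<phi> = fm_code \<psi> \<longleftrightarrow> \<phi> = \<psi>"
  by (induction \<phi> arbitrary: \<psi>; case_tac \<psi>; simp add: trm_code_eq_iff)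

end

theory Submission
  imports Defs
begin

text \<open>
  Write \<open>x = 1/\<alpha>\<close>, \<open>d\<close> for the valuation of \<open>\<alpha>\<close>, and let \<open>Q = B\<^sup>2\<close> for a power \<open>B > 3d\<close> of \<open>q\<close>.
  A finite set \<open>S\<close> of natural numbers is represented by the field element \<open>x\<close> to the power
  \<open>\<Sum>i\<in>S. Q ^ i\<close>. Then disjoint union is multiplication, and translation of \<open>S\<close> by \<open>n\<close> raises the
  element to the power \<open>Q ^ n\<close>; as \<open>z ^ Q - z\<close> can only have poles of order divisible by \<open>Q\<close>,
  Artin-Schreier equations recognize the latter relation even for variable \<open>n\<close>.
  The representatives of sets themselves are recognized as the monomials of the polynomial
  \<open>\<Theta> = (\<Prod>i<m. 1 + x ^ Q ^ i)\<close>, a solution of \<open>\<Theta> ^ Q * (1 + x) = \<Theta> * (1 + x ^ Q ^ m)\<close>: modulo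
  elements \<open>z ^ Q - z + x * g ^ Q + \<alpha> * h ^ Q\<close>, the product of \<open>\<Theta>\<close> with a power of \<open>\<alpha>\<close> reduces to its
  constant coefficient.

  Finite sets under disjoint union and translation suffice to write down the history of a
  computation. So every partial recursive graph is existentially definable, and a decision procedure
  for the existential theory could be applied to a sentence asserting its own rejection.
\<close>

subsection \<open>Numbers attached to points\<close>

text \<open>An existential formula offers no bounded universal quantifier over the steps of a
  computation. The way out: one equation between finite sets speaks about all their elements at
  once. A function is therefore evaluated simultaneously at all points of a set, and an iteration is
  one such evaluation of its step function at all points of its walks. Numbers are lengths of runs
  because disjoint union and translation suffice to copy, increment and compare such lengths.

  On the field side the obstacle is that the characteristic may divide the valuation
  \<open>d\<close> of \<open>\<alpha>\<close>. Valuations then show that \<open>Q\<close> divides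
  \<open>d * n\<close>, but in general not that \<open>Q\<close> divides \<open>n\<close>. As
  \<open>d < B\<close>, at least half of \<open>Q = B * B\<close> survives and \<open>B\<close>
  divides \<open>n\<close>; to recognize powers and codes, the missing half comes from repeating a
  condition with \<open>B\<close>-th powers. The bound \<open>3 * d < B\<close> keeps
  \<open>d * u\<close>, \<open>2 * d * u\<close> and \<open>3 * d * u\<close> from being multiples
  of \<open>Q\<close> for \<open>u = 1\<close> and \<open>u = B\<close>; these are the differences
  of valuations that must not vanish modulo \<open>Q\<close>.\<close>

text \<open>A set \<open>U\<close> attaches to a point \<open>x \<in> X\<close> the length of the run of \<open>U\<close> that starts at \<open>x\<close>; in a valued
  pair every run starts at a point of \<open>X\<close> and ends before the next one.\<close>

definition valued :: "nat set \<Rightarrow> nat set \<Rightarrow> bool" where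
  "valued X U \<longleftrightarrow> X \<inter> Suc ` U = {} \<and> U \<subseteq> X \<union> Suc ` U"

definition val :: "nat set \<Rightarrow> nat \<Rightarrow> nat" where
  "val U x = (LEAST m. x + m \<notin> U)"

definition blocks :: "nat set \<Rightarrow> (nat \<Rightarrow> nat) \<Rightarrow> nat set" where
  "blocks X v = {m. \<exists>x\<in>X. x \<le> m \<and> m < x + v x}"

lemma val_notin: "finite U \<Longrightarrow> x + val U x \<notin> U"
proof -
  assume "finite U"
  then have "\<exists>m. x + m \<notin> U"
    by (metis finite_nat_set_iff_bounded not_add_less2)
  then show ?thesis unfolding val_def by (rule LeastI_ex)
qed

lemma val_in: "m < val U x \<Longrightarrow> x + m \<in> U"
  unfolding val_def using not_less_Least by blast

lemma val_eqI:
  assumes "\<And>m. m < n \<Longrightarrow> x + m \<in> U" "x + n \<notin> U"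
  shows "val U x = n"
  unfolding val_def
  by (rule Least_equality) (use assms in \<open>auto simp: not_less[symmetric]\<close>)

lemma val_empty [simp]: "val {} x = 0"
  by (rule val_eqI) auto

lemma val_shift: "val ((+) w ` U) (w + x) = val U x"
proof -
  have "w + x + m \<in> (+) w ` U \<longleftrightarrow> x + m \<in> U" for m
    by (auto simp: add.assoc)
  then show ?thesis by (simp add: val_def)
qed

text \<open>Stepping left from an element of \<open>U\<close> stays inside \<open>U\<close> until a
  point of \<open>X\<close> is met. Hence \<open>U\<close> carries no information beyond its values
  on \<open>X\<close>.\<close>

lemma valued_eq_blocks:
  assumes "finite U" "valued X U"
  shows "U = blocks X (val U)"
proof (intro equalityI subsetI)
  fix m assume "m \<in> U"
  then show "m \<in> blocks X (val U)"
  proof (induction m)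
    case 0
    then have "0 \<in> X" using assms(2) unfolding valued_def by auto
    moreover have "0 < val U 0"
      using 0 val_notin[OF assms(1), of 0] by (cases "val U 0 = 0") auto
    ultimately show ?case unfolding blocks_def by auto
  next
    case (Suc m)
    show ?case
    proof (cases "Suc m \<in> X")
      case True
      moreover have "0 < val U (Suc m)"
        using Suc.prems val_notin[OF assms(1), of "Suc m"] by (cases "val U (Suc m) = 0") auto
      ultimately show ?thesis unfolding blocks_def by auto
    next
      case False
      then have "m \<in> U" using Suc.prems assms(2) unfolding valued_def by auto
      then obtain x where x: "x \<in> X" "x \<le> m" "m < x + val U x"
        using Suc.IH unfolding blocks_def by blast
      have "Suc m \<noteq> x + val U x" using val_notin[OF assms(1), of x] Suc.prems by metis
      with x show ?thesis unfolding blocks_def by (auto intro!: bexI[of _ x])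
    qed
  qed
next
  fix m assume "m \<in> blocks X (val U)"
  then obtain x where "x \<in> X" "x \<le> m" "m < x + val U x" unfolding blocks_def by blast
  then show "m \<in> U" using val_in[of "m - x" U x] by auto
qed

lemma finite_blocks [intro, simp]: "finite X \<Longrightarrow> finite (blocks X v)"
proof -
  assume "finite X"
  moreover have "blocks X v = (\<Union>x\<in>X. {x..<x + v x})" unfolding blocks_def by auto
  ultimately show ?thesis by simp
qed

definition gapped :: "nat \<Rightarrow> nat set \<Rightarrow> bool" where
  "gapped G X \<longleftrightarrow> (\<forall>x\<in>X. \<forall>y\<in>X. x < y \<longrightarrow> x + G \<le> y)"

lemma gapped_mono: "gapped G X \<Longrightarrow> H \<le> G \<Longrightarrow> Y \<subseteq> X \<Longrightarrow> gapped H Y"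
  unfolding gapped_def by (meson add_le_mono le_refl order_trans subsetD)

lemma val_blocks:
  assumes "gapped G X" "\<And>x. x \<in> X \<Longrightarrow> v x < G" "x \<in> X"
  shows "val (blocks X v) x = v x"
proof (rule val_eqI)
  show "x + m \<in> blocks X v" if "m < v x" for m
    using that assms(3) unfolding blocks_def by (auto intro!: bexI[of _ x])
  show "x + v x \<notin> blocks X v"
  proof
    assume "x + v x \<in> blocks X v"
    then obtain y where y: "y \<in> X" "y \<le> x + v x" "x + v x < y + v y"
      unfolding blocks_def by blast
    have "v x < G" "v y < G" using assms(2,3) y by auto
    consider "x < y" | "y < x" | "x = y" by linarith
    then show False
    proof cases
      case 1 then have "x + G \<le> y" using assms(1,3) y(1) unfolding gapped_def by blast
      then show False using y \<open>v x < G\<close> by linarith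
    next
      case 2 then have "y + G \<le> x" using assms(1,3) y(1) unfolding gapped_def by blast
      then show False using y \<open>v y < G\<close> by linarith
    qed (use y in auto)
  qed
qed

lemma valued_blocks:
  assumes "gapped G X" "\<And>x. x \<in> X \<Longrightarrow> v x < G"
  shows "valued X (blocks X v)"
  unfolding valued_def
proof
  show "X \<inter> Suc ` blocks X v = {}"
  proof (rule ccontr)
    assume "\<not> ?thesis"
    then obtain m x where m: "Suc m \<in> X" "x \<in> X" "x \<le> m" "m < x + v x"
      unfolding blocks_def by blast
    then have "x + G \<le> Suc m" using assms(1) unfolding gapped_def by force
    then show False using assms(2)[OF m(2)] m(4) by linarith
  qed
  show "blocks X v \<subseteq> X \<union> Suc ` blocks X v"
  proof
    fix m assume "m \<in> blocks X v"
    then obtain x where x: "x \<in> X" "x \<le> m" "m < x + v x" unfolding blocks_def by blast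
    show "m \<in> X \<union> Suc ` blocks X v"
    proof (cases "m = x")
      case False
      then have "m - 1 \<in> blocks X v" using x unfolding blocks_def by (auto intro!: bexI[of _ x])
      moreover have "m = Suc (m - 1)" using False x by auto
      ultimately show ?thesis by blast
    qed (use x in auto)
  qed
qed

lemma blocks_cong: "(\<And>x. x \<in> X \<Longrightarrow> v x = v' x) \<Longrightarrow> blocks X v = blocks X v'"
  unfolding blocks_def by auto

lemma blocks_disjoint:
  assumes "gapped G (X \<union> Z)" "\<And>x. x \<in> X \<union> Z \<Longrightarrow> v x < G" "X \<inter> Z = {}"
  shows "blocks X v \<inter> blocks Z v = {}"
proof (rule ccontr)
  assume "\<not> ?thesis"
  then obtain m x z where m: "x \<in> X" "x \<le> m" "m < x + v x" "z \<in> Z" "z \<le> m" "m < z + v z"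
    unfolding blocks_def by blast
  then have "x \<noteq> z" using assms(3) by blast
  then have "x + G \<le> z \<or> z + G \<le> x"
    using assms(1) m unfolding gapped_def by (metis UnCI linorder_neqE_nat)
  then show False using assms(2)[of x] assms(2)[of z] m by auto
qed

text \<open>Adding \<open>V\<close> could lengthen a run of \<open>U\<close> in two ways: a run of
  \<open>V\<close> reaches \<open>x\<close> from the left, or the run of \<open>x\<close> reaches a
  point of \<open>Z\<close>. In both cases a point is immediately preceded by an element of the
  union, which the validity of the union forbids.\<close>

lemma val_Un_left:
  assumes "valued X U" "valued Z V" "X \<inter> Z = {}" "valued (X \<union> Z) (U \<union> V)"
    "finite U" "finite V" "x \<in> X"
  shows "val (U \<union> V) x = val U x"
proof (rule val_eqI)
  show "x + m \<in> U \<union> V" if "m < val U x" for m using val_in[OF that] by blast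
  show "x + val U x \<notin> U \<union> V"
  proof
    assume "x + val U x \<in> U \<union> V"
    then have "x + val U x \<in> V" using val_notin[OF assms(5)] by blast
    then obtain z where z: "z \<in> Z" "z \<le> x + val U x" "x + val U x < z + val V z"
      using valued_eq_blocks[OF assms(6,2)] unfolding blocks_def by blast
    have "z \<noteq> x" using assms(3,7) z(1) by blast
    show False
    proof (cases "z < x")
      case True
      then have "x - 1 \<in> V" using z val_in[of "x - 1 - z" V z] by auto
      moreover have "x = Suc (x - 1)" using True by simp
      ultimately have "x \<in> Suc ` (U \<union> V)" by blast
      then show False using assms(4,7) unfolding valued_def by blast
    next
      case False
      then have "z - 1 \<in> U" using \<open>z \<noteq> x\<close> z val_in[of "z - 1 - x" U x] by auto
      moreover have "z = Suc (z - 1)" using False \<open>z \<noteq> x\<close> by simp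
      ultimately have "z \<in> Suc ` (U \<union> V)" by blast
      then show False using assms(4) z(1) unfolding valued_def by blast
    qed
  qed
qed

lemma valued_shift:
  assumes "valued X U"
  shows "valued ((+) w ` X) ((+) w ` U)"
proof -
  have eq: "Suc ` (+) w ` U = (+) w ` Suc ` U" by (auto simp: image_image)
  have "(+) w ` X \<inter> (+) w ` Suc ` U = (+) w ` (X \<inter> Suc ` U)"
    by (rule image_Int[symmetric]) simp
  then have "(+) w ` X \<inter> (+) w ` Suc ` U = {}" using assms unfolding valued_def by simp
  moreover have "(+) w ` U \<subseteq> (+) w ` (X \<union> Suc ` U)"
    using assms unfolding valued_def by (intro image_mono) simp
  ultimately show ?thesis unfolding valued_def eq image_Un by simp
qed

lemma val_disjoint_Un:
  assumes "valued X U" "valued Z V" "X \<inter> Z = {}" "valued (X \<union> Z) (U \<union> V)"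
    "finite U" "finite V"
  shows "x \<in> X \<Longrightarrow> val (U \<union> V) x = val U x" "x \<in> Z \<Longrightarrow> val (U \<union> V) x = val V x"
  using val_Un_left[OF assms] val_Un_left[of Z V X U x] assms by (auto simp: Un_commute)

lemma val_incr:
  assumes "finite S" "valued X (X \<union> Suc ` S)" "x \<in> X"
  shows "val (X \<union> Suc ` S) x = Suc (val S x)"
proof (rule val_eqI)
  show "x + m \<in> X \<union> Suc ` S" if "m < Suc (val S x)" for m
    using that assms(3) val_in[of "m - 1" S x] by (cases m) auto
  have "x + val S x \<in> X \<union> Suc ` S"
    using assms(3) val_in[of "val S x - 1" S x] by (cases "val S x") auto
  then have "x + Suc (val S x) \<notin> X" using assms(2) unfolding valued_def by (metis IntI add_Suc_right empty_iff imageI)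
  moreover have "x + Suc (val S x) \<notin> Suc ` S" using val_notin[OF assms(1), of x] by auto
  ultimately show "x + Suc (val S x) \<notin> X \<union> Suc ` S" by blast
qed

lemma blocks_incr: "blocks X (\<lambda>x. Suc (v x)) = X \<union> Suc ` blocks X v"
proof (intro equalityI subsetI)
  fix m assume "m \<in> blocks X (\<lambda>x. Suc (v x))"
  then obtain x where x: "x \<in> X" "x \<le> m" "m < x + Suc (v x)" unfolding blocks_def by blast
  show "m \<in> X \<union> Suc ` blocks X v"
  proof (cases "m = x")
    case False
    then have "m - 1 \<in> blocks X v" using x unfolding blocks_def by (auto intro!: bexI[of _ x])
    moreover have "m = Suc (m - 1)" using False x by auto
    ultimately show ?thesis by blast
  qed (use x in auto)
next
  fix m assume "m \<in> X \<union> Suc ` blocks X v"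
  then obtain x where "x \<in> X" "x \<le> m" "m < x + Suc (v x)" unfolding blocks_def by force
  then show "m \<in> blocks X (\<lambda>x. Suc (v x))" unfolding blocks_def by blast
qed

section \<open>Tables of values laid out along walks of constant step width\<close>

definition points :: "nat \<Rightarrow> (nat \<times> nat) set \<Rightarrow> nat set" where
  "points w C = (\<lambda>(x, j). x + j * w) ` C"

text \<open>A pair \<open>(x, j)\<close> is a cell, namely column \<open>j\<close> of the row that
  starts at \<open>x\<close>. Its entry \<open>F x j\<close> is written as a run that starts at the
  position of the cell.\<close>

definition layout :: "nat \<Rightarrow> (nat \<times> nat) set \<Rightarrow> (nat \<Rightarrow> nat \<Rightarrow> nat) \<Rightarrow> nat set" where
  "layout w C F = {m. \<exists>(x, j)\<in>C. x + j * w \<le> m \<and> m < x + j * w + F x j}"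

lemma layout_cong: "(\<And>x j. (x, j) \<in> C \<Longrightarrow> F x j = H x j) \<Longrightarrow> layout w C F = layout w C H"
  unfolding layout_def by fastforce

lemma layout_eq_blocks:
  "(\<And>x j. (x, j) \<in> C \<Longrightarrow> v (x + j * w) = F x j) \<Longrightarrow> layout w C F = blocks (points w C) v"
  unfolding layout_def blocks_def points_def by fastforce

lemma finite_points: "finite C \<Longrightarrow> finite (points w C)"
  unfolding points_def by simp

lemma pts_Un: "points w (C \<union> D) = points w C \<union> points w D"
  unfolding points_def by auto

lemma lay_Un: "layout w (C \<union> D) F = layout w C F \<union> layout w D F"
  unfolding layout_def by auto

text \<open>The gap between points of \<open>X\<close> leaves room for \<open>N + 1\<close> cells of
  width \<open>w\<close>, one for each column from \<open>0\<close> to \<open>N\<close>.\<close>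

context
  fixes w N :: nat and X :: "nat set"
  assumes w: "0 < w" and gap: "gapped (Suc N * w) X"
begin

lemma points_less:
  assumes "x \<in> X" "x' \<in> X" "j \<le> N" "x < x'"
  shows "x + j * w + w \<le> x' + j' * w"
proof -
  have "x + Suc N * w \<le> x'" using gap assms unfolding gapped_def by blast
  then have "x + (w + N * w) \<le> x'" by simp
  moreover have "j * w \<le> N * w" using assms(3) by (rule mult_le_mono1)
  ultimately show ?thesis by linarith
qed

lemma points_less2:
  assumes "j < j'"
  shows "x + j * w + w \<le> x + j' * w"
proof -
  have "Suc j * w \<le> j' * w" using assms by (intro mult_le_mono1) simp
  then show ?thesis by simp
qed

lemma inj_points:
  assumes "C \<subseteq> X \<times> {..N}"
  shows "inj_on (\<lambda>(x, j). x + j * w) C"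
proof (rule inj_onI, clarsimp)
  fix x j x' j' assume *: "(x, j) \<in> C" "(x', j') \<in> C" "x + j * w = x' + j' * w"
  then have "x = x'"
    using points_less[of x x' j j'] points_less[of x' x j' j] assms w by (cases x x' rule: linorder_cases) auto
  moreover have "j = j'" using * w \<open>x = x'\<close> by simp
  ultimately show "x = x' \<and> j = j'" by simp
qed

lemma gapped_points:
  assumes "C \<subseteq> X \<times> {..N}"
  shows "gapped w (points w C)"
  unfolding gapped_def points_def
proof (clarsimp)
  fix x j x' j' assume *: "(x, j) \<in> C" "(x', j') \<in> C" "x + j * w < x' + j' * w"
  show "x + j * w + w \<le> x' + j' * w"
  proof (cases x x' rule: linorder_cases)
    case less
    then show ?thesis using points_less[of x x' j j'] * assms by auto
  next
    case equal
    then have "j < j'" using * by simp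
    then show ?thesis using points_less2 equal by blast
  next
    case greater
    then show ?thesis using points_less[of x' x j' j] * assms by auto
  qed
qed

lemma layout_blocks:
  assumes "C \<subseteq> X \<times> {..N}"
  obtains v where "\<And>x j. (x, j) \<in> C \<Longrightarrow> v (x + j * w) = F x j"
proof
  fix x j assume "(x, j) \<in> C"
  then show "(\<lambda>y. case the_inv_into C (\<lambda>(x, j). x + j * w) y of (x, j) \<Rightarrow> F x j) (x + j * w) = F x j"
    using the_inv_into_f_f[OF inj_points[OF assms], of "(x, j)"] by simp
qed

lemma
  assumes C: "C \<subseteq> X \<times> {..N}" and F: "\<And>x j. (x, j) \<in> C \<Longrightarrow> F x j < w"
  shows valued_layout: "valued (points w C) (layout w C F)"
    and val_layout: "(x, j) \<in> C \<Longrightarrow> val (layout w C F) (x + j * w) = F x j"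
    and finite_layout: "finite C \<Longrightarrow> finite (layout w C F)"
proof -
  obtain v where v: "\<And>x j. (x, j) \<in> C \<Longrightarrow> v (x + j * w) = F x j" by (rule layout_blocks[OF C, where F = F]) blast
  have eq: "layout w C F = blocks (points w C) v" by (rule layout_eq_blocks) (rule v)
  have less: "v y < w" if "y \<in> points w C" for y using that v F unfolding points_def by force
  show "valued (points w C) (layout w C F)" unfolding eq by (rule valued_blocks[OF gapped_points[OF C] less])
  show "val (layout w C F) (x + j * w) = F x j" if "(x, j) \<in> C"
    unfolding eq v[OF that, symmetric]
    by (rule val_blocks[OF gapped_points[OF C] less]) (use that in \<open>force simp: points_def\<close>)+
  show "finite C \<Longrightarrow> finite (layout w C F)" unfolding eq using finite_points by blast
qed

lemma layout_disjoint:
  assumes C: "C \<union> D \<subseteq> X \<times> {..N}" and F: "\<And>x j. (x, j) \<in> C \<union> D \<Longrightarrow> F x j < w" and "C \<inter> D = {}"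
  shows "layout w C F \<inter> layout w D F = {}"
proof -
  obtain v where v: "\<And>x j. (x, j) \<in> C \<union> D \<Longrightarrow> v (x + j * w) = F x j" by (rule layout_blocks[OF C, where F = F]) blast
  have eq: "layout w C F = blocks (points w C) v" "layout w D F = blocks (points w D) v"
    by (rule layout_eq_blocks, use v in blast)+
  have less: "v y < w" if "y \<in> points w C \<union> points w D" for y using that v F unfolding points_def by force
  have "points w C \<inter> points w D = {}"
    using inj_on_image_Int[OF inj_points[OF C], of C D] assms(3) unfolding points_def by simp
  then show ?thesis unfolding eq
    by (intro blocks_disjoint[OF _ less]) (use gapped_points[OF C] in \<open>simp_all add: pts_Un\<close>)
qed

lemma points_disjoint: "C \<union> D \<subseteq> X \<times> {..N} \<Longrightarrow> C \<inter> D = {} \<Longrightarrow> points w C \<inter> points w D = {}"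
  using inj_on_image_Int[OF inj_points, of "C \<union> D" C D] unfolding points_def by simp

end

definition next_col :: "(nat \<times> nat) set \<Rightarrow> (nat \<times> nat) set" where
  "next_col C = (\<lambda>(x, j). (x, Suc j)) ` C"

lemma points_next_col: "points w (next_col C) = (+) w ` points w C"
  unfolding points_def next_col_def by (force simp: image_iff algebra_simps)

text \<open>What column \<open>j\<close> stores for its successor becomes, after translation by
  \<open>w\<close>, the entry of column \<open>Suc j\<close>. A single translation thus performs one
  step of all walks simultaneously.\<close>

lemma layout_next_col: "layout w (next_col C) F = (+) w ` layout w C (\<lambda>x j. F x (Suc j))"
proof (intro equalityI subsetI)
  fix m assume "m \<in> layout w (next_col C) F"
  then obtain x j where "(x, j) \<in> C" "x + Suc j * w \<le> m" "m < x + Suc j * w + F x (Suc j)"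
    unfolding layout_def next_col_def by auto
  then have "m - w \<in> layout w C (\<lambda>x j. F x (Suc j))" "m = w + (m - w)"
    unfolding layout_def by (auto intro!: bexI[of _ "(x, j)"])
  then show "m \<in> (+) w ` layout w C (\<lambda>x j. F x (Suc j))" by blast
next
  fix m assume "m \<in> (+) w ` layout w C (\<lambda>x j. F x (Suc j))"
  then obtain m' x j where "(x, j) \<in> C" "x + j * w \<le> m'" "m' < x + j * w + F x (Suc j)" "m = w + m'"
    unfolding layout_def by auto
  then show "m \<in> layout w (next_col C) F"
    unfolding layout_def next_col_def by (auto intro!: bexI[of _ "(x, j)"])
qed

lemma layout_incr: "layout w C (\<lambda>x j. Suc (F x j)) = points w C \<union> Suc ` layout w C F"
proof (intro equalityI subsetI)
  fix m assume "m \<in> layout w C (\<lambda>x j. Suc (F x j))"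
  then obtain x j where x: "(x, j) \<in> C" "x + j * w \<le> m" "m < x + j * w + Suc (F x j)"
    unfolding layout_def by auto
  show "m \<in> points w C \<union> Suc ` layout w C F"
  proof (cases "m = x + j * w")
    case False
    then have "m - 1 \<in> layout w C F" using x unfolding layout_def by (auto intro!: bexI[of _ "(x, j)"])
    moreover have "m = Suc (m - 1)" using False x by auto
    ultimately show ?thesis by blast
  qed (use x in \<open>force simp: points_def\<close>)
next
  fix m assume "m \<in> points w C \<union> Suc ` layout w C F"
  then obtain x j where "(x, j) \<in> C" "x + j * w \<le> m" "m < x + j * w + Suc (F x j)"
    unfolding layout_def points_def by force
  then show "m \<in> layout w C (\<lambda>x j. Suc (F x j))" unfolding layout_def by blast
qed

text \<open>The interface between computations and the field: conjunction, quantifiers over finite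
  sets and a few atomic relations. Negation, disjunction and universal quantifiers are absent. In
  the translation relation the offset is itself a variable, given as a singleton, so step widths can
  be quantified.\<close>

locale set_definability =
  fixes set_definable :: "((nat \<Rightarrow> nat set) \<Rightarrow> bool) \<Rightarrow> bool"
  assumes set_definable_conj: "set_definable R \<Longrightarrow> set_definable S \<Longrightarrow> set_definable (\<lambda>e. R e \<and> S e)"
    and set_definable_cong: "set_definable R \<Longrightarrow> (\<And>e. (\<And>i. finite (e i)) \<Longrightarrow> R e = S e) \<Longrightarrow> set_definable S"
    and sd_True: "set_definable (\<lambda>_. True)"
    and set_definable_ex: "\<And>R. set_definable (\<lambda>e. R (\<lambda>i. e (Suc i)) (e 0)) \<Longrightarrow> set_definable (\<lambda>e. \<exists>S. finite S \<and> R e S)"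
    and set_definable_union: "\<And>i j k. set_definable (\<lambda>e. e i = e j \<union> e k \<and> e j \<inter> e k = {})"
    and sd_Suc: "\<And>i j. set_definable (\<lambda>e. e i = Suc ` e j)"
    and set_definable_shift: "\<And>i j k. set_definable (\<lambda>e. \<exists>w. e i = {w} \<and> e k = (+) w ` e j)"
    and set_definable_zero: "\<And>i. set_definable (\<lambda>e. e i = {0})"
begin

text \<open>Variables behave like de Bruijn indices: the new sets occupy the indices below
  \<open>l\<close>, and the old ones move up by \<open>l\<close>.\<close>

lemma set_definable_ex_list:
  assumes "set_definable (\<lambda>e. P (\<lambda>i. e (l + i)) (map e [0..<l]))"
  shows "set_definable (\<lambda>e. \<exists>Ts. length Ts = l \<and> (\<forall>T\<in>set Ts. finite T) \<and> P e Ts)"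
  using assms
proof (induction l arbitrary: P)
  case 0
  then show ?case by simp
next
  case (Suc l)
  have "set_definable (\<lambda>e. \<exists>T. finite T \<and> (\<exists>Ts. length Ts = l \<and> (\<forall>T\<in>set Ts. finite T) \<and> P e (Ts @ [T])))"
  proof (rule set_definable_ex, rule Suc.IH)
    show "set_definable (\<lambda>e. P (\<lambda>i. e (l + Suc i)) (map e [0..<l] @ [e (l + 0)]))"
      using Suc.prems by simp
  qed
  moreover have "(\<exists>T. finite T \<and> (\<exists>Ts. length Ts = l \<and> (\<forall>T\<in>set Ts. finite T) \<and> P e (Ts @ [T])))
    \<longleftrightarrow> (\<exists>Ts. length Ts = Suc l \<and> (\<forall>T\<in>set Ts. finite T) \<and> P e Ts)" (is "?L \<longleftrightarrow> ?R") for e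
  proof
    assume ?L
    then obtain T Ts where "finite T" "length Ts = l" "\<forall>T\<in>set Ts. finite T" "P e (Ts @ [T])"
      by blast
    then show ?R by (intro exI[of _ "Ts @ [T]"]) auto
  next
    assume ?R
    then obtain Ts where Ts: "length Ts = Suc l" "\<forall>T\<in>set Ts. finite T" "P e Ts" by blast
    then obtain Us U where "Ts = Us @ [U]" by (metis length_Suc_conv_rev)
    with Ts show ?L by auto
  qed
  ultimately show ?case by simp
qed

lemma set_definable_all: "(\<And>i. i < (n::nat) \<Longrightarrow> set_definable (R i)) \<Longrightarrow> set_definable (\<lambda>e. \<forall>i<n. R i e)"
proof (induction n)
  case 0
  then show ?case using sd_True by simp
next
  case (Suc n)
  have "(\<forall>i<Suc n. R i e) \<longleftrightarrow> (\<forall>i<n. R i e) \<and> R n e" for e by (auto simp: less_Suc_eq)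
  then show ?case using Suc set_definable_conj[of "\<lambda>e. \<forall>i<n. R i e" "R n"] by simp
qed

text \<open>A set is the disjoint union of itself with itself only if it is empty.\<close>

lemma set_definable_empty: "set_definable (\<lambda>e. e i = {})"
  by (rule set_definable_cong[OF set_definable_union[of i i i]]) auto

lemma set_definable_eq: "set_definable (\<lambda>e. e i = e j)"
proof -
  have "set_definable (\<lambda>e. \<exists>S. finite S \<and> S = {} \<and> e i = e j \<union> S \<and> e j \<inter> S = {})"
    by (intro set_definable_ex set_definable_conj set_definable_empty set_definable_union)
  then show ?thesis by (rule set_definable_cong) auto
qed

lemma set_definable_subset: "set_definable (\<lambda>e. e i \<subseteq> e j)"
proof -
  have "set_definable (\<lambda>e. \<exists>S. finite S \<and> e j = e i \<union> S \<and> e i \<inter> S = {})"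
    by (intro set_definable_ex set_definable_conj set_definable_union)
  then show ?thesis
  proof (rule set_definable_cong)
    fix e :: "nat \<Rightarrow> nat set" assume "\<And>i. finite (e i)"
    then show "(\<exists>S. finite S \<and> e j = e i \<union> S \<and> e i \<inter> S = {}) = (e i \<subseteq> e j)"
      by (auto intro!: exI[of _ "e j - e i"])
  qed
qed

lemma set_definable_incr: "set_definable (\<lambda>e. e k = e i \<union> Suc ` e j \<and> e i \<inter> Suc ` e j = {})"
proof -
  have "set_definable (\<lambda>e. \<exists>V. finite V \<and> V = Suc ` e j \<and> e k = e i \<union> V \<and> e i \<inter> V = {})"
    by (intro set_definable_ex set_definable_conj set_definable_union sd_Suc)
  then show ?thesis by (rule set_definable_cong) auto
qed

lemma set_definable_valued: "set_definable (\<lambda>e. valued (e i) (e j))"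
proof -
  have "set_definable (\<lambda>e. \<exists>Z. finite Z \<and> (Z = e i \<union> Suc ` e j \<and> e i \<inter> Suc ` e j = {}) \<and> e j \<subseteq> Z)"
    by (intro set_definable_ex set_definable_conj set_definable_incr set_definable_subset)
  then show ?thesis by (rule set_definable_cong) (auto simp: valued_def)
qed

section \<open>Evaluation of a recursive function at many points at once\<close>

definition set_definable_relation :: "nat \<Rightarrow> (nat set \<Rightarrow> nat set list \<Rightarrow> nat set \<Rightarrow> bool) \<Rightarrow> bool" where
  "set_definable_relation k R \<longleftrightarrow> (\<forall>a ss t. length ss = k \<longrightarrow> set_definable (\<lambda>e. R (e a) (map e ss) (e t)))"

lemma set_definable_relationD: "set_definable_relation k R \<Longrightarrow> length ss = k \<Longrightarrow> set_definable (\<lambda>e. R (e a) (map e ss) (e t))"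
  unfolding set_definable_relation_def by blast

definition inputs :: "nat \<Rightarrow> nat set \<Rightarrow> nat set list \<Rightarrow> bool" where
  "inputs k X Ss \<longleftrightarrow> finite X \<and> length Ss = k \<and> (\<forall>S\<in>set Ss. finite S \<and> valued X S)"

definition args :: "nat set list \<Rightarrow> nat \<Rightarrow> nat list" where
  "args Ss x = map (\<lambda>S. val S x) Ss"

text \<open>There is no gap condition here: however the auxiliary sets are chosen, a relation that
  holds certifies all values. The conclusion includes \<open>valued X T\<close> because intermediate
  results are quantified sets about which only finiteness is known.\<close>

definition sound :: "nat \<Rightarrow> recf \<Rightarrow> (nat set \<Rightarrow> nat set list \<Rightarrow> nat set \<Rightarrow> bool) \<Rightarrow> bool" where
  "sound k f R \<longleftrightarrow> (\<forall>X Ss T. inputs k X Ss \<longrightarrow> finite T \<longrightarrow> R X Ss T \<longrightarrow>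
     valued X T \<and> (\<forall>x\<in>X. rec_eval f (args Ss x) (val T x)))"

text \<open>Completeness can only be expected when the points are far apart, because an iteration lays out
  its intermediate values between consecutive points.\<close>

definition covers :: "nat \<Rightarrow> (nat set \<Rightarrow> nat set list \<Rightarrow> nat set \<Rightarrow> bool) \<Rightarrow> (nat list \<times> nat) set \<Rightarrow> nat \<Rightarrow> bool" where
  "covers k R A G \<longleftrightarrow> (\<forall>X Ss T. inputs k X Ss \<longrightarrow> gapped G X \<longrightarrow> finite T \<longrightarrow> valued X T \<longrightarrow>
     (\<forall>x\<in>X. (args Ss x, val T x) \<in> A) \<longrightarrow> R X Ss T)"

text \<open>The gap may depend on the finite part \<open>A\<close> of the graph, but not on
  \<open>X\<close>. An iteration applies the inner relation to the points of a layout, and the step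
  width of that layout has to be chosen from the inner gap.\<close>

definition complete :: "nat \<Rightarrow> recf \<Rightarrow> (nat set \<Rightarrow> nat set list \<Rightarrow> nat set \<Rightarrow> bool) \<Rightarrow> bool" where
  "complete k f R \<longleftrightarrow>
     (\<forall>A. finite A \<longrightarrow> (\<forall>(xs, y)\<in>A. rec_eval f xs y) \<longrightarrow> (\<exists>G. covers k R A G))"

lemma coversD:
  "covers k R A G \<Longrightarrow> inputs k X Ss \<Longrightarrow> gapped G X \<Longrightarrow> finite T \<Longrightarrow> valued X T \<Longrightarrow>
    (\<And>x. x \<in> X \<Longrightarrow> (args Ss x, val T x) \<in> A) \<Longrightarrow> R X Ss T"
  unfolding covers_def by blast

definition parallel :: "nat \<Rightarrow> recf \<Rightarrow> bool" where
  "parallel k f \<longleftrightarrow> (\<exists>R. set_definable_relation k R \<and> sound k f R \<and> complete k f R)"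

lemma valued_empty: "valued X {}"
  by (simp add: valued_def)

lemma valued_val_eq:
  assumes "finite U" "finite V" "valued X U" "valued X V" "\<And>x. x \<in> X \<Longrightarrow> val U x = val V x"
  shows "U = V"
proof -
  have "U = blocks X (val U)" by (rule valued_eq_blocks[OF assms(1,3)])
  also have "\<dots> = blocks X (val V)" by (rule blocks_cong[OF assms(5)])
  also have "\<dots> = V" by (rule valued_eq_blocks[OF assms(2,4), symmetric])
  finally show ?thesis .
qed

lemma parallel_RZero: "parallel k RZero"
  unfolding parallel_def
proof (intro exI conjI)
  let ?R = "\<lambda>X Ss T :: nat set. T = {}"
  show "set_definable_relation k ?R" unfolding set_definable_relation_def using set_definable_empty by simp
  show "sound k RZero ?R"
    unfolding sound_def by (auto simp: valued_empty intro: rec_eval.zero)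
  show "complete k RZero ?R"
    unfolding complete_def covers_def
  proof (intro allI impI exI)
    fix A :: "(nat list \<times> nat) set" and X T :: "nat set" and Ss :: "nat set list"
    assume *: "\<forall>(xs, y)\<in>A. rec_eval RZero xs y" "finite T" "valued X T"
      "\<forall>x\<in>X. (args Ss x, val T x) \<in> A"
    show "T = {}"
    proof (rule valued_val_eq[of _ _ X])
      fix x assume "x \<in> X"
      then have "rec_eval RZero (args Ss x) (val T x)" using * by blast
      then show "val T x = val {} x" by cases simp
    qed (use * valued_empty in auto)
  qed
qed

text \<open>A \<open>recf\<close> has no fixed arity, so \<open>parallel k f\<close> is also claimed
  for numbers of arguments on which \<open>f\<close> never returns. There the empty set of points is
  the only admissible one.\<close>

lemma parallel_False:
  assumes "\<And>xs y. length xs = k \<Longrightarrow> \<not> rec_eval f xs y"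
  shows "parallel k f"
  unfolding parallel_def
proof (intro exI conjI)
  let ?R = "\<lambda>(X :: nat set) (Ss :: nat set list) (T :: nat set). X = {} \<and> T = {}"
  show "set_definable_relation k ?R" unfolding set_definable_relation_def using set_definable_empty set_definable_conj by simp
  show "sound k f ?R" unfolding sound_def by (auto simp: valued_empty)
  show "complete k f ?R"
    unfolding complete_def covers_def
  proof (intro allI impI exI)
    fix A :: "(nat list \<times> nat) set" and X T :: "nat set" and Ss :: "nat set list"
    assume *: "\<forall>(xs, y)\<in>A. rec_eval f xs y" "inputs k X Ss" "valued X T" "finite T"
      "\<forall>x\<in>X. (args Ss x, val T x) \<in> A"
    have "X = {}" using * assms unfolding inputs_def args_def by fastforce
    moreover have "T = {}" using valued_eq_blocks[OF *(4,3)] \<open>X = {}\<close> by (simp add: blocks_def)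
    ultimately show "X = {} \<and> T = {}" by simp
  qed
qed

lemma parallel_RSucc: "parallel k RSucc"
proof (cases "k = 1")
  case False
  then show ?thesis by (intro parallel_False) (auto elim: rec_eval.cases)
next
  case True
  define R :: "nat set \<Rightarrow> nat set list \<Rightarrow> nat set \<Rightarrow> bool" where
    "R X Ss T \<longleftrightarrow> (T = X \<union> Suc ` (Ss ! 0) \<and> X \<inter> Suc ` (Ss ! 0) = {}) \<and> valued X T" for X Ss T
  have "set_definable_relation k R"
    unfolding set_definable_relation_def R_def
  proof (intro allI impI)
    fix a t and ss :: "nat list" assume "length ss = k"
    then have "map e ss ! 0 = e (ss ! 0)" for e :: "nat \<Rightarrow> nat set" using True by simp
    then show "set_definable (\<lambda>e. (e t = e a \<union> Suc ` (map e ss ! 0) \<and> e a \<inter> Suc ` (map e ss ! 0) = {}) \<and>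
        valued (e a) (e t))"
      by (simp only:) (intro set_definable_conj[OF set_definable_incr] set_definable_valued)
  qed
  moreover have "sound k RSucc R"
    unfolding sound_def
  proof (intro allI impI conjI ballI)
    fix X Ss T assume *: "inputs k X Ss" "finite T" "R X Ss T"
    then obtain S where S: "Ss = [S]" "finite S"
      using True unfolding inputs_def by (auto simp: length_Suc_conv)
    show "valued X T" using * R_def by blast
    fix x assume "x \<in> X"
    then have "val T x = Suc (val S x)" using * S unfolding R_def
      by (auto intro!: val_incr)
    then show "rec_eval RSucc (args Ss x) (val T x)"
      using S rec_eval.succ unfolding args_def by simp
  qed
  moreover have "complete k RSucc R"
    unfolding complete_def covers_def
  proof (intro allI impI exI)
    fix A :: "(nat list \<times> nat) set" and X T Ss
    assume *: "\<forall>(xs, y)\<in>A. rec_eval RSucc xs y" "inputs k X Ss" "valued X T" "finite T"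
      "\<forall>x\<in>X. (args Ss x, val T x) \<in> A"
    then obtain S where S: "Ss = [S]" "finite S" "valued X S"
      using True unfolding inputs_def by (auto simp: length_Suc_conv)
    have "val T x = Suc (val S x)" if "x \<in> X" for x
    proof -
      have "rec_eval RSucc [val S x] (val T x)" using * S that unfolding args_def by auto
      then show ?thesis by cases auto
    qed
    then have "T = blocks X (\<lambda>x. Suc (val S x))"
      by (subst valued_eq_blocks[OF *(4,3)]) (rule blocks_cong)
    then have "T = X \<union> Suc ` S" using blocks_incr valued_eq_blocks[OF S(2,3)] by simp
    then show "R X Ss T" using S * unfolding R_def by (auto simp: valued_def)
  qed
  ultimately show ?thesis unfolding parallel_def by blast
qed

lemma parallel_RProj: "parallel k (RProj i)"
proof (cases "i < k")
  case False
  then show ?thesis by (intro parallel_False) (auto elim: rec_eval.cases)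
next
  case True
  let ?R = "\<lambda>(X :: nat set) (Ss :: nat set list) (T :: nat set). T = Ss ! i"
  have "set_definable_relation k ?R" unfolding set_definable_relation_def using set_definable_eq True by simp
  moreover have "sound k (RProj i) ?R"
    unfolding sound_def
  proof (intro allI impI conjI ballI)
    fix X Ss T assume *: "inputs k X Ss" "finite T" "T = Ss ! i"
    then show "valued X T" using True unfolding inputs_def by auto
    fix x
    show "rec_eval (RProj i) (args Ss x) (val T x)"
      using rec_eval.proj[of i "args Ss x"] True * unfolding args_def inputs_def by simp
  qed
  moreover have "complete k (RProj i) ?R"
    unfolding complete_def covers_def
  proof (intro allI impI exI)
    fix A :: "(nat list \<times> nat) set" and X T Ss
    assume *: "\<forall>(xs, y)\<in>A. rec_eval (RProj i) xs y" "inputs k X Ss" "valued X T" "finite T"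
      "\<forall>x\<in>X. (args Ss x, val T x) \<in> A"
    show "T = Ss ! i"
    proof (rule valued_val_eq[of _ _ X])
      fix x assume "x \<in> X"
      then have "rec_eval (RProj i) (args Ss x) (val T x)" using * by blast
      then show "val T x = val (Ss ! i) x"
        using True * by cases (simp add: args_def inputs_def)
    qed (use * True in \<open>auto simp: inputs_def\<close>)
  qed
  ultimately show ?thesis unfolding parallel_def by blast
qed

lemma args_in_blocks:
  assumes "gapped G X" "finite X" "\<And>x c. x \<in> X \<Longrightarrow> c < l \<Longrightarrow> F x c < G"
  shows "inputs l X (map (\<lambda>c. blocks X (\<lambda>x. F x c)) [0..<l])"
    and "x \<in> X \<Longrightarrow> args (map (\<lambda>c. blocks X (\<lambda>x. F x c)) [0..<l]) x = map (F x) [0..<l]"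
proof -
  show "inputs l X (map (\<lambda>c. blocks X (\<lambda>x. F x c)) [0..<l])"
    unfolding inputs_def using assms by (auto intro!: valued_blocks[OF assms(1)])
  show "x \<in> X \<Longrightarrow> args (map (\<lambda>c. blocks X (\<lambda>x. F x c)) [0..<l]) x = map (F x) [0..<l]"
    unfolding args_def using val_blocks[OF assms(1), where v = "\<lambda>x. F x _"] assms(3) by simp
qed

lemma finite_le_bound: "finite A \<Longrightarrow> \<exists>b. \<forall>a\<in>A. g a < (b :: nat)"
  using finite_nat_set_iff_bounded[of "g ` A"] by auto

text \<open>The intermediate results are further sets of runs, written at the same points as the
  arguments.\<close>

lemma parallel_RComp:
  assumes f: "\<And>k. parallel k f" and gs: "\<And>g k. g \<in> set gs \<Longrightarrow> parallel k g"
  shows "parallel k (RComp f gs)"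
proof -
  define l where "l = length gs"
  obtain Rf where Rf: "set_definable_relation l Rf" "sound l f Rf" "complete l f Rf"
    using f unfolding parallel_def by blast
  have "\<forall>j. \<exists>R. j < l \<longrightarrow> set_definable_relation k R \<and> sound k (gs ! j) R \<and> complete k (gs ! j) R"
    using gs[OF nth_mem] unfolding parallel_def l_def by blast
  from choice[OF this]
  obtain Rg where Rg: "\<And>j. j < l \<Longrightarrow> set_definable_relation k (Rg j)"
    "\<And>j. j < l \<Longrightarrow> sound k (gs ! j) (Rg j)" "\<And>j. j < l \<Longrightarrow> complete k (gs ! j) (Rg j)"
    by blast
  define R where "R X Ss T \<longleftrightarrow> (\<exists>Ts. length Ts = l \<and> (\<forall>T\<in>set Ts. finite T) \<and>
    (\<forall>j<l. Rg j X Ss (Ts ! j)) \<and> Rf X Ts T)" for X Ss T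
  have "set_definable_relation k R"
    unfolding set_definable_relation_def R_def
  proof (intro allI impI, rule set_definable_ex_list, rule set_definable_conj, rule set_definable_all)
    fix a t j and ss :: "nat list" assume *: "length ss = k"
    show "set_definable (\<lambda>e. Rf (e (l + a)) (map e [0..<l]) (e (l + t)))"
      using Rf(1) unfolding set_definable_relation_def by simp
    assume j: "j < l"
    have "set_definable (\<lambda>e. Rg j (e (l + a)) (map e (map ((+) l) ss)) (e j))"
      by (rule set_definable_relationD[OF Rg(1)[OF j]]) (simp add: *)
    then show "set_definable (\<lambda>e. Rg j (e (l + a)) (map (\<lambda>i. e (l + i)) ss) (map e [0..<l] ! j))"
      using j by (simp add: comp_def)
  qed
  moreover have "sound k (RComp f gs) R"
    unfolding sound_def
  proof (intro allI impI)
    fix X Ss T assume *: "inputs k X Ss" "finite T" "R X Ss T"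
    then obtain Ts where Ts: "length Ts = l" "\<And>T. T \<in> set Ts \<Longrightarrow> finite T"
      "\<And>j. j < l \<Longrightarrow> Rg j X Ss (Ts ! j)" "Rf X Ts T"
      unfolding R_def by blast
    have j: "valued X (Ts ! j) \<and> (\<forall>x\<in>X. rec_eval (gs ! j) (args Ss x) (val (Ts ! j) x))"
      if "j < l" for j
    proof -
      have "finite (Ts ! j)" using Ts(1,2) that by simp
      then show ?thesis using Rg(2)[OF that] *(1) Ts(3)[OF that] unfolding sound_def by blast
    qed
    then have "inputs l X Ts"
      using *(1) Ts(1,2) unfolding inputs_def by (auto simp: in_set_conv_nth)
    then have "valued X T \<and> (\<forall>x\<in>X. rec_eval f (args Ts x) (val T x))"
      using Rf(2) *(2) Ts(4) unfolding sound_def by blast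
    moreover have "list_all2 (\<lambda>g y. rec_eval g (args Ss x) y) gs (args Ts x)" if "x \<in> X" for x
      using that j Ts(1) by (auto simp: list_all2_conv_all_nth args_def l_def)
    ultimately show "valued X T \<and> (\<forall>x\<in>X. rec_eval (RComp f gs) (args Ss x) (val T x))"
      by (blast intro: rec_eval.comp)
  qed
  moreover have "complete k (RComp f gs) R"
    unfolding complete_def
  proof (intro allI impI)
    fix A assume A: "finite A" "\<forall>(xs, y)\<in>A. rec_eval (RComp f gs) xs y"
    have "\<exists>ys. list_all2 (\<lambda>g y. rec_eval g (fst a) y) gs ys \<and> rec_eval f ys (snd a)" if "a \<in> A" for a
    proof -
      have "rec_eval (RComp f gs) (fst a) (snd a)" using A(2) that by auto
      then show ?thesis by cases blast
    qed
    then obtain Y where Y: "\<And>a. a \<in> A \<Longrightarrow> list_all2 (\<lambda>g y. rec_eval g (fst a) y) gs (Y a)"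
      "\<And>a. a \<in> A \<Longrightarrow> rec_eval f (Y a) (snd a)"
      by metis
    have lenY: "length (Y a) = l" if "a \<in> A" for a
      using list_all2_lengthD[OF Y(1)[OF that]] l_def by simp
    have fin: "finite ((\<lambda>a. (Y a, snd a)) ` A)" using A(1) by simp
    have "\<forall>(xs, y)\<in>(\<lambda>a. (Y a, snd a)) ` A. rec_eval f xs y" using Y(2) by auto
    with Rf(3) fin obtain Gf where Gf: "covers l Rf ((\<lambda>a. (Y a, snd a)) ` A) Gf"
      unfolding complete_def by blast
    have "\<exists>G. covers k (Rg j) ((\<lambda>a. (fst a, Y a ! j)) ` A) G" if "j < l" for j
    proof -
      have "finite ((\<lambda>a. (fst a, Y a ! j)) ` A)" using A(1) by simp
      moreover have "\<forall>(xs, y)\<in>(\<lambda>a. (fst a, Y a ! j)) ` A. rec_eval (gs ! j) xs y"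
        using Y(1) that by (auto simp: list_all2_conv_all_nth l_def)
      ultimately show ?thesis using Rg(3)[OF that] unfolding complete_def by blast
    qed
    then obtain Gg where Gg: "\<And>j. j < l \<Longrightarrow> covers k (Rg j) ((\<lambda>a. (fst a, Y a ! j)) ` A) (Gg j)"
      by metis
    obtain b where b: "\<And>j. j < l \<Longrightarrow> Gg j < b"
      using finite_le_bound[of "{..<l}" Gg] by auto
    obtain c where c: "\<And>a j. a \<in> A \<Longrightarrow> j < l \<Longrightarrow> Y a ! j < c"
      using finite_le_bound[of "A \<times> {..<l}" "\<lambda>(a, j). Y a ! j"] A(1) by auto
    \<comment> \<open>The gap has to serve \<open>f\<close> (by \<open>Gf\<close>), all the
      components (by \<open>b\<close>) and the runs of the intermediate values (by
      \<open>c\<close>).\<close>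
    show "\<exists>G. covers k R A G"
      unfolding covers_def
    proof (intro exI[of _ "Gf + b + c"] allI impI)
      fix X Ss T assume *: "inputs k X Ss" "gapped (Gf + b + c) X" "finite T" "valued X T"
        "\<forall>x\<in>X. (args Ss x, val T x) \<in> A"
      define F where "F x j = Y (args Ss x, val T x) ! j" for x j
      define Ts where "Ts = map (\<lambda>j. blocks X (\<lambda>x. F x j)) [0..<l]"
      have gap: "gapped c X" "gapped Gf X" "\<And>j. j < l \<Longrightarrow> gapped (Gg j) X"
        using gapped_mono[OF *(2)] b by (auto simp: less_imp_le trans_le_add1 trans_le_add2)
      have Fc: "F x j < c" if "x \<in> X" "j < l" for x j using c *(5) that unfolding F_def by blast
      have finX: "finite X" using *(1) unfolding inputs_def by blast
      have in_Ts: "inputs l X Ts" unfolding Ts_def by (rule args_in_blocks(1)[OF gap(1) finX Fc])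
      have "args Ts x = Y (args Ss x, val T x)" if "x \<in> X" for x
      proof -
        have "args Ts x = map (F x) [0..<l]"
          unfolding Ts_def by (rule args_in_blocks(2)[OF gap(1) finX Fc that])
        then show ?thesis
          using lenY *(5) that by (auto simp: F_def intro!: nth_equalityI)
      qed
      then have "Rf X Ts T"
        using *(5) by (intro coversD[OF Gf] in_Ts gap *(3,4)) (auto simp: image_iff intro!: bexI)
      moreover have "Rg j X Ss (Ts ! j)" if j: "j < l" for j
      proof (rule coversD[OF Gg[OF j] *(1) gap(3)[OF j]])
        show "finite (Ts ! j)" "valued X (Ts ! j)"
          using in_Ts j unfolding inputs_def by auto
        fix x assume x: "x \<in> X"
        have "val (Ts ! j) x = F x j"
          unfolding Ts_def using j val_blocks[OF gap(1), of "\<lambda>x. F x j"] Fc x by simp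
        then show "(args Ss x, val (Ts ! j) x) \<in> (\<lambda>a. (fst a, Y a ! j)) ` A"
          using *(5) x unfolding F_def by force
      qed
      ultimately show "R X Ss T"
        using in_Ts unfolding R_def inputs_def by blast
    qed
  qed
  ultimately show ?thesis unfolding parallel_def by blast
qed

subsection \<open>Iteration\<close>

text \<open>\<open>Y\<close> consists of walks with step width \<open>w\<close> that start at the points of \<open>X\<close>; \<open>L\<close> collects their last
  points and \<open>Y'\<close> the others. A link records values along these walks: they start with those of \<open>P\<close>, and
  \<open>N\<close> records at each point the value for the next one.\<close>

definition frame :: "nat set \<Rightarrow> nat set \<Rightarrow> nat set \<Rightarrow> nat set \<Rightarrow> nat set \<Rightarrow> bool" where
  "frame W X Y Y' L \<longleftrightarrow>
     (\<exists>V. finite V \<and> (\<exists>w. W = {w} \<and> V = (+) w ` Y') \<and> Y = X \<union> V \<and> X \<inter> V = {}) \<and>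
     Y = Y' \<union> L \<and> Y' \<inter> L = {}"

definition link :: "nat set \<Rightarrow> nat set \<Rightarrow> nat set \<Rightarrow> nat set \<Rightarrow> nat set \<Rightarrow> nat set \<Rightarrow> nat set \<Rightarrow> nat set \<Rightarrow> bool" where
  "link W Y Y' L P N U' UL \<longleftrightarrow>
     (\<exists>U. finite U \<and> (\<exists>V. finite V \<and> (\<exists>w. W = {w} \<and> V = (+) w ` N) \<and> U = P \<union> V \<and> P \<inter> V = {}) \<and>
       (U = U' \<union> UL \<and> U' \<inter> UL = {}) \<and> valued Y U \<and> valued Y' U' \<and> valued L UL)"

lemma set_definable_frame: "set_definable (\<lambda>e. frame (e w) (e x) (e y) (e y') (e l))"
  unfolding frame_def by (intro set_definable_conj[OF set_definable_ex set_definable_union] set_definable_conj[OF set_definable_shift] set_definable_union)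

lemma set_definable_link: "set_definable (\<lambda>e. link (e w) (e y) (e y') (e l) (e p) (e n) (e u) (e ul))"
  unfolding link_def
  by (rule set_definable_ex, rule set_definable_conj, rule set_definable_ex, rule set_definable_conj[OF set_definable_shift set_definable_union],
      rule set_definable_conj[OF set_definable_union], intro set_definable_conj set_definable_valued)

text \<open>Every point outside \<open>L\<close> has its successor in the finite set
  \<open>Y\<close>, so walks with positive step width end in \<open>L\<close>. A frame may also have
  \<open>w = 0\<close>; then the disjointness of \<open>X\<close> from the translate of
  \<open>Y'\<close>, which is \<open>Y'\<close> itself, puts \<open>x\<close> into \<open>L\<close>
  at once.\<close>

lemma frame_walk:
  assumes "frame {w} X Y Y' L" "finite Y" "x \<in> X"
  shows "\<exists>n. (\<forall>i<n. x + i * w \<in> Y') \<and> x + n * w \<in> L"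
proof -
  have Y: "Y = X \<union> (+) w ` Y'" "X \<inter> (+) w ` Y' = {}" "Y = Y' \<union> L"
    using assms(1) unfolding frame_def by auto
  show ?thesis
  proof (cases "w = 0")
    case True
    then have "x \<in> L" using Y assms(3) by auto
    then show ?thesis by (intro exI[of _ 0]) simp
  next
    case False
    obtain b where b: "\<And>y. y \<in> Y \<Longrightarrow> y < b" using assms(2) finite_nat_set_iff_bounded by auto
    have "\<exists>n. (\<forall>i<n. y + i * w \<in> Y') \<and> y + n * w \<in> L" if "y \<in> Y" for y
      using that
    proof (induction "b - y" arbitrary: y rule: less_induct)
      case less
      show ?case
      proof (cases "y \<in> L")
        case True
        then show ?thesis by (intro exI[of _ 0]) simp
      next
        case nL: False
        then have y: "y \<in> Y'" "w + y \<in> Y" using less.prems Y by auto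
        have "b - (w + y) < b - y" using b[OF less.prems] False by linarith
        then obtain n where n: "\<And>i. i < n \<Longrightarrow> w + y + i * w \<in> Y'" "w + y + n * w \<in> L"
          using less.hyps y(2) by blast
        have "y + i * w \<in> Y'" if "i < Suc n" for i
          using that n(1)[of "i - 1"] y(1) by (cases i) (auto simp: algebra_simps)
        moreover have "y + Suc n * w \<in> L" using n(2) by (simp add: algebra_simps)
        ultimately show ?thesis by blast
      qed
    qed
    then show ?thesis using Y assms(3) by blast
  qed
qed

text \<open>The values on \<open>Y\<close> are split in two ways: \<open>P\<close> and the translate
  of \<open>N\<close> tell where a value comes from, \<open>U'\<close> and \<open>UL\<close> where
  it is used. Passing back and forth between both splittings carries the invariant \<open>Q\<close>
  along the walk. It is arbitrary, so that counters, constant parameters and values of a recursion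
  are all instances.\<close>

lemma link_walk:
  assumes "frame {w} X Y Y' L" "link {w} Y Y' L P N U' UL"
    and fin: "finite X" "finite Y'" "finite L" "finite P" "finite N" "finite U'" "finite UL"
    and "valued X P" "valued Y' N" "x \<in> X"
    and walk: "\<And>i. i < n \<Longrightarrow> x + i * w \<in> Y'" "x + n * w \<in> L"
    and start: "Q 0 (val P x)"
    and step: "\<And>i. i < n \<Longrightarrow> Q i (val U' (x + i * w)) \<Longrightarrow> Q (Suc i) (val N (x + i * w))"
  shows "\<And>i. i < n \<Longrightarrow> Q i (val U' (x + i * w))" "Q n (val UL (x + n * w))"
proof -
  have Y: "Y = X \<union> (+) w ` Y'" "X \<inter> (+) w ` Y' = {}" "Y = Y' \<union> L" "Y' \<inter> L = {}"
    using assms(1) unfolding frame_def by auto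
  obtain U where U: "U = P \<union> (+) w ` N" "U = U' \<union> UL"
    "valued Y U" "valued Y' U'" "valued L UL"
    using assms(2) unfolding link_def by blast
  have shifted: "valued ((+) w ` Y') ((+) w ` N)" by (rule valued_shift) fact
  have vP: "val U x = val P x"
    using val_disjoint_Un(1)[OF \<open>valued X P\<close> shifted Y(2)] U Y fin \<open>x \<in> X\<close> by simp
  have vN: "val U (w + y) = val N y" if "y \<in> Y'" for y
    using val_disjoint_Un(2)[OF \<open>valued X P\<close> shifted Y(2), of "w + y"] U Y(1) fin that
    by (simp add: val_shift)
  have vU': "val U y = val U' y" if "y \<in> Y'" for y
    using val_disjoint_Un(1)[OF U(4,5) Y(4)] U Y(3) fin that by simp
  have vUL: "val U y = val UL y" if "y \<in> L" for y
    using val_disjoint_Un(2)[OF U(4,5) Y(4)] U Y(3) fin that by simp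
  have Q: "Q i (val U (x + i * w))" if "i \<le> n" for i
    using that
  proof (induction i)
    case 0
    then show ?case using start vP by simp
  next
    case (Suc i)
    then have i: "i < n" "Q i (val U' (x + i * w))" using vU' walk by auto
    have "x + Suc i * w = w + (x + i * w)" by simp
    then show ?case using step[OF i] vN[OF walk(1)[OF i(1)]] by metis
  qed
  then show "\<And>i. i < n \<Longrightarrow> Q i (val U' (x + i * w))" "Q n (val UL (x + n * w))"
    using vU' vUL walk by (metis less_imp_le, metis le_refl)
qed

text \<open>\<open>C'\<close> contains the cells from which a walk continues and \<open>CL\<close>
  the final ones. A cell is either in column \<open>0\<close> or the successor of a cell of
  \<open>C'\<close>; these two partitions of the cells are the ones that \<open>frame\<close> and
  \<open>link\<close> ask for.\<close>

lemma link_layout: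
  assumes w: "0 < w" and gap: "gapped (Suc N * w) X" and fin: "finite X"
    and n: "\<And>x. x \<in> X \<Longrightarrow> n x \<le> N" and F: "\<And>x j. x \<in> X \<Longrightarrow> j \<le> n x \<Longrightarrow> F x j < w"
  defines "C' \<equiv> {(x, j). x \<in> X \<and> j < n x}" and "CL \<equiv> {(x, j). x \<in> X \<and> j = n x}"
  shows "frame {w} X (points w (C' \<union> CL)) (points w C') (points w CL)"
    and "link {w} (points w (C' \<union> CL)) (points w C') (points w CL)
      (layout w (X \<times> {0}) F) (layout w C' (\<lambda>x j. F x (Suc j))) (layout w C' F) (layout w CL F)"
    and "finite C'" "finite CL" "C' \<union> CL \<subseteq> X \<times> {..N}"
proof -
  show sub: "C' \<union> CL \<subseteq> X \<times> {..N}" unfolding C'_def CL_def using n by fastforce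
  have "finite (C' \<union> CL)" by (rule finite_subset[OF sub]) (use fin in simp)
  then show finC: "finite C'" "finite CL" by simp_all
  have split: "C' \<union> CL = X \<times> {0} \<union> next_col C'" (is "?l = ?r")
  proof (intro equalityI subsetI)
    fix c assume "c \<in> ?l"
    then obtain x j where c: "c = (x, j)" "x \<in> X" "j \<le> n x" unfolding C'_def CL_def by auto
    then show "c \<in> ?r" unfolding next_col_def C'_def by (cases j) auto
  qed (auto simp: next_col_def C'_def CL_def)
  have disj: "X \<times> {0} \<inter> next_col C' = {}" "C' \<inter> CL = {}"
    unfolding next_col_def C'_def CL_def by auto
  have F': "F x j < w" if "(x, j) \<in> C' \<union> CL" for x j
    using that F unfolding C'_def CL_def by auto
  have X: "points w (X \<times> {0}) = X" unfolding points_def by force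
  have sub2: "X \<times> {0} \<union> next_col C' \<subseteq> X \<times> {..N}" using sub split by simp
  show "frame {w} X (points w (C' \<union> CL)) (points w C') (points w CL)"
    unfolding frame_def
  proof (intro conjI exI[of _ "(+) w ` points w C'"] exI[of _ w] refl)
    show "points w (C' \<union> CL) = X \<union> (+) w ` points w C'"
      unfolding split pts_Un X points_next_col ..
    show "X \<inter> (+) w ` points w C' = {}"
      using points_disjoint[OF w gap sub2 disj(1)] by (simp add: X points_next_col)
    show "points w C' \<inter> points w CL = {}" by (rule points_disjoint[OF w gap sub disj(2)])
  qed (use finC finite_points in \<open>auto simp: pts_Un\<close>)
  show "link {w} (points w (C' \<union> CL)) (points w C') (points w CL)
      (layout w (X \<times> {0}) F) (layout w C' (\<lambda>x j. F x (Suc j))) (layout w C' F) (layout w CL F)"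
    unfolding link_def
  proof (rule exI[of _ "layout w (C' \<union> CL) F"], intro conjI)
    show "finite (layout w (C' \<union> CL) F)"
      by (rule finite_layout[OF w gap sub F']) (use finC in auto)
    have "finite (layout w (next_col C') F)"
      by (rule finite_layout[OF w gap]) (use sub2 F' finC split in \<open>auto simp: next_col_def\<close>)
    moreover have "layout w (C' \<union> CL) F = layout w (X \<times> {0}) F \<union> layout w (next_col C') F"
      unfolding split lay_Un ..
    moreover have "layout w (X \<times> {0}) F \<inter> layout w (next_col C') F = {}"
      by (rule layout_disjoint[OF w gap sub2 F' disj(1)]) (use split in auto)
    ultimately show "\<exists>V. finite V \<and> (\<exists>wa. {w} = {wa} \<and> V = (+) wa ` layout w C' (\<lambda>x j. F x (Suc j))) \<and>
        layout w (C' \<union> CL) F = layout w (X \<times> {0}) F \<union> V \<and> layout w (X \<times> {0}) F \<inter> V = {}"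
      unfolding layout_next_col by blast
    show "layout w (C' \<union> CL) F = layout w C' F \<union> layout w CL F" by (rule lay_Un)
    show "layout w C' F \<inter> layout w CL F = {}" by (rule layout_disjoint[OF w gap sub F' disj(2)])
    show "valued (points w (C' \<union> CL)) (layout w (C' \<union> CL) F)" by (rule valued_layout[OF w gap sub F'])
    show "valued (points w C') (layout w C' F)" "valued (points w CL) (layout w CL F)"
      by (rule valued_layout[OF w gap]; use sub F' in auto)+
  qed
qed

lemma layout_start:
  assumes "finite P" "valued X P" "\<And>x. x \<in> X \<Longrightarrow> F x 0 = val P x"
  shows "layout w (X \<times> {0}) F = P"
proof -
  have "layout w (X \<times> {0}) F = blocks (points w (X \<times> {0})) (val P)"
    by (rule layout_eq_blocks) (use assms(3) in auto)
  also have "points w (X \<times> {0}) = X" unfolding points_def by force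
  finally show ?thesis using valued_eq_blocks[OF assms(1,2)] by simp
qed

text \<open>Equips walks with a counter and with their parameters. The counter starts with the empty
  set, which has value \<open>0\<close> everywhere, and \<open>J1\<close> is the counter plus one. A
  parameter has \<open>Cs ! i\<close> both as its current and as its next value, hence stays
  constant. The copies are needed because the step function is evaluated at the points of the walks,
  whereas the arguments are given at the points of \<open>X\<close>.\<close>

definition chain :: "nat \<Rightarrow> nat set \<Rightarrow> nat set \<Rightarrow> nat set list \<Rightarrow> nat set \<Rightarrow> nat set \<Rightarrow> nat set \<Rightarrow>
    nat set \<Rightarrow> nat set \<Rightarrow> nat set list \<Rightarrow> nat set list \<Rightarrow> bool" where
  "chain k W X Ps Y Y' L J JL Cs Ds \<longleftrightarrow> frame W X Y Y' L \<and>
     (\<exists>J1. finite J1 \<and> (J1 = Y' \<union> Suc ` J \<and> Y' \<inter> Suc ` J = {}) \<and> valued Y' J1 \<and>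
       (\<exists>E. finite E \<and> E = {} \<and> link W Y Y' L E J1 J JL)) \<and>
     (\<forall>i<k. link W Y Y' L (Ps ! i) (Cs ! i) (Cs ! i) (Ds ! i))"

lemma set_definable_chain:
  assumes "length ps = k" "length cs = k" "length ds = k"
  shows "set_definable (\<lambda>e. chain k (e w) (e x) (map e ps) (e y) (e y') (e l) (e j) (e jl) (map e cs) (map e ds))"
proof -
  have "set_definable (\<lambda>e. frame (e w) (e x) (e y) (e y') (e l) \<and>
     (\<exists>J1. finite J1 \<and> (J1 = e y' \<union> Suc ` e j \<and> e y' \<inter> Suc ` e j = {}) \<and> valued (e y') J1 \<and>
       (\<exists>E. finite E \<and> E = {} \<and> link (e w) (e y) (e y') (e l) E J1 (e j) (e jl))) \<and>
     (\<forall>i<k. link (e w) (e y) (e y') (e l) (e (ps ! i)) (e (cs ! i)) (e (cs ! i)) (e (ds ! i))))"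
  proof (rule set_definable_conj[OF set_definable_frame set_definable_conj])
    show "set_definable (\<lambda>e. \<exists>J1. finite J1 \<and> (J1 = e y' \<union> Suc ` e j \<and> e y' \<inter> Suc ` e j = {}) \<and>
        valued (e y') J1 \<and> (\<exists>E. finite E \<and> E = {} \<and> link (e w) (e y) (e y') (e l) E J1 (e j) (e jl)))"
      by (rule set_definable_ex, rule set_definable_conj[OF set_definable_incr], rule set_definable_conj[OF set_definable_valued], rule set_definable_ex,
          rule set_definable_conj[OF set_definable_empty set_definable_link])
  qed (rule set_definable_all, rule set_definable_link)
  then show ?thesis by (rule set_definable_cong) (simp add: chain_def assms)
qed

lemma link_valued:
  "link W Y Y' L P N U UL \<Longrightarrow> valued Y' U \<and> valued L UL"
  unfolding link_def by blast

lemma chainE: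
  assumes "chain k W X Ps Y Y' L J JL Cs Ds"
  obtains J1 where "finite J1" "J1 = Y' \<union> Suc ` J" "valued Y' J1" "link W Y Y' L {} J1 J JL"
  using assms unfolding chain_def by auto

lemma chain_inputs:
  assumes "chain k W X Ps Y Y' L J JL Cs Ds" "finite Y'" "finite L"
    "length Cs = k" "length Ds = k" "\<forall>S\<in>set Cs. finite S" "\<forall>S\<in>set Ds. finite S"
  shows "inputs k Y' Cs" "inputs k L Ds" "valued Y' J" "valued L JL"
proof -
  have lk: "link W Y Y' L (Ps ! i) (Cs ! i) (Cs ! i) (Ds ! i)" if "i < k" for i
    using assms(1) that unfolding chain_def by blast
  show "inputs k Y' Cs" "inputs k L Ds"
    using link_valued[OF lk] assms(2-) unfolding inputs_def by (auto simp: in_set_conv_nth)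
  obtain J1 where "link W Y Y' L {} J1 J JL" by (rule chainE[OF assms(1)])
  then show "valued Y' J" "valued L JL" using link_valued by auto
qed

text \<open>Instances of \<open>link_walk\<close>, with the invariants that a value equals the
  number of steps and that it equals the initial value. The length of the walk is not prescribed by
  the frame; it becomes readable as the value of \<open>JL\<close> at the end.\<close>

lemma chain_walk:
  assumes ch: "chain k {w} X Ps Y Y' L J JL Cs Ds" and ins: "inputs k X Ps"
    and fin: "finite Y" "finite Y'" "finite L" "finite J" "finite JL"
      "length Cs = k" "length Ds = k" "\<forall>S\<in>set Cs. finite S" "\<forall>S\<in>set Ds. finite S"
    and x: "x \<in> X"
  obtains n where "\<And>i. i < n \<Longrightarrow> x + i * w \<in> Y'" "x + n * w \<in> L"
    "\<And>i. i < n \<Longrightarrow> val J (x + i * w) = i" "val JL (x + n * w) = n"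
    "\<And>i. i < n \<Longrightarrow> args Cs (x + i * w) = args Ps x" "args Ds (x + n * w) = args Ps x"
proof -
  have fr: "frame {w} X Y Y' L" using ch unfolding chain_def by blast
  obtain n where n: "\<And>i. i < n \<Longrightarrow> x + i * w \<in> Y'" "x + n * w \<in> L"
    using frame_walk[OF fr fin(1) x] by blast
  have finX: "finite X" using ins unfolding inputs_def by blast
  obtain J1 where J1: "finite J1" "J1 = Y' \<union> Suc ` J" "valued Y' J1" "link {w} Y Y' L {} J1 J JL"
    by (rule chainE[OF ch])
  note J = link_walk[OF fr J1(4) finX fin(2,3) _ J1(1) fin(4,5) valued_empty J1(3) x n,
      where Q = "\<lambda>i v. v = i"]
  have stepJ: "val J1 (x + i * w) = Suc i" if "i < n" "val J (x + i * w) = i" for i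
    using val_incr[OF fin(4), of Y'] J1(2,3) n(1) that by simp
  have C: "val (Ds ! c) (x + n * w) = val (Ps ! c) x"
      "\<And>i. i < n \<Longrightarrow> val (Cs ! c) (x + i * w) = val (Ps ! c) x" if c: "c < k" for c
  proof -
    have lk: "link {w} Y Y' L (Ps ! c) (Cs ! c) (Cs ! c) (Ds ! c)"
      using ch c unfolding chain_def by blast
    have fins: "finite (Ps ! c)" "finite (Cs ! c)" "finite (Ds ! c)" "valued X (Ps ! c)"
      using ins fin(6-9) c unfolding inputs_def by auto
    note * = link_walk[OF fr lk finX fin(2,3) fins(1,2,2,3,4) _ x n, where Q = "\<lambda>_ v. v = val (Ps ! c) x"]
    have v: "valued Y' (Cs ! c)" using link_valued[OF lk] by blast
    show "val (Ds ! c) (x + n * w) = val (Ps ! c) x" by (rule *(2)[OF v]) auto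
    show "val (Cs ! c) (x + i * w) = val (Ps ! c) x" if "i < n" for i
      by (rule *(1)[OF v]) (use that in auto)
  qed
  have len: "length Ps = k" using ins unfolding inputs_def by blast
  show ?thesis
  proof (rule that[OF n])
    show "val JL (x + n * w) = n" by (rule J(2)) (use stepJ in auto)
    show "val J (x + i * w) = i" if "i < n" for i
      by (rule J(1)) (use stepJ that in auto)
    show "args Cs (x + i * w) = args Ps x" if "i < n" for i
      unfolding args_def using C(2)[OF _ that] fin(6) len by (auto intro!: nth_equalityI)
    show "args Ds (x + n * w) = args Ps x"
      unfolding args_def using C(1) fin(7) len by (auto intro!: nth_equalityI)
  qed simp_all
qed

text \<open>Counters and parameters are runs inside a cell, so the step width has to exceed all of
  them.\<close>

lemma chain_layout:
  assumes w: "0 < w" and gap: "gapped (Suc N * w) X" and ins: "inputs k X Ps"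
    and n: "\<And>x. x \<in> X \<Longrightarrow> n x \<le> N" "N < w"
    and bound: "\<And>x i. x \<in> X \<Longrightarrow> i < k \<Longrightarrow> args Ps x ! i < w"
  defines "C' \<equiv> {(x, j). x \<in> X \<and> j < n x}" and "CL \<equiv> {(x, j). x \<in> X \<and> j = n x}"
  shows "chain k {w} X Ps (points w (C' \<union> CL)) (points w C') (points w CL)
    (layout w C' (\<lambda>x j. j)) (layout w CL (\<lambda>x j. j))
    (map (\<lambda>i. layout w C' (\<lambda>x j. args Ps x ! i)) [0..<k])
    (map (\<lambda>i. layout w CL (\<lambda>x j. args Ps x ! i)) [0..<k])"
  unfolding chain_def
proof (intro conjI allI impI)
  have finX: "finite X" and len: "length Ps = k" using ins unfolding inputs_def by auto
  have J: "\<And>x j. x \<in> X \<Longrightarrow> j \<le> n x \<Longrightarrow> j < w" using n by fastforce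
  have lk: "frame {w} X (points w (C' \<union> CL)) (points w C') (points w CL)"
    "link {w} (points w (C' \<union> CL)) (points w C') (points w CL)
      (layout w (X \<times> {0}) F) (layout w C' (\<lambda>x j. F x (Suc j))) (layout w C' F) (layout w CL F)"
    if "\<And>x j. x \<in> X \<Longrightarrow> j \<le> n x \<Longrightarrow> F x j < w" for F
    unfolding C'_def CL_def using that n(1)
    by (auto intro!: link_layout(1,2)[OF w gap finX])
  show "frame {w} X (points w (C' \<union> CL)) (points w C') (points w CL)"
    by (rule lk(1)[of "\<lambda>x j. j"]) (rule J)
  have sub: "finite C'" "C' \<subseteq> X \<times> {..N}"
  proof -
    show "C' \<subseteq> X \<times> {..N}" unfolding C'_def using n(1) by fastforce
    then show "finite C'" by (rule finite_subset) (use finX in simp)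
  qed
  let ?J1 = "layout w C' (\<lambda>x j. Suc j)" and ?J = "layout w C' (\<lambda>x j. j)"
  have bJ: "\<And>x j. (x, j) \<in> C' \<Longrightarrow> j < w" "\<And>x j. (x, j) \<in> C' \<Longrightarrow> Suc j < w"
    using n unfolding C'_def by fastforce+
  have "valued (points w C') ?J" by (rule valued_layout[OF w gap sub(2) bJ(1)])
  then have "?J1 = points w C' \<union> Suc ` ?J \<and> points w C' \<inter> Suc ` ?J = {}"
    using layout_incr unfolding valued_def by auto
  moreover have "finite ?J1" "valued (points w C') ?J1"
    using finite_layout[OF w gap sub(2) bJ(2)] valued_layout[OF w gap sub(2) bJ(2)] sub(1) by auto
  moreover have "link {w} (points w (C' \<union> CL)) (points w C') (points w CL) {} ?J1 ?J (layout w CL (\<lambda>x j. j))"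
    using lk(2)[of "\<lambda>x j. j"] J layout_start[of "{}" X "\<lambda>x j. j" w] valued_empty by simp
  ultimately show "\<exists>J1. finite J1 \<and> (J1 = points w C' \<union> Suc ` ?J \<and> points w C' \<inter> Suc ` ?J = {}) \<and>
      valued (points w C') J1 \<and> (\<exists>E. finite E \<and> E = {} \<and>
        link {w} (points w (C' \<union> CL)) (points w C') (points w CL) E J1 ?J (layout w CL (\<lambda>x j. j)))"
    by blast
  fix i assume i: "i < k"
  let ?F = "\<lambda>x j. args Ps x ! i"
  have "layout w (X \<times> {0}) ?F = Ps ! i"
    by (rule layout_start) (use ins i len in \<open>auto simp: inputs_def args_def\<close>)
  then show "link {w} (points w (C' \<union> CL)) (points w C') (points w CL) (Ps ! i)
      (map (\<lambda>i. layout w C' (\<lambda>x j. args Ps x ! i)) [0..<k] ! i)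
      (map (\<lambda>i. layout w C' (\<lambda>x j. args Ps x ! i)) [0..<k] ! i)
      (map (\<lambda>i. layout w CL (\<lambda>x j. args Ps x ! i)) [0..<k] ! i)"
    using lk(2)[of ?F] bound i by simp
qed

end

section \<open>Primitive recursion and minimization as walks\<close>

lemma prec_sequence:
  assumes "rec_eval (RPrec f g) (n # xs) y"
  shows "\<exists>r. (\<forall>j\<le>n. rec_eval (RPrec f g) (j # xs) (r j)) \<and> rec_eval f xs (r 0) \<and>
    (\<forall>j<n. rec_eval g (j # r j # xs) (r (Suc j))) \<and> r n = y"
  using assms
proof (induction n arbitrary: y)
  case 0
  from 0 have "rec_eval f xs y" by cases
  then show ?case using 0 by (intro exI[of _ "\<lambda>_. y"]) simp
next
  case (Suc n)
  from Suc.prems obtain z where z: "rec_eval (RPrec f g) (n # xs) z" "rec_eval g (n # z # xs) y"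
    by cases
  obtain r where r: "\<forall>j\<le>n. rec_eval (RPrec f g) (j # xs) (r j)" "rec_eval f xs (r 0)"
    "\<forall>j<n. rec_eval g (j # r j # xs) (r (Suc j))" "r n = z" using Suc.IH[OF z(1)] by blast
  show ?case
    by (intro exI[of _ "r(Suc n := y)"]) (use r z Suc.prems in \<open>auto simp: le_Suc_eq less_Suc_eq\<close>)
qed

lemma set_tl_subset: "set (tl xs) \<subseteq> set xs"
  by (cases xs) auto

context set_definability
begin

lemma soundD:
  assumes "sound k f R" "inputs k X Ss" "finite T" "R X Ss T"
  shows "valued X T" "x \<in> X \<Longrightarrow> rec_eval f (args Ss x) (val T x)"
  using assms unfolding sound_def by blast+

lemma inputs_layout:
  assumes "0 < w" "gapped (Suc N * w) X" "finite C" "C \<subseteq> X \<times> {..N}"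
    and "\<And>x j i. (x, j) \<in> C \<Longrightarrow> i < k \<Longrightarrow> F i x j < w"
  shows "inputs k (points w C) (map (\<lambda>i. layout w C (F i)) [0..<k])"
    and "(x, j) \<in> C \<Longrightarrow> args (map (\<lambda>i. layout w C (F i)) [0..<k]) (x + j * w) = map (\<lambda>i. F i x j) [0..<k]"
  unfolding inputs_def args_def using assms
  by (auto simp: finite_points valued_layout[OF assms(1,2,4)] val_layout[OF assms(1,2,4)] finite_layout[OF assms(1,2,4)])


text \<open>The result of a recursion appears at the end of its walk. Walks have different lengths,
  so no single translation brings the results back to \<open>X\<close>. Instead the claimed result
  \<open>T\<close> travels along as one more parameter and is compared with the computed value at
  the end.\<close>

lemma parallel_RPrec:
  assumes f: "\<And>k. parallel k f" and g: "\<And>k. parallel k g"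
  shows "parallel k (RPrec f g)"
proof (cases k)
  case 0
  then show ?thesis by (intro parallel_False) (auto elim: rec_eval.cases)
next
  case (Suc m)
  obtain Rf where Rf: "set_definable_relation m Rf" "sound m f Rf" "complete m f Rf"
    using f unfolding parallel_def by blast
  obtain Rg where Rg: "set_definable_relation (Suc (Suc m)) Rg" "sound (Suc (Suc m)) g Rg"
      "complete (Suc (Suc m)) g Rg"
    using g unfolding parallel_def by blast
  \<comment> \<open>The parameters are \<open>T # Ss\<close>. Hence \<open>tl (tl Cs)\<close> leaves
    out the claimed result and the recursion argument, while \<open>Ds ! 0\<close> and
    \<open>Ds ! 1\<close> are these two at the ends of the walks: the former must equal the last
    value, the latter the number of steps.\<close>
  define body where "body X Ss T W Y Y' L J JL R0 N R' RL Cs Ds \<longleftrightarrow>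
      chain (Suc k) W X (T # Ss) Y Y' L J JL Cs Ds \<and> valued X T \<and> Rf X (tl Ss) R0 \<and>
      Rg Y' (J # R' # tl (tl Cs)) N \<and> link W Y Y' L R0 N R' RL \<and> JL = Ds ! 1 \<and> RL = Ds ! 0"
    for X Ss T W Y Y' L J JL R0 N R' RL Cs Ds
  \<comment> \<open>The ten single sets of \<open>body\<close> from \<open>W\<close> to
    \<open>RL\<close>, followed by the lists \<open>Cs\<close> and \<open>Ds\<close> of length
    \<open>Suc k\<close>.\<close>
  define R where "R X Ss T \<longleftrightarrow>
    (\<exists>Zs. length Zs = 10 + (Suc k + Suc k) \<and> (\<forall>Z\<in>set Zs. finite Z) \<and>
      body X Ss T (Zs ! 0) (Zs ! 1) (Zs ! 2) (Zs ! 3) (Zs ! 4) (Zs ! 5) (Zs ! 6) (Zs ! 7) (Zs ! 8) (Zs ! 9)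
        (take (Suc k) (drop 10 Zs)) (drop (10 + Suc k) Zs))" for X Ss T
  have "set_definable_relation k R"
    unfolding set_definable_relation_def
  proof (intro allI impI)
    fix a t and ss :: "nat list" assume *: "length ss = k"
    define l where "l = 10 + (Suc k + Suc k)"
    define cs ds where "cs = [10..<10 + Suc k]" and "ds = [10 + Suc k..<l]"
    have len: "length cs = Suc k" "length ds = Suc k" unfolding cs_def ds_def l_def by auto
    have "set_definable (\<lambda>e. body (e (l + a)) (map e (map ((+) l) ss)) (e (l + t)) (e 0) (e 1) (e 2) (e 3) (e 4)
      (e 5) (e 6) (e 7) (e 8) (e 9) (map e cs) (map e ds))"
      unfolding body_def
    proof (intro set_definable_conj)
      show "set_definable (\<lambda>e. chain (Suc k) (e 0) (e (l + a)) (e (l + t) # map e (map ((+) l) ss)) (e 1) (e 2) (e 3)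
          (e 4) (e 5) (map e cs) (map e ds))"
        using set_definable_chain[of "(l + t) # map ((+) l) ss" "Suc k" cs ds 0 "l + a" 1 2 3 4 5] * len by simp
      show "set_definable (\<lambda>e. Rf (e (l + a)) (tl (map e (map ((+) l) ss))) (e 6))"
        using set_definable_relationD[OF Rf(1), of "tl (map ((+) l) ss)" "l + a" 6] * Suc by (simp add: map_tl)
      show "set_definable (\<lambda>e. Rg (e 2) (e 4 # e 8 # tl (tl (map e cs))) (e 7))"
        using set_definable_relationD[OF Rg(1), of "4 # 8 # tl (tl cs)" 2 7] len Suc by (simp add: map_tl)
      show "set_definable (\<lambda>e. link (e 0) (e 1) (e 2) (e 3) (e 6) (e 7) (e 8) (e 9))" by (rule set_definable_link)
      show "set_definable (\<lambda>e. e 5 = map e ds ! 1)" "set_definable (\<lambda>e. e 9 = map e ds ! 0)"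
        using len Suc by (simp_all add: set_definable_eq)
    qed (rule set_definable_valued)
    moreover have "take (Suc k) (drop 10 (map e [0..<l])) = map e cs"
        "drop (10 + Suc k) (map e [0..<l]) = map e ds" for e :: "nat \<Rightarrow> nat set"
      unfolding cs_def ds_def l_def by (simp_all add: drop_map take_map del: upt_Suc)
    moreover have "map e [0..<l] ! i = e i" if "i < 10" for i and e :: "nat \<Rightarrow> nat set"
      using that unfolding l_def by (simp del: upt_Suc)
    ultimately show "set_definable (\<lambda>e. R (e a) (map e ss) (e t))"
      unfolding R_def l_def[symmetric] by (intro set_definable_ex_list) (simp add: comp_def)
  qed
  moreover have "sound k (RPrec f g) R"
    unfolding sound_def
  proof (intro allI impI)
    fix X Ss T assume ins: "inputs k X Ss" and T: "finite T" and "R X Ss T"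
    then obtain Zs where Zs: "length Zs = 10 + (Suc k + Suc k)" "\<And>Z. Z \<in> set Zs \<Longrightarrow> finite Z"
      "body X Ss T (Zs ! 0) (Zs ! 1) (Zs ! 2) (Zs ! 3) (Zs ! 4) (Zs ! 5) (Zs ! 6) (Zs ! 7) (Zs ! 8) (Zs ! 9)
        (take (Suc k) (drop 10 Zs)) (drop (10 + Suc k) Zs)"
      unfolding R_def by blast
    have fin: "finite (Zs ! i)" if "i < 10" for i using Zs(1,2) that by simp
    define W Y Y' L J JL R0 N R' RL Cs Ds where defs: "W = Zs ! 0" "Y = Zs ! 1" "Y' = Zs ! 2" "L = Zs ! 3"
      "J = Zs ! 4" "JL = Zs ! 5" "R0 = Zs ! 6" "N = Zs ! 7" "R' = Zs ! 8" "RL = Zs ! 9"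
      "Cs = take (Suc k) (drop 10 Zs)" "Ds = drop (10 + Suc k) Zs"
    have finl: "finite Y" "finite Y'" "finite L" "finite J" "finite JL" "length Cs = Suc k"
      "length Ds = Suc k" "\<forall>S\<in>set Cs. finite S" "\<forall>S\<in>set Ds. finite S" and
      fin': "finite R0" "finite N" "finite R'" "finite RL"
      using fin Zs(1,2) in_set_takeD in_set_dropD unfolding defs by force+
    have ch: "chain (Suc k) W X (T # Ss) Y Y' L J JL Cs Ds" and vT: "valued X T" and Rf0: "Rf X (tl Ss) R0"
      and RgN: "Rg Y' (J # R' # tl (tl Cs)) N" and lk: "link W Y Y' L R0 N R' RL"
      and eqs: "JL = Ds ! 1" "RL = Ds ! 0"
      using Zs(3) unfolding body_def defs by blast+
    obtain w where W: "W = {w}" using lk unfolding link_def by blast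
    have fr: "frame {w} X Y Y' L" using ch unfolding chain_def W by blast
    have ins': "inputs (Suc k) X (T # Ss)" using ins T vT unfolding inputs_def by auto
    have "inputs m X (tl Ss)" using ins Suc unfolding inputs_def by (cases Ss) auto
    then have R0: "valued X R0" "\<And>x. x \<in> X \<Longrightarrow> rec_eval f (args (tl Ss) x) (val R0 x)"
      using Rf(2) Rf0 fin' unfolding sound_def by blast+
    have inC: "inputs (Suc k) Y' Cs" "valued Y' J"
      using chain_inputs[OF ch finl(2,3,6-9)] by auto
    then have "inputs (Suc (Suc m)) Y' (J # R' # tl (tl Cs))"
      using link_valued[OF lk] fin' finl Suc set_tl_subset[of Cs] set_tl_subset[of "tl Cs"]
      unfolding inputs_def by auto
    then have N: "valued Y' N" "\<And>y. y \<in> Y' \<Longrightarrow> rec_eval g (args (J # R' # tl (tl Cs)) y) (val N y)"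
      using Rg(2) RgN fin' unfolding sound_def by blast+
    have "rec_eval (RPrec f g) (args Ss x) (val T x)" if x: "x \<in> X" for x
    proof -
      obtain n where n: "\<And>i. i < n \<Longrightarrow> x + i * w \<in> Y'" "x + n * w \<in> L"
        "\<And>i. i < n \<Longrightarrow> val J (x + i * w) = i" "val JL (x + n * w) = n"
        "\<And>i. i < n \<Longrightarrow> args Cs (x + i * w) = args (T # Ss) x" "args Ds (x + n * w) = args (T # Ss) x"
        by (rule chain_walk[OF ch[unfolded W] ins' finl x]) blast
      have finX: "finite X" using ins unfolding inputs_def by blast
      obtain S0 Ss' where Ss: "Ss = S0 # Ss'" using ins Suc unfolding inputs_def by (cases Ss) auto
      have "rec_eval (RPrec f g) (n # args (tl Ss) x) (val RL (x + n * w))"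
      proof (rule link_walk(2)[OF fr lk[unfolded W] finX finl(2,3) fin'(1-4) R0(1) N(1) x n(1,2),
            where Q = "\<lambda>i v. rec_eval (RPrec f g) (i # args (tl Ss) x) v"])
        show "rec_eval (RPrec f g) (0 # args (tl Ss) x) (val R0 x)"
          by (rule rec_eval.prec_0) (rule R0(2)[OF x])
        fix i assume i: "i < n" "rec_eval (RPrec f g) (i # args (tl Ss) x) (val R' (x + i * w))"
        have "args (tl (tl Cs)) (x + i * w) = tl (tl (args Cs (x + i * w)))"
          unfolding args_def by (simp add: map_tl)
        also have "\<dots> = args (tl Ss) x" by (simp only: n(5)[OF i(1)]) (simp add: Ss args_def)
        finally have "rec_eval g (i # val R' (x + i * w) # args (tl Ss) x) (val N (x + i * w))"
          using N(2)[OF n(1)[OF i(1)]] n(3)[OF i(1)] unfolding args_def by simp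
        then show "rec_eval (RPrec f g) (Suc i # args (tl Ss) x) (val N (x + i * w))"
          using i(2) by (intro rec_eval.prec_Suc)
      qed simp
      moreover have "val RL (x + n * w) = args Ds (x + n * w) ! 0" "val JL (x + n * w) = args Ds (x + n * w) ! 1"
        unfolding eqs args_def using finl(7) Suc by simp_all
      ultimately show ?thesis unfolding n(6) using n(4) by (simp add: args_def Ss)
    qed
    then show "valued X T \<and> (\<forall>x\<in>X. rec_eval (RPrec f g) (args Ss x) (val T x))" using vT by blast
  qed
  moreover have "complete k (RPrec f g) R"
    unfolding complete_def
  proof (intro allI impI)
    fix A assume A: "finite A" "\<forall>(xs, y)\<in>A. rec_eval (RPrec f g) xs y"
    have "\<forall>a. \<exists>r. a \<in> A \<longrightarrow> rec_eval f (tl (fst a)) (r 0) \<and> r (hd (fst a)) = snd a \<and>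
        (\<forall>j<hd (fst a). rec_eval g (j # r j # tl (fst a)) (r (Suc j)))"
    proof
      fix a
      show "\<exists>r. a \<in> A \<longrightarrow> rec_eval f (tl (fst a)) (r 0) \<and> r (hd (fst a)) = snd a \<and>
        (\<forall>j<hd (fst a). rec_eval g (j # r j # tl (fst a)) (r (Suc j)))"
      proof (cases "a \<in> A")
        case True
        then have ev: "rec_eval (RPrec f g) (fst a) (snd a)" using A(2) by auto
        then obtain n xs where "fst a = n # xs" by cases auto
        then show ?thesis using prec_sequence ev by (metis list.sel(1,3))
      qed simp
    qed
    from choice[OF this] obtain r where r: "\<And>a. a \<in> A \<Longrightarrow> rec_eval f (tl (fst a)) (r a 0)"
      "\<And>a. a \<in> A \<Longrightarrow> r a (hd (fst a)) = snd a"
      "\<And>a j. a \<in> A \<Longrightarrow> j < hd (fst a) \<Longrightarrow> rec_eval g (j # r a j # tl (fst a)) (r a (Suc j))"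
      by blast
    \<comment> \<open>All calls of \<open>f\<close> and \<open>g\<close> in the computations behind
      \<open>A\<close>. They are finite in number, so the inner gaps are available before a layout
      is chosen.\<close>
    define Af where "Af = (\<lambda>a. (tl (fst a), r a 0)) ` A"
    define Ag where "Ag = (\<lambda>(a, j). (j # r a j # tl (fst a), r a (Suc j))) ` (SIGMA a:A. {..<hd (fst a)})"
    have "finite Af" "finite Ag" unfolding Af_def Ag_def using A(1) by auto
    moreover have "\<forall>(xs, y)\<in>Af. rec_eval f xs y" "\<forall>(xs, y)\<in>Ag. rec_eval g xs y"
      unfolding Af_def Ag_def using r by auto
    ultimately obtain Gf Gg where G: "covers m Rf Af Gf" "covers (Suc (Suc m)) Rg Ag Gg"
      using Rf(3) Rg(3) unfolding complete_def by meson
    have "finite (\<Union>a\<in>A. insert (snd a) (set (fst a) \<union> r a ` {..hd (fst a)} \<union> {hd (fst a)}))"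
      using A(1) by simp
    then obtain b where b0: "\<And>v. v \<in> (\<Union>a\<in>A. insert (snd a) (set (fst a) \<union> r a ` {..hd (fst a)} \<union> {hd (fst a)})) \<Longrightarrow> v < b"
      using finite_nat_set_iff_bounded by meson
    have b: "snd a < b" "v \<in> set (fst a) \<Longrightarrow> v < b" "j \<le> hd (fst a) \<Longrightarrow> r a j < b" "hd (fst a) < b"
      if "a \<in> A" for a v j
      using b0 that by auto
    \<comment> \<open>The width exceeds all values, which are below \<open>b\<close>, and is at
      least \<open>Gg\<close> because \<open>g\<close> is evaluated at cells that lie
      \<open>w\<close> apart.\<close>
    define w where "w = b + Gg + 1"
    have w: "0 < w" "b < w" "Gg \<le> w" unfolding w_def by simp_all
    \<comment> \<open>\<open>Gf\<close> serves the evaluation of \<open>f\<close> at the points of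
      \<open>X\<close>; \<open>Suc b * w\<close> is the room for columns \<open>0\<close> to
      \<open>b\<close>.\<close>
    show "\<exists>G. covers k R A G"
      unfolding covers_def
    proof (intro exI[of _ "Gf + Suc b * w"] allI impI)
      fix X Ss T assume ins: "inputs k X Ss" and gap0: "gapped (Gf + Suc b * w) X"
        and T: "finite T" "valued X T" and inA: "\<forall>x\<in>X. (args Ss x, val T x) \<in> A"
      define a where "a x = (args Ss x, val T x)" for x
      have a: "a x \<in> A" if "x \<in> X" for x using inA that unfolding a_def by blast
      define n where "n x = hd (fst (a x))" for x
      have gap: "gapped (Suc b * w) X" "gapped Gf X" "gapped w X"
        by (rule gapped_mono[OF gap0]; simp)+
      have ins': "inputs (Suc k) X (T # Ss)" using ins T unfolding inputs_def by auto
      have len: "length Ss = k" and finX: "finite X" using ins unfolding inputs_def by auto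
      have len_args: "length (args Ss x) = k" for x using len unfolding args_def by simp
      have n: "n x = args Ss x ! 0" "n x < b" if "x \<in> X" for x
      proof -
        show "n x < b" unfolding n_def by (rule b(4)[OF a[OF that]])
        have "args Ss x \<noteq> []" using len_args[of x] Suc by auto
        then show "n x = args Ss x ! 0" unfolding n_def a_def by (simp add: hd_conv_nth)
      qed
      have bound: "args (T # Ss) x ! i < w" if "x \<in> X" "i < Suc k" for x i
      proof -
        have "args (T # Ss) x ! i < b"
          using that b(1,2)[OF a[OF that(1)]] len len_args[of x]
          by (cases i) (auto simp: a_def args_def)
        then show ?thesis using w by simp
      qed
      define C' CL where "C' = {(x, j). x \<in> X \<and> j < n x}" and "CL = {(x, j). x \<in> X \<and> j = n x}"
      have nb: "n x \<le> b" if "x \<in> X" for x using n(2)[OF that] by simp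
      have rw: "r (a x) j < w" if "x \<in> X" "j \<le> n x" for x j
        using b(3)[OF a[OF that(1)]] that(2) w(2) unfolding n_def by fastforce
      have lkR: "link {w} (points w (C' \<union> CL)) (points w C') (points w CL)
        (layout w (X \<times> {0}) (\<lambda>x. r (a x))) (layout w C' (\<lambda>x j. r (a x) (Suc j)))
        (layout w C' (\<lambda>x. r (a x))) (layout w CL (\<lambda>x. r (a x)))"
        unfolding C'_def CL_def by (rule link_layout(2)[OF w(1) gap(1) finX nb rw])
      have finC: "finite C'" "finite CL" "C' \<subseteq> X \<times> {..b}" "CL \<subseteq> X \<times> {..b}"
        using link_layout(3,4,5)[OF w(1) gap(1) finX nb rw] unfolding C'_def CL_def by auto
      have chn: "chain (Suc k) {w} X (T # Ss) (points w (C' \<union> CL)) (points w C') (points w CL)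
        (layout w C' (\<lambda>x j. j)) (layout w CL (\<lambda>x j. j))
        (map (\<lambda>i. layout w C' (\<lambda>x j. args (T # Ss) x ! i)) [0..<Suc k])
        (map (\<lambda>i. layout w CL (\<lambda>x j. args (T # Ss) x ! i)) [0..<Suc k])"
        unfolding C'_def CL_def by (rule chain_layout[OF w(1) gap(1) ins' nb w(2) bound])
      define R0 where "R0 = blocks X (\<lambda>x. r (a x) 0)"
      have r0: "r (a x) 0 < w" if "x \<in> X" for x using rw that by simp
      have R0: "finite R0" "valued X R0" "\<And>x. x \<in> X \<Longrightarrow> val R0 x = r (a x) 0"
        unfolding R0_def using valued_blocks[OF gap(3) r0] val_blocks[OF gap(3) r0] finX by auto
      have R0': "layout w (X \<times> {0}) (\<lambda>x. r (a x)) = R0" by (rule layout_start[OF R0(1,2)]) (simp add: R0(3))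
      define Cs Ds where "Cs = map (\<lambda>i. layout w C' (\<lambda>x j. args (T # Ss) x ! i)) [0..<Suc k]"
        and "Ds = map (\<lambda>i. layout w CL (\<lambda>x j. args (T # Ss) x ! i)) [0..<Suc k]"
      have Cs: "inputs (Suc k) (points w C') Cs"
        "(x, j) \<in> C' \<Longrightarrow> args Cs (x + j * w) = map (\<lambda>i. args (T # Ss) x ! i) [0..<Suc k]" for x j
        unfolding Cs_def by (rule inputs_layout[OF w(1) gap(1) finC(1,3)]; use bound finC in auto)+
      have Ds: "inputs (Suc k) (points w CL) Ds"
        unfolding Ds_def by (rule inputs_layout[OF w(1) gap(1) finC(2,4)]) (use bound finC in auto)
      have Csx: "args (tl (tl Cs)) (x + j * w) = tl (args Ss x)" if "(x, j) \<in> C'" for x j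
      proof -
        have "args (tl (tl Cs)) (x + j * w) = tl (tl (args Cs (x + j * w)))"
          unfolding args_def by (simp add: map_tl)
        also have "args Cs (x + j * w) = args (T # Ss) x"
          unfolding Cs(2)[OF that] using len by (intro nth_equalityI) (auto simp: args_def simp del: upt_Suc)
        finally show ?thesis by (simp add: args_def)
      qed
      define J JL N R' RL where JR: "J = layout w C' (\<lambda>x j. j)" "JL = layout w CL (\<lambda>x j. j)"
        "N = layout w C' (\<lambda>x j. r (a x) (Suc j))" "R' = layout w C' (\<lambda>x. r (a x))"
        "RL = layout w CL (\<lambda>x. r (a x))"
      have bC: "j < w" "r (a x) j < w" "r (a x) (Suc j) < w" if "(x, j) \<in> C'" for x j
        using that n(2)[of x] w(2) rw[of x] unfolding C'_def by auto
      have bL: "j < w" "r (a x) j < w" if "(x, j) \<in> CL" for x j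
        using that n(2)[of x] w(2) rw[of x] unfolding CL_def by auto
      note vl = valued_layout[OF w(1) gap(1) finC(3)] val_layout[OF w(1) gap(1) finC(3)]
        finite_layout[OF w(1) gap(1) finC(3) _ finC(1)]
      have fin: "finite J" "finite N" "finite R'" "finite JL" "finite RL"
        unfolding JR using bC bL finC
        by (auto intro: finite_layout[OF w(1) gap(1) finC(3)] finite_layout[OF w(1) gap(1) finC(4)])
      have inputs_g: "inputs (Suc (Suc m)) (points w C') (J # R' # tl (tl Cs))"
        using Cs(1) set_tl_subset[of Cs] set_tl_subset[of "tl Cs"] fin vl(1) bC Suc
        unfolding inputs_def JR by auto
      have "body X Ss T {w} (points w (C' \<union> CL)) (points w C') (points w CL) J JL R0 N R' RL Cs Ds"
        unfolding body_def
      proof (intro conjI T(2))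
        show "chain (Suc k) {w} X (T # Ss) (points w (C' \<union> CL)) (points w C') (points w CL) J JL Cs Ds"
          using chn unfolding JR Cs_def Ds_def .
        show "link {w} (points w (C' \<union> CL)) (points w C') (points w CL) R0 N R' RL"
          using lkR unfolding R0' JR .
        show "Rf X (tl Ss) R0"
        proof (rule coversD[OF G(1) _ gap(2) R0(1,2)])
          show "inputs m X (tl Ss)" using ins Suc unfolding inputs_def by (cases Ss) auto
          fix x assume x: "x \<in> X"
          have "args (tl Ss) x = tl (fst (a x))" unfolding a_def args_def by (simp add: map_tl)
          then show "(args (tl Ss) x, val R0 x) \<in> Af" unfolding Af_def using a[OF x] R0(3)[OF x] by simp
        qed
        show "Rg (points w C') (J # R' # tl (tl Cs)) N"
        proof (rule coversD[OF G(2) inputs_g])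
          show "gapped Gg (points w C')"
            by (rule gapped_mono[OF gapped_points[OF w(1) gap(1) finC(3)] w(3)]) simp
          show "finite N" "valued (points w C') N" using fin vl(1) bC unfolding JR by auto
          fix y assume "y \<in> points w C'"
          then obtain x j where y: "(x, j) \<in> C'" "y = x + j * w" unfolding points_def by auto
          have "args (J # R' # tl (tl Cs)) y = j # r (a x) j # tl (fst (a x))"
            using Csx[OF y(1)] vl(2)[OF _ y(1)] bC unfolding y(2) JR by (simp add: args_def a_def)
          moreover have "val N y = r (a x) (Suc j)"
            unfolding JR y(2) by (rule vl(2)[OF _ y(1)]) (rule bC(3))
          moreover have "a x \<in> A" "j < hd (fst (a x))" using y(1) a unfolding C'_def n_def by auto
          ultimately show "(args (J # R' # tl (tl Cs)) y, val N y) \<in> Ag"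
            unfolding Ag_def by (auto intro!: image_eqI[of _ _ "(a x, j)"])
        qed
        have "j = args (T # Ss) x ! 1" "r (a x) j = args (T # Ss) x ! 0" if "(x, j) \<in> CL" for x j
          using that n(1) r(2)[OF a] unfolding CL_def n_def by (auto simp: args_def a_def)
        then have "JL = layout w CL (\<lambda>x j. args (T # Ss) x ! 1)" "RL = layout w CL (\<lambda>x j. args (T # Ss) x ! 0)"
          unfolding JR by (auto intro!: layout_cong)
        then show "JL = Ds ! 1" "RL = Ds ! 0" unfolding Ds_def using Suc by (simp_all del: upt_Suc)
      qed
      moreover have "\<forall>Z\<in>set Cs \<union> set Ds. finite Z" "length Cs = Suc k" "length Ds = Suc k"
        using Cs(1) Ds unfolding inputs_def by auto
      moreover have "finite (points w (C' \<union> CL))" "finite (points w C')" "finite (points w CL)"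
        using finC finite_points by blast+
      ultimately show "R X Ss T"
        unfolding R_def using fin R0(1)
        by (intro exI[of _ "[{w}, points w (C' \<union> CL), points w C', points w CL, J, JL, R0, N, R', RL] @ Cs @ Ds"])
          (auto simp: numeral_eq_Suc)
    qed
  qed
  ultimately show ?thesis unfolding parallel_def by blast
qed

text \<open>The search is a walk whose counter is the candidate. All conditions are positive:
  \<open>Y' \<subseteq> F\<close> says that the values before the end are nonzero, and the empty set
  \<open>E\<close> is the value zero at the end. The claimed result travels along and is compared
  with the final counter.\<close>

lemma parallel_RMin:
  assumes f: "\<And>k. parallel k f"
  shows "parallel k (RMin f)"
proof -
  obtain Rf where Rf: "set_definable_relation (Suc k) Rf" "sound (Suc k) f Rf" "complete (Suc k) f Rf"
    using f unfolding parallel_def by blast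
  define body where "body X Ss T W Y Y' L J JL F E Cs Ds \<longleftrightarrow>
      chain (Suc k) W X (T # Ss) Y Y' L J JL Cs Ds \<and> valued X T \<and> Rf Y' (J # tl Cs) F \<and>
      Y' \<subseteq> F \<and> E = {} \<and> Rf L (JL # tl Ds) E \<and> JL = Ds ! 0"
    for X Ss T W Y Y' L J JL F E Cs Ds
  define R where "R X Ss T \<longleftrightarrow>
    (\<exists>Zs. length Zs = 8 + (Suc k + Suc k) \<and> (\<forall>Z\<in>set Zs. finite Z) \<and>
      body X Ss T (Zs ! 0) (Zs ! 1) (Zs ! 2) (Zs ! 3) (Zs ! 4) (Zs ! 5) (Zs ! 6) (Zs ! 7)
        (take (Suc k) (drop 8 Zs)) (drop (8 + Suc k) Zs))" for X Ss T
  have "set_definable_relation k R"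
    unfolding set_definable_relation_def
  proof (intro allI impI)
    fix a t and ss :: "nat list" assume *: "length ss = k"
    define l where "l = 8 + (Suc k + Suc k)"
    define cs ds where "cs = [8..<8 + Suc k]" and "ds = [8 + Suc k..<l]"
    have len: "length cs = Suc k" "length ds = Suc k" unfolding cs_def ds_def l_def by auto
    have "set_definable (\<lambda>e. body (e (l + a)) (map e (map ((+) l) ss)) (e (l + t)) (e 0) (e 1) (e 2) (e 3) (e 4)
      (e 5) (e 6) (e 7) (map e cs) (map e ds))"
      unfolding body_def
    proof (intro set_definable_conj)
      show "set_definable (\<lambda>e. chain (Suc k) (e 0) (e (l + a)) (e (l + t) # map e (map ((+) l) ss)) (e 1) (e 2) (e 3)
          (e 4) (e 5) (map e cs) (map e ds))"
        using set_definable_chain[of "(l + t) # map ((+) l) ss" "Suc k" cs ds 0 "l + a" 1 2 3 4 5] * len by simp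
      show "set_definable (\<lambda>e. Rf (e 2) (e 4 # tl (map e cs)) (e 6))"
        using set_definable_relationD[OF Rf(1), of "4 # tl cs" 2 6] len by (simp add: map_tl)
      show "set_definable (\<lambda>e. Rf (e 3) (e 5 # tl (map e ds)) (e 7))"
        using set_definable_relationD[OF Rf(1), of "5 # tl ds" 3 7] len by (simp add: map_tl)
      show "set_definable (\<lambda>e. e 5 = map e ds ! 0)"
        using len by (simp_all add: set_definable_eq)
    qed (rule set_definable_valued set_definable_subset set_definable_empty)+
    moreover have "take (Suc k) (drop 8 (map e [0..<l])) = map e cs"
        "drop (8 + Suc k) (map e [0..<l]) = map e ds" for e :: "nat \<Rightarrow> nat set"
      unfolding cs_def ds_def l_def by (simp_all add: drop_map take_map del: upt_Suc)
    moreover have "map e [0..<l] ! i = e i" if "i < 8" for i and e :: "nat \<Rightarrow> nat set"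
      using that unfolding l_def by (simp del: upt_Suc)
    ultimately show "set_definable (\<lambda>e. R (e a) (map e ss) (e t))"
      unfolding R_def l_def[symmetric] by (intro set_definable_ex_list) (simp add: comp_def)
  qed
  moreover have "sound k (RMin f) R"
    unfolding sound_def
  proof (intro allI impI)
    fix X Ss T assume ins: "inputs k X Ss" and T: "finite T" and "R X Ss T"
    then obtain Zs where Zs: "length Zs = 8 + (Suc k + Suc k)" "\<And>Z. Z \<in> set Zs \<Longrightarrow> finite Z"
      "body X Ss T (Zs ! 0) (Zs ! 1) (Zs ! 2) (Zs ! 3) (Zs ! 4) (Zs ! 5) (Zs ! 6) (Zs ! 7)
        (take (Suc k) (drop 8 Zs)) (drop (8 + Suc k) Zs)"
      unfolding R_def by blast
    have fin: "finite (Zs ! i)" if "i < 8" for i using Zs(1,2) that by simp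
    define W Y Y' L J JL F E Cs Ds where defs: "W = Zs ! 0" "Y = Zs ! 1" "Y' = Zs ! 2" "L = Zs ! 3"
      "J = Zs ! 4" "JL = Zs ! 5" "F = Zs ! 6" "E = Zs ! 7"
      "Cs = take (Suc k) (drop 8 Zs)" "Ds = drop (8 + Suc k) Zs"
    have finl: "finite Y" "finite Y'" "finite L" "finite J" "finite JL" "length Cs = Suc k"
      "length Ds = Suc k" "\<forall>S\<in>set Cs. finite S" "\<forall>S\<in>set Ds. finite S" and fin': "finite F"
      using fin Zs(1,2) in_set_takeD in_set_dropD unfolding defs by force+
    have ch: "chain (Suc k) W X (T # Ss) Y Y' L J JL Cs Ds" and vT: "valued X T"
      and RfF: "Rf Y' (J # tl Cs) F" "Y' \<subseteq> F" and RfE: "Rf L (JL # tl Ds) {}" and eq: "JL = Ds ! 0"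
      using Zs(3) unfolding body_def defs by auto
    have "frame W X Y Y' L" using ch unfolding chain_def by (rule conjunct1)
    then obtain w where W: "W = {w}" unfolding frame_def by auto
    have ins': "inputs (Suc k) X (T # Ss)" using ins T vT unfolding inputs_def by auto
    note inC = chain_inputs[OF ch finl(2,3,6-9)]
    have "inputs (Suc k) Y' (J # tl Cs)" "inputs (Suc k) L (JL # tl Ds)"
      using inC finl set_tl_subset[of Cs] set_tl_subset[of Ds] unfolding inputs_def by auto
    then have F: "valued Y' F" "\<And>y. y \<in> Y' \<Longrightarrow> rec_eval f (args (J # tl Cs) y) (val F y)"
      and E: "\<And>y. y \<in> L \<Longrightarrow> rec_eval f (args (JL # tl Ds) y) 0"
      using soundD[OF Rf(2) _ fin' RfF(1)] soundD[OF Rf(2) _ _ RfE] by auto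
    have "rec_eval (RMin f) (args Ss x) (val T x)" if x: "x \<in> X" for x
    proof -
      obtain n where n: "\<And>i. i < n \<Longrightarrow> x + i * w \<in> Y'" "x + n * w \<in> L"
        "\<And>i. i < n \<Longrightarrow> val J (x + i * w) = i" "val JL (x + n * w) = n"
        "\<And>i. i < n \<Longrightarrow> args Cs (x + i * w) = args (T # Ss) x" "args Ds (x + n * w) = args (T # Ss) x"
        by (rule chain_walk[OF ch[unfolded W] ins' finl x]) blast
      have tl_args: "args (tl Zs) y = tl (args Zs y)" for Zs y unfolding args_def by (simp add: map_tl)
      have "val JL (x + n * w) = args Ds (x + n * w) ! 0"
        unfolding eq args_def using finl(7) by simp
      then have "val T x = n" unfolding n(4,6) by (simp add: args_def)
      moreover have "args (tl Ds) (x + n * w) = args Ss x"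
        unfolding tl_args n(6) by (simp add: args_def)
      then have "rec_eval f (n # args Ss x) 0"
        using E[OF n(2)] n(4) by (simp add: args_def)
      moreover have "\<exists>v>0. rec_eval f (i # args Ss x) v" if i: "i < n" for i
      proof -
        have "args (tl Cs) (x + i * w) = args Ss x"
          unfolding tl_args n(5)[OF i] by (simp add: args_def)
        then have "rec_eval f (i # args Ss x) (val F (x + i * w))"
          using F(2)[OF n(1)[OF i]] n(3)[OF i] by (simp add: args_def)
        moreover have "val F (x + i * w) \<noteq> 0"
          using n(1)[OF i] RfF(2) val_notin[OF fin', of "x + i * w"] by (metis add_0_right subsetD)
        ultimately show ?thesis by blast
      qed
      ultimately show ?thesis by (simp add: rec_eval.min)
    qed
    then show "valued X T \<and> (\<forall>x\<in>X. rec_eval (RMin f) (args Ss x) (val T x))" using vT by blast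
  qed
  moreover have "complete k (RMin f) R"
    unfolding complete_def
  proof (intro allI impI)
    fix A assume A: "finite A" "\<forall>(xs, y)\<in>A. rec_eval (RMin f) xs y"
    have "\<forall>a. \<exists>r. a \<in> A \<longrightarrow> rec_eval f (snd a # fst a) 0 \<and>
        (\<forall>j<snd a. rec_eval f (j # fst a) (r j) \<and> r j > 0)"
    proof
      fix a
      show "\<exists>r. a \<in> A \<longrightarrow> rec_eval f (snd a # fst a) 0 \<and>
        (\<forall>j<snd a. rec_eval f (j # fst a) (r j) \<and> r j > 0)"
      proof (cases "a \<in> A")
        case True
        then have "rec_eval (RMin f) (fst a) (snd a)" using A(2) by auto
        then have "rec_eval f (snd a # fst a) 0" "\<forall>j. \<exists>v. j < snd a \<longrightarrow> rec_eval f (j # fst a) v \<and> v > 0"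
          by (cases, blast)+
        then show ?thesis using choice[of "\<lambda>j v. j < snd a \<longrightarrow> rec_eval f (j # fst a) v \<and> v > 0"] by blast
      qed simp
    qed
    from choice[OF this] obtain r where r: "\<And>a. a \<in> A \<Longrightarrow> rec_eval f (snd a # fst a) 0"
      "\<And>a j. a \<in> A \<Longrightarrow> j < snd a \<Longrightarrow> rec_eval f (j # fst a) (r a j)"
      "\<And>a j. a \<in> A \<Longrightarrow> j < snd a \<Longrightarrow> r a j > 0"
      by blast
    define Af where "Af = (\<lambda>a. (snd a # fst a, 0)) ` A \<union>
      (\<lambda>(a, j). (j # fst a, r a j)) ` (SIGMA a:A. {..<snd a})"
    have "finite Af" unfolding Af_def using A(1) by auto
    moreover have "\<forall>(xs, y)\<in>Af. rec_eval f xs y" unfolding Af_def using r by auto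
    ultimately obtain Gf where G: "covers (Suc k) Rf Af Gf"
      using Rf(3) unfolding complete_def by meson
    have "finite (\<Union>a\<in>A. insert (snd a) (set (fst a) \<union> r a ` {..<snd a}))"
      using A(1) by simp
    then obtain b where b0: "\<And>v. v \<in> (\<Union>a\<in>A. insert (snd a) (set (fst a) \<union> r a ` {..<snd a})) \<Longrightarrow> v < b"
      using finite_nat_set_iff_bounded by meson
    have b: "snd a < b" "v \<in> set (fst a) \<Longrightarrow> v < b" "j < snd a \<Longrightarrow> r a j < b" if "a \<in> A" for a v j
      using b0 that by auto
    define w where "w = b + Gf + 1"
    have w: "0 < w" "b < w" "Gf \<le> w" unfolding w_def by simp_all
    \<comment> \<open>Calls of \<open>f\<close> occur only at cells, so \<open>Gf\<close> enters the
      step width and the gap of \<open>X\<close> has to accommodate just the layout.\<close>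
    show "\<exists>G. covers k R A G"
      unfolding covers_def
    proof (intro exI[of _ "Suc b * w"] allI impI)
      fix X Ss T assume ins: "inputs k X Ss" and gap: "gapped (Suc b * w) X"
        and T: "finite T" "valued X T" and inA: "\<forall>x\<in>X. (args Ss x, val T x) \<in> A"
      define a where "a x = (args Ss x, val T x)" for x
      have a: "a x \<in> A" if "x \<in> X" for x using inA that unfolding a_def by blast
      define n where "n x = snd (a x)" for x
      have ins': "inputs (Suc k) X (T # Ss)" using ins T unfolding inputs_def by auto
      have len: "length Ss = k" and finX: "finite X" using ins unfolding inputs_def by auto
      have n: "n x < b" "n x \<le> b" if "x \<in> X" for x
        using b(1)[OF a[OF that]] unfolding n_def by auto
      have bound: "args (T # Ss) x ! i < w" if "x \<in> X" "i < Suc k" for x i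
      proof -
        have "args (T # Ss) x ! i < b"
          using that b(1,2)[OF a[OF that(1)]] len
          by (cases i) (auto simp: a_def args_def)
        then show ?thesis using w by simp
      qed
      define C' CL where "C' = {(x, j). x \<in> X \<and> j < n x}" and "CL = {(x, j). x \<in> X \<and> j = n x}"
      have rw: "r (a x) j < w" if "x \<in> X" "j < n x" for x j
        using b(3)[OF a[OF that(1)]] that(2) w(2) unfolding n_def by fastforce
      have nw: "j < w" if "x \<in> X" "j \<le> n x" for x j using n(1)[OF that(1)] that(2) w(2) by simp
      have finC: "finite C'" "finite CL" "C' \<subseteq> X \<times> {..b}" "CL \<subseteq> X \<times> {..b}"
        using link_layout(3,4,5)[OF w(1) gap finX n(2), where F = "\<lambda>x j. j"] nw
        unfolding C'_def CL_def by auto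
      have chn: "chain (Suc k) {w} X (T # Ss) (points w (C' \<union> CL)) (points w C') (points w CL)
        (layout w C' (\<lambda>x j. j)) (layout w CL (\<lambda>x j. j))
        (map (\<lambda>i. layout w C' (\<lambda>x j. args (T # Ss) x ! i)) [0..<Suc k])
        (map (\<lambda>i. layout w CL (\<lambda>x j. args (T # Ss) x ! i)) [0..<Suc k])"
        unfolding C'_def CL_def by (rule chain_layout[OF w(1) gap ins' n(2) w(2) bound])
      define Cs Ds where "Cs = map (\<lambda>i. layout w C' (\<lambda>x j. args (T # Ss) x ! i)) [0..<Suc k]"
        and "Ds = map (\<lambda>i. layout w CL (\<lambda>x j. args (T # Ss) x ! i)) [0..<Suc k]"
      have Cs: "inputs (Suc k) (points w C') Cs"
        "(x, j) \<in> C' \<Longrightarrow> args Cs (x + j * w) = map (\<lambda>i. args (T # Ss) x ! i) [0..<Suc k]" for x j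
        unfolding Cs_def by (rule inputs_layout[OF w(1) gap finC(1,3)]; use bound finC in auto)+
      have Ds: "inputs (Suc k) (points w CL) Ds"
        "(x, j) \<in> CL \<Longrightarrow> args Ds (x + j * w) = map (\<lambda>i. args (T # Ss) x ! i) [0..<Suc k]" for x j
        unfolding Ds_def by (rule inputs_layout[OF w(1) gap finC(2,4)]; use bound finC in auto)+
      have tl_args: "args (tl Zs) y = tl (args Zs y)" for Zs y unfolding args_def by (simp add: map_tl)
      have args_map: "map (\<lambda>i. args (T # Ss) x ! i) [0..<Suc k] = args (T # Ss) x" for x
        using len by (intro nth_equalityI) (auto simp: args_def simp del: upt_Suc)
      have Csx: "args (tl Cs) (x + j * w) = args Ss x" if "(x, j) \<in> C'" for x j
        unfolding tl_args Cs(2)[OF that] args_map by (simp add: args_def)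
      have Dsx: "args (tl Ds) (x + j * w) = args Ss x" if "(x, j) \<in> CL" for x j
        unfolding tl_args Ds(2)[OF that] args_map by (simp add: args_def)
      define J JL F where JF: "J = layout w C' (\<lambda>x j. j)" "JL = layout w CL (\<lambda>x j. j)"
        "F = layout w C' (\<lambda>x. r (a x))"
      have bC: "j < w" "r (a x) j < w" if "(x, j) \<in> C'" for x j
        using that nw[of x] rw[of x] unfolding C'_def by auto
      have bL: "j < w" if "(x, j) \<in> CL" for x j
        using that nw[of x] unfolding CL_def by auto
      note vl = valued_layout[OF w(1) gap finC(3)] val_layout[OF w(1) gap finC(3)]
      have fin: "finite J" "finite F" "finite JL"
        unfolding JF using bC bL finC
        by (auto intro: finite_layout[OF w(1) gap finC(3)] finite_layout[OF w(1) gap finC(4)])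
      have in_f: "inputs (Suc k) (points w C') (J # tl Cs)"
        using Cs(1) set_tl_subset[of Cs] fin vl(1) bC unfolding inputs_def JF by auto
      have in_l: "inputs (Suc k) (points w CL) (JL # tl Ds)"
        using Ds(1) set_tl_subset[of Ds] fin valued_layout[OF w(1) gap finC(4)] bL
        unfolding inputs_def JF by auto
      have "body X Ss T {w} (points w (C' \<union> CL)) (points w C') (points w CL) J JL F {} Cs Ds"
        unfolding body_def
      proof (intro conjI T(2) refl)
        show "chain (Suc k) {w} X (T # Ss) (points w (C' \<union> CL)) (points w C') (points w CL) J JL Cs Ds"
          using chn unfolding JF Cs_def Ds_def .
        show "Rf (points w C') (J # tl Cs) F"
        proof (rule coversD[OF G in_f])
          show "gapped Gf (points w C')"
            by (rule gapped_mono[OF gapped_points[OF w(1) gap finC(3)] w(3)]) simp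
          show "finite F" "valued (points w C') F" using fin vl(1) bC unfolding JF by auto
          fix y assume "y \<in> points w C'"
          then obtain x j where y: "(x, j) \<in> C'" "y = x + j * w" unfolding points_def by auto
          have "args (J # tl Cs) y = j # fst (a x)"
            using Csx[OF y(1)] vl(2)[OF _ y(1)] bC unfolding y(2) JF by (simp add: args_def a_def)
          moreover have "val F y = r (a x) j"
            unfolding JF y(2) by (rule vl(2)[OF _ y(1)]) (rule bC(2))
          moreover have "a x \<in> A" "j < snd (a x)" using y(1) a unfolding C'_def n_def by auto
          ultimately show "(args (J # tl Cs) y, val F y) \<in> Af"
            unfolding Af_def by (auto intro!: image_eqI[of _ _ "(a x, j)"])
        qed
        show "points w C' \<subseteq> F"
        proof
          fix y assume "y \<in> points w C'"
          then obtain x j where y: "(x, j) \<in> C'" "y = x + j * w" unfolding points_def by auto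
          then have "0 < r (a x) j" using r(3) a unfolding C'_def n_def by auto
          then show "y \<in> F" unfolding JF layout_def using y by auto
        qed
        show "Rf (points w CL) (JL # tl Ds) {}"
        proof (rule coversD[OF G in_l])
          show "gapped Gf (points w CL)"
            by (rule gapped_mono[OF gapped_points[OF w(1) gap finC(4)] w(3)]) simp
          fix y assume "y \<in> points w CL"
          then obtain x j where y: "(x, j) \<in> CL" "y = x + j * w" unfolding points_def by auto
          have "args (JL # tl Ds) y = j # fst (a x)"
            using Dsx[OF y(1)] val_layout[OF w(1) gap finC(4) _ y(1)] bL unfolding y(2) JF
            by (simp add: args_def a_def)
          moreover have "a x \<in> A" "j = snd (a x)" using y(1) a unfolding CL_def n_def by auto
          ultimately show "(args (JL # tl Ds) y, val {} y) \<in> Af" unfolding Af_def by auto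
        qed (simp_all add: valued_empty)
        have "j = args (T # Ss) x ! 0" if "(x, j) \<in> CL" for x j
          using that unfolding CL_def n_def by (auto simp: args_def a_def)
        then have "JL = layout w CL (\<lambda>x j. args (T # Ss) x ! 0)"
          unfolding JF by (auto intro!: layout_cong)
        then show "JL = Ds ! 0" unfolding Ds_def by (simp del: upt_Suc)
      qed
      moreover have "\<forall>Z\<in>set Cs \<union> set Ds. finite Z" "length Cs = Suc k" "length Ds = Suc k"
        using Cs(1) Ds unfolding inputs_def by auto
      moreover have "finite (points w (C' \<union> CL))" "finite (points w C')" "finite (points w CL)"
        using finC finite_points by blast+
      ultimately show "R X Ss T"
        unfolding R_def using fin
        by (intro exI[of _ "[{w}, points w (C' \<union> CL), points w C', points w CL, J, JL, F, {}] @ Cs @ Ds"])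
          (auto simp: numeral_eq_Suc)
    qed
  qed
  ultimately show ?thesis unfolding parallel_def by blast
qed

theorem parallel_recf: "parallel k f"
  by (induction f arbitrary: k)
    (auto intro: parallel_RZero parallel_RSucc parallel_RProj parallel_RComp parallel_RPrec parallel_RMin)

text \<open>For the single point \<open>0\<close> every gap condition is vacuous, so soundness and
  completeness give an equivalence. The input \<open>n\<close> is the run \<open>{..<n}\<close> at
  that point and the output \<open>0\<close> is the empty run.\<close>

theorem set_definable_rec_eval:
  obtains P where "set_definable P" "\<And>e n. (\<And>i. finite (e i)) \<Longrightarrow> e 0 = {..<n} \<Longrightarrow> P e \<longleftrightarrow> rec_eval f [n] 0"
proof -
  obtain R where R: "set_definable_relation 1 R" "sound 1 f R" "complete 1 f R"
    using parallel_recf unfolding parallel_def by blast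
  have set_definable: "set_definable (\<lambda>e. \<exists>X. finite X \<and> X = {0} \<and> (\<exists>T. finite T \<and> T = {} \<and> R X [e 0] T))"
    using set_definable_relationD[OF R(1), of "[Suc (Suc 0)]" "Suc 0" 0]
    by (intro set_definable_ex set_definable_conj set_definable_zero set_definable_empty) simp
  have iff: "(\<exists>X. finite X \<and> X = {0} \<and> (\<exists>T. finite T \<and> T = {} \<and> R X [e 0] T)) \<longleftrightarrow> rec_eval f [n] 0"
    if "e 0 = {..<n}" for e n
  proof -
    have val: "val {..<n} 0 = n" by (rule val_eqI) auto
    have "m \<in> Suc ` {..<n}" if "m < n" "0 < m" for m using that by (cases m) auto
    then have valued: "valued {0} {..<n}" unfolding valued_def by auto
    then have ins: "inputs 1 {0} [{..<n}]" unfolding inputs_def by simp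
    have "R {0} [{..<n}] {} \<longleftrightarrow> rec_eval f [n] 0"
    proof
      assume "R {0} [{..<n}] {}"
      then show "rec_eval f [n] 0"
        using soundD(2)[OF R(2) ins, of "{}" 0] val by (simp add: args_def)
    next
      assume "rec_eval f [n] 0"
      then obtain G where "covers 1 R {([n], 0)} G"
        using R(3)[unfolded complete_def, rule_format, of "{([n], 0)}"] by auto
      then show "R {0} [{..<n}] {}"
        by (rule coversD[OF _ ins]) (auto simp: gapped_def valued_empty args_def val)
    qed
    then show ?thesis unfolding that by simp
  qed
  show ?thesis by (rule that[OF set_definable]) (rule iff)
qed

end

subsection \<open>Artin-Schreier equations\<close>

lemma fls_power_nth_0: "0 \<le> fls_subdegree f \<Longrightarrow> fls_nth (f ^ n) 0 = fls_nth f 0 ^ n"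
  for f :: "'a::field fls"
  by (simp add: fls_pow_conv_fps_pow fps_power_zeroth)

lemma fls_nonneg_add:
  assumes "0 \<le> fls_subdegree f" "0 \<le> fls_subdegree g"
  shows "0 \<le> fls_subdegree (f + g)"
  using fls_plus_subdegree[of f g] assms by (cases "f + g = 0") auto

text \<open>Eliminating \<open>c\<close> leaves an identity in powers of \<open>Q\<close> and
  \<open>a\<close>. Size excludes \<open>l < k\<close>; for \<open>k < l\<close> the lowest power of
  \<open>Q\<close> forces \<open>n = k\<close>; and \<open>k = l\<close> gives \<open>l = n\<close>.
  One equation would not suffice: the first one holds for \<open>n = 2\<close> and
  \<open>a = c = l = 1\<close>, where its two summands have merely changed places.\<close>

lemma shift_equations:
  fixes Q a c n l k :: nat
  assumes Q: "1 < Q" and 1: "Q ^ n + Q * c = Q ^ l * Suc (Q * a)"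
    and 2: "Q ^ n + Q * (Q * c) = Q ^ k * Suc (Q * (Q * a))"
  shows "c = Q ^ n * a"
proof -
  have "Q ^ n + Q * (Q ^ n + Q * c) = Q * Q ^ n + (Q ^ n + Q * (Q * c))"
    by (simp add: algebra_simps)
  then have eq: "Q ^ n + (Q ^ Suc l + Q ^ Suc (Suc l) * a) = Q ^ Suc n + (Q ^ k + Q ^ Suc (Suc k) * a)"
    unfolding 1 2 by (simp add: algebra_simps)
  have no: "\<not> Q ^ Suc i dvd Q ^ i" for i
    using Q power_dvd_imp_le[of Q "Suc i" i] by auto
  have dv: "Q ^ i dvd Q ^ j * z" if "i \<le> j" for i j z
    using that by (simp add: le_imp_power_dvd)
  consider "l < k" | "k = l" | "k < l" by linarith
  then show ?thesis
  proof cases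
    case 1
    then have "Q ^ Suc l \<le> Q ^ k" "Q ^ Suc (Suc l) * a \<le> Q ^ Suc (Suc k) * a"
      using Q by (intro power_increasing mult_le_mono1; simp)+
    moreover have "Q ^ n < Q ^ Suc n" using Q by simp
    ultimately show ?thesis using eq by linarith
  next
    case kl: 2
    then have "Q ^ n + Q * Q ^ l = Q * Q ^ n + Q ^ l" using eq by simp
    then have "int Q ^ n + int Q * int Q ^ l = int Q * int Q ^ n + int Q ^ l"
      by (metis of_nat_add of_nat_mult of_nat_power)
    then have "(int Q - 1) * int Q ^ l = (int Q - 1) * int Q ^ n" by (simp add: algebra_simps)
    then have "int Q ^ l = int Q ^ n" using Q by simp
    then have "Q ^ l = Q ^ n" by (metis of_nat_eq_iff of_nat_power)
    then show ?thesis using 1 Q by simp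
  next
    case 3
    consider "n < k" | "k < n" | "n = k" by linarith
    then show ?thesis
    proof cases
      case 1
      have "Q ^ Suc n dvd Q ^ Suc n + (Q ^ k + Q ^ Suc (Suc k) * a)"
        using 1 dv[of "Suc n" k 1] dv[of "Suc n" "Suc (Suc k)" a] by (intro dvd_add) auto
      then have "Q ^ Suc n dvd Q ^ n + (Q ^ Suc l + Q ^ Suc (Suc l) * a)" unfolding eq .
      moreover have "Q ^ Suc n dvd Q ^ Suc l + Q ^ Suc (Suc l) * a"
        using 1 3 dv[of "Suc n" "Suc l" 1] dv[of "Suc n" "Suc (Suc l)" a] by (intro dvd_add) auto
      ultimately show ?thesis using no dvd_add_left_iff by blast
    next
      case 2
      have "Q ^ Suc k dvd Q ^ n + (Q ^ Suc l + Q ^ Suc (Suc l) * a)"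
        using 2 3 dv[of "Suc k" n 1] dv[of "Suc k" "Suc l" 1] dv[of "Suc k" "Suc (Suc l)" a]
        by (intro dvd_add) auto
      then have "Q ^ Suc k dvd Q ^ k + (Q ^ Suc n + Q ^ Suc (Suc k) * a)"
        unfolding eq by (simp only: add.left_commute)
      moreover have "Q ^ Suc k dvd Q ^ Suc n + Q ^ Suc (Suc k) * a"
        using 2 dv[of "Suc k" "Suc n" 1] dv[of "Suc k" "Suc (Suc k)" a] by (intro dvd_add) auto
      ultimately show ?thesis using no dvd_add_left_iff by blast
    next
      case 3
      then show ?thesis using 2 Q by (simp add: algebra_simps)
    qed
  qed
qed

text \<open>All that is used of a finite residue field: \<open>Q\<close>-th powers are additive and
  fix the constants. The assumption \<open>B_dvd\<close> replaces the coprimality of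
  \<open>d\<close> and \<open>Q\<close>.\<close>

locale laurent_frobenius =
  fixes \<alpha> :: "'a::field fls" and d B Q :: nat
  assumes deg: "fls_subdegree \<alpha> = int d" and d_pos: "0 < d"
    and Q_def: "Q = B * B" and B_gt: "3 * d < B"
    and frob: "\<And>f g :: 'a fls. (f + g) ^ Q = f ^ Q + g ^ Q"
    and const_pow: "\<And>c :: 'a. c ^ Q = c"
    and B_dvd: "\<And>n. Q dvd d * n \<Longrightarrow> B dvd n"
begin

abbreviation "v \<equiv> fls_subdegree :: 'a fls \<Rightarrow> int"

definition "x = inverse \<alpha>"

lemma \<alpha>_nz: "\<alpha> \<noteq> 0" using deg d_pos by auto
lemma x_nz: "x \<noteq> 0" unfolding x_def using \<alpha>_nz by simp
lemma x_\<alpha>: "x * \<alpha> = 1" "\<alpha> * x = 1" unfolding x_def using \<alpha>_nz by simp_all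
lemma vx: "v (x ^ n) = - (int d * int n)" unfolding x_def using deg by (simp add: fls_subdegree_pow)
lemma v\<alpha>: "v (\<alpha> ^ n) = int d * int n" using deg by (simp add: fls_subdegree_pow)

lemma B_pos: "B > 3" using B_gt d_pos by simp
lemma B_less_Q: "B < Q" unfolding Q_def using B_pos by simp
lemma Q_pos: "Q > 3" using B_less_Q B_pos by simp

lemma frob_diff: "(f - g) ^ Q = f ^ Q - g ^ Q" for f g :: "'a fls"
  using frob[of "f - g" g] by (simp add: algebra_simps)

lemma B_dvd_int: "int Q dvd int d * z \<Longrightarrow> int B dvd z"
proof -
  assume "int Q dvd int d * z"
  then have "int Q dvd \<bar>int d * z\<bar>" by simp
  also have "\<bar>int d * z\<bar> = int (d * nat \<bar>z\<bar>)" by (simp add: abs_mult)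
  finally have "Q dvd d * nat \<bar>z\<bar>" by (simp only: int_dvd_int_iff)
  then have "B dvd nat \<bar>z\<bar>" by (rule B_dvd)
  then show ?thesis by simp
qed

lemma not_B_dvd: "\<not> B dvd d" "\<not> B dvd 2 * d" "\<not> B dvd 3 * d"
  using B_gt d_pos by (auto dest!: dvd_imp_le)

definition artin_schreier :: "'a fls \<Rightarrow> bool" where "artin_schreier f \<longleftrightarrow> (\<exists>z. f = z ^ Q - z)"

lemma artin_schreier_frob: "artin_schreier (f ^ Q - f)" unfolding artin_schreier_def by blast

lemma artin_schreier_add: "artin_schreier f \<Longrightarrow> artin_schreier g \<Longrightarrow> artin_schreier (f + g)"
  unfolding artin_schreier_def by (metis add_diff_add frob)

lemma artin_schreier_diff: "artin_schreier f \<Longrightarrow> artin_schreier g \<Longrightarrow> artin_schreier (f - g)"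
proof -
  assume "artin_schreier f" "artin_schreier g"
  then obtain y z where "f = y ^ Q - y" "g = z ^ Q - z" unfolding artin_schreier_def by blast
  then have "f - g = (y - z) ^ Q - (y - z)" by (simp add: frob_diff)
  then show ?thesis unfolding artin_schreier_def by blast
qed

lemma artin_schreier_pow: "artin_schreier (f ^ (Q ^ i) - f)"
proof (induction i)
  case 0
  show ?case using artin_schreier_diff[OF artin_schreier_frob artin_schreier_frob, of f f] by simp
next
  case (Suc i)
  have "f ^ (Q ^ Suc i) - f = ((f ^ Q ^ i) ^ Q - f ^ Q ^ i) + (f ^ (Q ^ i) - f)"
    by (simp flip: power_mult add: mult.commute)
  also have "artin_schreier \<dots>" by (rule artin_schreier_add[OF artin_schreier_frob Suc])
  finally show ?case .
qed

text \<open>Up to Artin-Schreier elements, factors \<open>Q\<close> of an exponent do not matter.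
  This is how a formula of fixed size can speak about \<open>x ^ (Q ^ n)\<close> with variable
  \<open>n\<close>.\<close>

lemma artin_schreier_strip_left: "artin_schreier (f ^ (Q ^ i) - g) \<Longrightarrow> artin_schreier (f - g)"
  using artin_schreier_diff[OF _ artin_schreier_pow[of f i], of "f ^ (Q ^ i) - g"] by simp

lemma pow_diff_subdegree:
  assumes "v z < 0"
  shows "v (z ^ Q - z) = int Q * v z" "z ^ Q - z \<noteq> 0"
proof -
  have "z \<noteq> 0" using assms by auto
  moreover have "v (z ^ Q) < v z" using assms Q_pos by (simp add: fls_subdegree_pow)
  ultimately show "v (z ^ Q - z) = int Q * v z"
    using fls_subdegree_diff_eq1[of "z ^ Q" z] by (simp add: fls_subdegree_pow)
  then show "z ^ Q - z \<noteq> 0" using assms Q_pos by (auto simp: mult_less_0_iff)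
qed

lemma artin_schreier_subdegree:
  assumes "artin_schreier f" "v f < 0"
  shows "int Q dvd v f"
proof -
  obtain z where z: "f = z ^ Q - z" using assms(1) unfolding artin_schreier_def by blast
  have "v z < 0"
  proof (rule ccontr)
    assume "\<not> v z < 0"
    then have "0 \<le> v (z ^ Q)" "0 \<le> v (- z)" by (simp_all add: fls_subdegree_pow)
    then have "0 \<le> v (z ^ Q + - z)" by (rule fls_nonneg_add)
    then show False using assms(2) z by simp
  qed
  then show ?thesis using pow_diff_subdegree z by simp
qed

lemma root_of_unity_subdegree: "f ^ Q = f \<Longrightarrow> v f = 0"
proof -
  assume "f ^ Q = f"
  then have "int Q * v f = v f" by (metis fls_subdegree_pow)
  then show ?thesis using Q_pos by simp
qed

text \<open>Monomials with different exponents have different valuations, so nothing cancels and the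
  larger exponent determines the order of the pole.\<close>

lemma artin_schreier_monomials:
  assumes "artin_schreier (x ^ m - x ^ n)" "m \<noteq> n"
  shows "Q dvd d * max m n"
proof -
  have *: "v (x ^ m - x ^ n) = - (int d * int (max m n))"
  proof (cases "m < n")
    case True
    then have "v (x ^ n) < v (x ^ m)" using d_pos by (simp add: vx)
    then show ?thesis using fls_subdegree_diff_eq2[of "x ^ n" "x ^ m"] True x_nz by (simp add: vx)
  next
    case False
    then have "v (x ^ m) < v (x ^ n)" using d_pos assms(2) by (simp add: vx)
    then show ?thesis using fls_subdegree_diff_eq1[of "x ^ m" "x ^ n"] False x_nz by (simp add: vx)
  qed
  then have "v (x ^ m - x ^ n) < 0" using assms(2) d_pos by (auto simp: max_def)
  then have "int Q dvd - int (d * max m n)" using artin_schreier_subdegree[OF assms(1)] * by simp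
  then show ?thesis by (simp only: dvd_minus_iff int_dvd_int_iff)
qed

section \<open>Recognizing the elements x ^ (Q ^ m)\<close>

lemma Q_decompose: "0 < n \<Longrightarrow> \<exists>i m. n = Q ^ i * m \<and> \<not> Q dvd m"
proof (induction n rule: less_induct)
  case (less n)
  show ?case
  proof (cases "Q dvd n")
    case False
    then show ?thesis by (intro exI[of _ 0] exI[of _ n]) auto
  next
    case True
    then obtain k where k: "n = Q * k" by blast
    then have "k < n" "0 < k" using less.prems Q_pos by auto
    then obtain i m where "k = Q ^ i * m" "\<not> Q dvd m" using less.IH by blast
    then show ?thesis using k by (intro exI[of _ "Suc i"] exI[of _ m]) simp
  qed
qed

text \<open>The second Artin-Schreier condition is needed because \<open>d\<close> and \<open>Q\<close> need not be coprime: the first one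
  alone does not exclude \<open>y = x ^ (Q ^ i * M)\<close> with \<open>Q\<close> dividing \<open>d * M\<close>.\<close>

definition pow_Q :: "'a fls \<Rightarrow> bool" where
  "pow_Q y \<longleftrightarrow> y \<in> range (\<lambda>n::int. \<alpha> powi n) \<and> artin_schreier (y - x) \<and> artin_schreier (y ^ B - x ^ B)"

lemma x_powi: "x ^ n = \<alpha> powi (- int n)"
  unfolding x_def by (simp add: power_int_minus power_inverse)

lemma range_cases:
  assumes "y \<in> range (\<lambda>n::int. \<alpha> powi n)"
  obtains n where "y = \<alpha> ^ n" | n where "0 < n" "y = x ^ n"
proof -
  obtain n :: int where n: "y = \<alpha> powi n" using assms by blast
  show ?thesis
  proof (cases "n \<ge> 0")
    case True
    then show ?thesis using that(1)[of "nat n"] n by (simp add: power_int_def)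
  next
    case False
    then show ?thesis using that(2)[of "nat (- n)"] n by (simp add: x_powi)
  qed
qed

text \<open>For nonnegative powers of \<open>\<alpha>\<close> the pole of \<open>x\<close> survives
  in \<open>y - x\<close>; its order \<open>d\<close> is not divisible by \<open>B\<close>.
  Otherwise factors \<open>Q\<close> are stripped from the exponent of \<open>y\<close>, leaving
  \<open>M'\<close>. The first condition yields \<open>M' = 1\<close> or that \<open>B\<close>
  divides \<open>M'\<close>, and the condition on \<open>B\<close>-th powers excludes the second
  case.\<close>

lemma pow_Q_iff: "pow_Q y \<longleftrightarrow> (\<exists>m. y = x ^ (Q ^ m))"
proof
  assume y: "pow_Q y"
  then have "y \<in> range (\<lambda>n::int. \<alpha> powi n)" and W1: "artin_schreier (y - x)" and W2: "artin_schreier (y ^ B - x ^ B)"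
    unfolding pow_Q_def by auto
  then show "\<exists>m. y = x ^ (Q ^ m)"
  proof (cases rule: range_cases)
    case (1 n)
    have "0 \<le> int d * int n" by simp
    moreover have "v x = - int d" "v y = int d * int n" using 1 vx[of 1] by (simp_all add: v\<alpha>)
    ultimately have "v x < v y" using d_pos by linarith
    then have "v (y - x) = - int d" using fls_subdegree_diff_eq2[of x y] x_nz vx[of 1] by simp
    then have "Q dvd d" using artin_schreier_subdegree[OF W1] d_pos by simp
    then show ?thesis using not_B_dvd(1) Q_def by (meson dvd_mult_left)
  next
    case (2 M)
    then obtain i M' where M: "M = Q ^ i * M'" "\<not> Q dvd M'" using Q_decompose by blast
    have "artin_schreier (x ^ M' - x ^ 1)"
      by (rule artin_schreier_strip_left[of _ i]) (use W1 2 M in \<open>simp add: power_mult[symmetric] mult.commute\<close>)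
    moreover have "M' = 1"
    proof (rule ccontr)
      assume "M' \<noteq> 1"
      then have "Q dvd d * max M' 1" using artin_schreier_monomials calculation by blast
      moreover have "M' \<noteq> 0" using M 2 by auto
      ultimately have "B dvd M'" using B_dvd by (simp add: max_def split: if_splits)
      then obtain M'' where M'': "M' = B * M''" by blast
      have "\<not> B dvd M''" using M'' M(2) unfolding Q_def by auto
      have "artin_schreier (x ^ M'' - x ^ B)"
      proof (rule artin_schreier_strip_left[of _ "Suc i"])
        \<comment> \<open>With \<open>M' = B * M''\<close>, the additional \<open>B\<close>-th power
          completes one more factor \<open>Q\<close>, which can be stripped as well.\<close>
        have "y ^ B = (x ^ M'') ^ Q ^ Suc i"
          unfolding 2 M M'' by (simp add: power_mult[symmetric] Q_def ac_simps)
        then show "artin_schreier ((x ^ M'') ^ Q ^ Suc i - x ^ B)" using W2 by simp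
      qed
      moreover have "M'' \<noteq> B" using \<open>\<not> B dvd M''\<close> by auto
      ultimately have *: "Q dvd d * max M'' B" by (rule artin_schreier_monomials)
      have "\<not> Q dvd d * B" using not_B_dvd(1) B_pos unfolding Q_def by auto
      with * have "Q dvd d * M''" by (auto simp: max_def split: if_splits)
      then show False using B_dvd \<open>\<not> B dvd M''\<close> by blast
    qed
    ultimately show ?thesis using 2 M by auto
  qed
next
  assume "\<exists>m. y = x ^ (Q ^ m)"
  then obtain m where m: "y = x ^ (Q ^ m)" by blast
  have "y \<in> range (\<lambda>n::int. \<alpha> powi n)" unfolding m x_powi by blast
  moreover have "artin_schreier (y - x)" unfolding m by (rule artin_schreier_pow)
  moreover have "artin_schreier (y ^ B - x ^ B)"
    using artin_schreier_pow[of "x ^ B" m] unfolding m by (simp add: power_mult[symmetric] mult.commute)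
  ultimately show "pow_Q y" unfolding pow_Q_def by blast
qed

section \<open>Absorbed elements and valuations modulo Q\<close>

definition absorbed :: "nat \<Rightarrow> 'a fls \<Rightarrow> bool" where
  "absorbed u f \<longleftrightarrow> (\<exists>z g h. f = z ^ Q - z + x ^ u * g ^ Q + \<alpha> ^ u * h ^ Q)"

lemma absorbed_add:
  assumes "absorbed u f" "absorbed u f'"
  shows "absorbed u (f + f')"
proof -
  obtain z g h z' g' h' where e: "f = z ^ Q - z + x ^ u * g ^ Q + \<alpha> ^ u * h ^ Q"
    "f' = z' ^ Q - z' + x ^ u * g' ^ Q + \<alpha> ^ u * h' ^ Q" using assms unfolding absorbed_def by blast
  have "f + f' = (z + z') ^ Q - (z + z') + x ^ u * (g + g') ^ Q + \<alpha> ^ u * (h + h') ^ Q"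
    unfolding e frob by (simp add: algebra_simps)
  then show ?thesis unfolding absorbed_def by blast
qed

lemma zero_pow_Q: "(0 :: 'a fls) ^ Q = 0" using Q_pos by simp

text \<open>Modulo absorbed elements \<open>f ^ Q\<close> may be replaced by \<open>f\<close>,
  whereas \<open>x ^ u * f ^ Q\<close> and \<open>\<alpha> ^ u * f ^ Q\<close> vanish. These are the
  rules for dropping the last base-\<open>Q\<close> digit of an exponent.\<close>

lemma absorbed_intros: "absorbed u (f ^ Q - f)" "absorbed u (f - f ^ Q)" "absorbed u (x ^ u * f ^ Q)" "absorbed u (\<alpha> ^ u * f ^ Q)"
  "absorbed u (- (x ^ u * f ^ Q))" "absorbed u (- (\<alpha> ^ u * f ^ Q))"
proof -
  have m: "(- f) ^ Q = - (f ^ Q)" for f :: "'a fls" using frob_diff[of 0 f] zero_pow_Q by simp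
  show "absorbed u (f ^ Q - f)" unfolding absorbed_def
    by (rule exI[of _ f], rule exI[of _ 0], rule exI[of _ 0]) (simp add: zero_pow_Q)
  show "absorbed u (f - f ^ Q)" unfolding absorbed_def
    by (rule exI[of _ "- f"], rule exI[of _ 0], rule exI[of _ 0]) (simp add: zero_pow_Q m)
  show "absorbed u (x ^ u * f ^ Q)" unfolding absorbed_def
    by (rule exI[of _ 0], rule exI[of _ f], rule exI[of _ 0]) (simp add: zero_pow_Q)
  show "absorbed u (\<alpha> ^ u * f ^ Q)" unfolding absorbed_def
    by (rule exI[of _ 0], rule exI[of _ 0], rule exI[of _ f]) (simp add: zero_pow_Q)
  show "absorbed u (- (x ^ u * f ^ Q))" unfolding absorbed_def
    by (rule exI[of _ 0], rule exI[of _ "- f"], rule exI[of _ 0]) (simp add: zero_pow_Q m)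
  show "absorbed u (- (\<alpha> ^ u * f ^ Q))" unfolding absorbed_def
    by (rule exI[of _ 0], rule exI[of _ 0], rule exI[of _ "- f"]) (simp add: zero_pow_Q m)
qed

definition in_class :: "int set \<Rightarrow> 'a fls \<Rightarrow> bool" where
  "in_class A f \<longleftrightarrow> f = 0 \<or> v f mod int Q \<in> A"

text \<open>Valuations in different classes modulo \<open>Q\<close> are different, so leading terms
  cannot cancel. Zero counts as a member of every class.\<close>

lemma in_class_add:
  assumes "in_class A f" "in_class A' g" "A \<inter> A' = {}"
  shows "in_class (A \<union> A') (f + g)" "f + g = 0 \<Longrightarrow> f = 0"
proof -
  have "in_class (A \<union> A') (f + g) \<and> (f + g = 0 \<longrightarrow> f = 0)"
  proof (cases "f = 0 \<or> g = 0")
    case True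
    then show ?thesis using assms unfolding in_class_def by auto
  next
    case False
    then have "v f \<noteq> v g" using assms unfolding in_class_def by auto
    then have "v f < v g \<or> v g < v f" by linarith
    then have "v (f + g) = v f \<or> v (f + g) = v g"
      using fls_subdegree_add_eq1[of f g] fls_subdegree_add_eq2[of g f] False by auto
    moreover have "f + g \<noteq> 0"
    proof
      assume "f + g = 0"
      then have "f = - g" by (simp add: eq_neg_iff_add_eq_0)
      then show False using \<open>v f \<noteq> v g\<close> by simp
    qed
    ultimately show ?thesis using assms False unfolding in_class_def by auto
  qed
  then show "in_class (A \<union> A') (f + g)" "f + g = 0 \<Longrightarrow> f = 0" by auto
qed

lemma in_class_minus: "in_class A f \<Longrightarrow> in_class A (- f)"
  unfolding in_class_def by simp

text \<open>If \<open>z\<close> is integral, its constant coefficient equals its own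
  \<open>Q\<close>-th power, so \<open>z ^ Q - z\<close> has none and the constant \<open>1\<close>
  remains, giving valuation \<open>0\<close>. If \<open>z\<close> has a pole, then
  \<open>z ^ Q\<close> dominates with a pole of order divisible by \<open>Q\<close>.\<close>

lemma constant_term_class:
  assumes "T = 0 \<or> v T > 0"
  shows "z ^ Q - z + 1 - T \<noteq> 0" "v (z ^ Q - z + 1 - T) mod int Q = 0"
proof -
  have "z ^ Q - z + 1 - T \<noteq> 0 \<and> v (z ^ Q - z + 1 - T) mod int Q = 0"
  proof (cases "v z < 0")
    case True
    have "0 \<le> v (1 + - T)" by (rule fls_nonneg_add) (use assms in auto)
    moreover have "int Q * v z < 0" using True Q_pos by (simp add: mult_pos_neg)
    ultimately have less: "v (z ^ Q - z) < v (1 - T)"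
      using pow_diff_subdegree(1)[OF True] by simp
    have "v ((z ^ Q - z) + (1 - T)) = v (z ^ Q - z)"
      by (rule fls_subdegree_add_eq1[OF pow_diff_subdegree(2)[OF True] less])
    then have "v (z ^ Q - z + 1 - T) = int Q * v z"
      using pow_diff_subdegree(1)[OF True] by (simp add: algebra_simps)
    moreover have "int Q * v z < 0" using True Q_pos by (simp add: mult_pos_neg)
    ultimately show ?thesis by auto
  next
    case False
    then have z: "0 \<le> v z" by simp
    have T0: "fls_nth T 0 = 0" using assms by auto
    have c: "fls_nth (z ^ Q - z + 1 - T) 0 = 1"
      using T0 by (simp add: fls_power_nth_0[OF z] const_pow)
    have "0 \<le> v (z ^ Q + (- z + (1 + - T)))"
      by (intro fls_nonneg_add) (use assms z in \<open>auto simp: fls_subdegree_pow\<close>)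
    then have "v (z ^ Q - z + 1 - T) \<ge> 0" by (simp add: algebra_simps)
    moreover have "v (z ^ Q - z + 1 - T) \<le> 0" by (rule fls_subdegree_leI) (simp only: c, simp)
    ultimately show ?thesis using c by auto
  qed
  then show "z ^ Q - z + 1 - T \<noteq> 0" "v (z ^ Q - z + 1 - T) mod int Q = 0" by auto
qed

text \<open>The valuations of the summands of an element of \<open>absorbed u\<close> lie in three different classes modulo
  \<open>Q\<close>, so the constant \<open>1\<close> cannot be cancelled unless \<open>T\<close> meets one of these classes.\<close>

lemma absorbed_class:
  assumes "absorbed u (T - 1)" and u: "\<not> Q dvd 2 * d * u"
  shows "T \<noteq> 0" "v T \<le> 0" "v T mod int Q \<in> {0, int (d * u) mod int Q, - int (d * u) mod int Q}"
proof -
  let ?c = "int (d * u)"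
  obtain z g h where zgh: "T - 1 = z ^ Q - z + x ^ u * g ^ Q + \<alpha> ^ u * h ^ Q"
    using assms(1) unfolding absorbed_def by blast
  define X Y where "X = x ^ u * g ^ Q" and "Y = \<alpha> ^ u * h ^ Q"
  have X: "in_class {- ?c mod int Q} X"
  proof (cases "g = 0")
    case False
    then have "v X = - ?c + int Q * v g" unfolding X_def using x_nz by (simp add: vx fls_subdegree_pow[of g])
    then have "v X mod int Q = - ?c mod int Q" by (simp only: mod_mult_self2)
    then show ?thesis unfolding in_class_def by simp
  qed (simp add: X_def in_class_def zero_pow_Q)
  have Y: "in_class {?c mod int Q} Y"
  proof (cases "h = 0")
    case False
    then have "v Y = ?c + int Q * v h" unfolding Y_def using \<alpha>_nz by (simp add: v\<alpha> fls_subdegree_pow[of h])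
    then have "v Y mod int Q = ?c mod int Q" by (simp only: mod_mult_self2)
    then show ?thesis unfolding in_class_def by simp
  qed (simp add: Y_def in_class_def zero_pow_Q)
  have dQ: "\<not> int Q dvd ?c" "\<not> int Q dvd 2 * ?c"
  proof -
    show "\<not> int Q dvd 2 * ?c"
      using u by (metis int_dvd_int_iff mult.assoc of_nat_mult of_nat_numeral)
    then show "\<not> int Q dvd ?c" by auto
  qed
  have disj: "{- ?c mod int Q} \<inter> {?c mod int Q} = {}"
  proof -
    have "- ?c mod int Q \<noteq> ?c mod int Q"
    proof
      assume "- ?c mod int Q = ?c mod int Q"
      then have "int Q dvd - ?c - ?c" by (simp only: mod_eq_dvd_iff)
      then have "int Q dvd - (2 * ?c)" by (simp add: algebra_simps)
      then show False using dQ(2) by (simp only: dvd_minus_iff)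
    qed
    then show ?thesis by simp
  qed
  have nz: "- ?c mod int Q \<noteq> 0" "?c mod int Q \<noteq> 0"
    using dQ(1) by (auto simp: mod_eq_0_iff_dvd simp del: of_nat_mult)
  have XY: "in_class {- ?c mod int Q, ?c mod int Q} (X + Y)"
    using in_class_add(1)[OF X Y disj] by (simp add: insert_commute)
  have small: "\<not> (T = 0 \<or> v T > 0)"
  proof
    assume *: "T = 0 \<or> v T > 0"
    have "z ^ Q - z + 1 - T = - (X + Y)" using zgh unfolding X_def Y_def by (simp add: algebra_simps)
    then show False
      using constant_term_class[OF *, of z] in_class_minus[OF XY] nz unfolding in_class_def by auto
  qed
  then show "T \<noteq> 0" "v T \<le> 0" by auto
  show "v T mod int Q \<in> {0, ?c mod int Q, - ?c mod int Q}"
  proof (rule ccontr)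
    assume n: "\<not> ?thesis"
    have Tc: "in_class {v T mod int Q} T" unfolding in_class_def by simp
    have XY': "in_class {- ?c mod int Q, ?c mod int Q} (- (X + Y))" by (rule in_class_minus[OF XY])
    have dj: "{v T mod int Q} \<inter> {- ?c mod int Q, ?c mod int Q} = {}" using n by auto
    have "in_class ({v T mod int Q} \<union> {- ?c mod int Q, ?c mod int Q}) (T + - (X + Y))"
      by (rule in_class_add(1)[OF Tc XY' dj])
    moreover have "T + - (X + Y) = z ^ Q - z + 1 - 0"
      using zgh unfolding X_def Y_def by (simp add: algebra_simps)
    ultimately show False
      using constant_term_class[of 0 z] n nz unfolding in_class_def by auto
  qed
qed

subsection \<open>Sums of distinct powers of \<open>Q\<close>\<close>

definition code :: "nat set \<Rightarrow> nat" where "code S = (\<Sum>i\<in>S. Q ^ i)"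

lemma code_empty [simp]: "code {} = 0" unfolding code_def by simp

lemma code_Un: "finite S \<Longrightarrow> finite T \<Longrightarrow> S \<inter> T = {} \<Longrightarrow> code (S \<union> T) = code S + code T"
  unfolding code_def by (rule sum.union_disjoint)

lemma code_shift: "code ((+) n ` S) = Q ^ n * code S"
  unfolding code_def by (subst sum.reindex) (auto simp: sum_distrib_left power_add)

lemma code_Suc: "code (Suc ` S) = Q * code S"
  using code_shift[of 1 S] by (simp add: plus_1_eq_Suc)

lemma code_split:
  assumes "finite S"
  shows "code S = of_bool (0 \<in> S) + Q * code {i. Suc i \<in> S}"
proof -
  have fin: "finite {i. Suc i \<in> S}"
    using finite_vimageI[OF assms, of Suc] by (simp add: vimage_def)
  have "i \<in> Suc ` {i. Suc i \<in> S}" if "i \<in> S" "i \<noteq> 0" for i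
    using that by (cases i) auto
  then have "S = (S \<inter> {0}) \<union> Suc ` {i. Suc i \<in> S}" by auto
  then have "code S = code (S \<inter> {0}) + code (Suc ` {i. Suc i \<in> S})"
    using code_Un[of "S \<inter> {0}" "Suc ` {i. Suc i \<in> S}"] fin by auto
  moreover have "code (S \<inter> {0}) = of_bool (0 \<in> S)"
    unfolding code_def by (cases "0 \<in> S") auto
  ultimately show ?thesis by (simp add: code_Suc)
qed

lemma finite_pred: "finite S \<Longrightarrow> finite {i. Suc i \<in> S}"
  using finite_vimageI[of S Suc] by (simp add: vimage_def)

text \<open>The digits of the codes are \<open>0\<close> and \<open>1\<close>, so their sums are at
  most \<open>2 < Q\<close> and no carry occurs. The equation can thus be compared digit by digit,
  and a common element of \<open>S\<close> and \<open>T\<close> would produce the digit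
  \<open>2\<close>.\<close>

lemma code_Un_iff:
  assumes "finite S" "finite T" "finite U"
  shows "code U = code S + code T \<longleftrightarrow> U = S \<union> T \<and> S \<inter> T = {}"
proof
  assume "code U = code S + code T"
  moreover obtain n where "S \<union> T \<union> U \<subseteq> {..<n}"
    using assms finite_nat_set_iff_bounded by (metis finite_UnI lessThan_iff subsetI)
  ultimately show "U = S \<union> T \<and> S \<inter> T = {}" using assms
  proof (induction n arbitrary: S T U)
    case (Suc n)
    let ?p = "\<lambda>S. {i. Suc i \<in> S}"
    define s t u where "s = (of_bool (0 \<in> S) :: nat)" and "t = (of_bool (0 \<in> T) :: nat)"
      and "u = (of_bool (0 \<in> U) :: nat)"
    have le: "s \<le> 1" "t \<le> 1" "u \<le> 1" unfolding s_def t_def u_def by auto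
    have eq: "u + Q * code (?p U) = (s + t) + Q * (code (?p S) + code (?p T))"
      using Suc.prems(1) code_split[OF Suc.prems(3)] code_split[OF Suc.prems(4)]
        code_split[OF Suc.prems(5)] unfolding s_def t_def u_def by (simp add: algebra_simps)
    have "(u + Q * code (?p U)) mod Q = u" "((s + t) + Q * (code (?p S) + code (?p T))) mod Q = s + t"
      using le Q_pos by (simp_all only: mod_mult_self2) simp_all
    then have 0: "u = s + t" using eq by metis
    then have "code (?p U) = code (?p S) + code (?p T)" using eq Q_pos by simp
    moreover have "?p S \<union> ?p T \<union> ?p U \<subseteq> {..<n}" using Suc.prems(2) by auto
    ultimately have *: "?p U = ?p S \<union> ?p T \<and> ?p S \<inter> ?p T = {}"
      using Suc.IH finite_pred Suc.prems(3-5) by blast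
    have "i \<in> U \<longleftrightarrow> i \<in> S \<or> i \<in> T" "\<not> (i \<in> S \<and> i \<in> T)" for i
    proof -
      have "(i \<in> U \<longleftrightarrow> i \<in> S \<or> i \<in> T) \<and> \<not> (i \<in> S \<and> i \<in> T)"
      proof (cases i)
        case 0
        then show ?thesis using \<open>u = s + t\<close> le unfolding s_def t_def u_def
          by (simp add: of_bool_def split: if_splits)
      qed (use * in blast)
      then show "i \<in> U \<longleftrightarrow> i \<in> S \<or> i \<in> T" "\<not> (i \<in> S \<and> i \<in> T)" by auto
    qed
    then show ?case by blast
  qed auto
qed (use assms code_Un in auto)

lemma code_inj: "finite S \<Longrightarrow> finite T \<Longrightarrow> code S = code T \<longleftrightarrow> S = T"
  using code_Un_iff[of T "{}" S] by auto

section \<open>Numbers whose base-Q digits are 0 and 1\<close>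

inductive digital :: "nat \<Rightarrow> bool" where
  "digital 0"
| "digital n \<Longrightarrow> digital (Q * n)"
| "digital n \<Longrightarrow> digital (Suc (Q * n))"

lemma digital_iff_code: "digital n \<longleftrightarrow> (\<exists>S. finite S \<and> n = code S)"
proof
  show "digital n \<Longrightarrow> \<exists>S. finite S \<and> n = code S"
  proof (induction rule: digital.induct)
    case 1
    show ?case by (rule exI[of _ "{}"]) simp
  next
    case (2 n)
    then obtain S where "finite S" "n = code S" by blast
    then show ?case by (intro exI[of _ "Suc ` S"]) (simp add: code_Suc)
  next
    case (3 n)
    then obtain S where S: "finite S" "n = code S" by blast
    have "code ({0} \<union> Suc ` S) = code {0} + code (Suc ` S)" by (rule code_Un) (use S in auto)
    then have "code ({0} \<union> Suc ` S) = Suc (Q * n)" using S by (simp add: code_Suc) (simp add: code_def)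
    then show ?case using S by (intro exI[of _ "{0} \<union> Suc ` S"]) simp
  qed
next
  assume "\<exists>S. finite S \<and> n = code S"
  then obtain S where "finite S" "n = code S" by blast
  then show "digital n"
  proof (induction n arbitrary: S rule: less_induct)
    case (less n)
    show ?case
    proof (cases "n = 0")
      case False
      have split: "n = of_bool (0 \<in> S) + Q * code {i. Suc i \<in> S}" using code_split less.prems by simp
      have "code {i. Suc i \<in> S} < n"
      proof (cases "code {i. Suc i \<in> S} = 0")
        case neq: False
        then have "code {i. Suc i \<in> S} < Q * code {i. Suc i \<in> S}" using Q_pos by simp
        then show ?thesis using split by linarith
      qed (use False in simp)
      then have "digital (code {i. Suc i \<in> S})" using less.IH finite_pred less.prems(1) by blast
      then show ?thesis using split digital.intros(2,3) by (cases "0 \<in> S") auto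
    qed (simp add: digital.intros)
  qed
qed

text \<open>The digit condition that survives the descent when a number fails to have only the base-\<open>Q\<close>
  digits \<open>0\<close> and \<open>u\<close>; it is too weak by itself because \<open>d\<close> and \<open>Q\<close> need not be coprime.\<close>

function plausible :: "nat \<Rightarrow> nat \<Rightarrow> bool" where
  "plausible u b = (if b = 0 then True
     else if b mod Q = 0 \<or> b mod Q = u then plausible u (b div Q)
     else b mod Q \<noteq> 2 * u \<and> (\<exists>t\<in>{0, u, 2 * u}. int B dvd int (b mod Q) - int t))"
  by auto
termination by (relation "measure snd") (use Q_pos in auto)

declare plausible.simps [simp del]

lemma plausible_descend: "plausible u b \<Longrightarrow> b mod Q = 0 \<or> b mod Q = u \<Longrightarrow> plausible u (b div Q)"
  by (cases "b = 0") (simp_all add: plausible.simps[of u b] plausible.simps[of u 0])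

lemma plausible_bad_digit:
  assumes "plausible u b" "b mod Q \<noteq> 0" "b mod Q \<noteq> u"
  shows "b mod Q \<noteq> 2 * u" "\<exists>t\<in>{0, u, 2 * u}. int B dvd int (b mod Q) - int t"
  using assms by (cases "b = 0"; simp add: plausible.simps[of u b])+

text \<open>The condition for \<open>u = 1\<close> controls the base-\<open>B\<close> digits of \<open>a\<close> in even positions and the one for
  \<open>u = B\<close> those in odd positions.\<close>

lemma plausible_imp_digital:
  "plausible 1 a \<Longrightarrow> plausible B (B * a) \<Longrightarrow> digital a"
proof (induction a rule: less_induct)
  case (less a)
  define j where "j = a mod Q"
  define j0 j1 where "j0 = j mod B" and "j1 = j div B"
  have j: "j < Q" "j = j0 + B * j1" "j0 < B" "j1 < B"
    using Q_pos B_pos unfolding j_def j0_def j1_def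
    by (auto simp: Q_def less_mult_imp_div_less)
  have a: "a = j + Q * (a div Q)" unfolding j_def by simp
  \<comment> \<open>Multiplication by \<open>B\<close> moves the upper base-\<open>B\<close> half of
    a base-\<open>Q\<close> digit to the lower half of the next one; so \<open>B * a\<close> exposes
    \<open>j1\<close>.\<close>
  have Ba: "B * a = B * j0 + Q * (j1 + B * (a div Q))"
    by (subst a, subst j(2)) (simp add: algebra_simps Q_def)
  have Bj0: "B * j0 < Q" using j(3) B_pos unfolding Q_def by simp
  have Ba_mod: "(B * a) mod Q = B * j0" "(B * a) div Q = j1 + B * (a div Q)"
    unfolding Ba using Bj0 Q_pos by simp_all
  show ?case
  proof (cases "j = 0 \<or> j = 1")
    case True
    show ?thesis
    proof (cases "a = 0")
      case False
      have "j0 = j \<and> j1 = 0" using True B_pos unfolding j0_def j1_def by auto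
      then have "plausible B (B * (a div Q))"
        using plausible_descend[OF less.prems(2)] Ba_mod True by auto
      moreover have "plausible 1 (a div Q)"
        using plausible_descend[OF less.prems(1)] True unfolding j_def by auto
      moreover have "a div Q < a" using False Q_pos by simp
      ultimately have "digital (a div Q)" using less.IH by blast
      then show ?thesis using digital.intros(2,3) a True by (metis add_0 plus_1_eq_Suc)
    qed (simp add: digital.intros)
  next
    case False
    then have "a mod Q \<noteq> 0" "a mod Q \<noteq> 1" unfolding j_def by auto
    note bad = plausible_bad_digit[OF less.prems(1) this]
    then obtain t where t: "t \<in> {0, 1, 2 * 1}" "int B dvd int j - int t" unfolding j_def by blast
    have "int j mod int B = int t mod int B" using t(2) by (simp add: mod_eq_dvd_iff)
    then have "j mod B = t mod B" by (metis of_nat_eq_iff zmod_int)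
    then have j0: "j0 = t" using t(1) B_pos unfolding j0_def by auto
    show ?thesis
    proof (cases "j0 = 2")
      case True
      \<comment> \<open>The last digit of \<open>B * a\<close> would be \<open>2 * B\<close>, the
        value that \<open>plausible B\<close> explicitly forbids.\<close>
      then show ?thesis
        using plausible_bad_digit(1)[OF less.prems(2)] Ba_mod(1) B_pos by simp
    next
      case not2: False
      then have "j0 = 0 \<or> j0 = 1" using j0 t(1) by auto
      then have "j1 \<noteq> 0" "plausible B (j1 + B * (a div Q))"
        using False j(2) plausible_descend[OF less.prems(2)] Ba_mod by auto
      define b where "b = j1 + B * (a div Q)"
      have "b mod Q mod B = j1"
        unfolding Q_def b_def using j(4) by (simp add: mod_mod_cancel)
      then have nd: "\<not> B dvd b mod Q" using \<open>j1 \<noteq> 0\<close> by (auto simp: dvd_eq_mod_eq_0)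
      then have "b mod Q \<noteq> 0" "b mod Q \<noteq> B" by (metis dvd_0_right, metis dvd_refl)
      then obtain t where t: "t \<in> {0, B, 2 * B}" "int B dvd int (b mod Q) - int t"
        using plausible_bad_digit(2)[of B b] \<open>plausible B (j1 + _)\<close> unfolding b_def by blast
      have "int B dvd int t" using t(1) by auto
      with t(2) have "int B dvd (int (b mod Q) - int t) + int t" by (rule dvd_add)
      then have "int B dvd int (b mod Q)" by simp
      then show ?thesis using nd by (simp only: int_dvd_int_iff)
    qed
  qed
qed

section \<open>The polynomials theta and the test for codes\<close>

text \<open>Expanding the product, \<open>theta m y\<close> is the sum of \<open>y ^ code S\<close> over \<open>S \<subseteq> {..<m}\<close>.\<close>

primrec theta :: "nat \<Rightarrow> 'a fls \<Rightarrow> 'a fls" where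
  "theta 0 y = 1"
| "theta (Suc m) y = (1 + y) * theta m y ^ Q"

lemma theta_eq: "theta m y ^ Q * (1 + y) = theta m y * (1 + y ^ (Q ^ m))"
proof (induction m)
  case (Suc m)
  have "theta (Suc m) y ^ Q * (1 + y) = (1 + y) * (theta m y ^ Q * (1 + y)) ^ Q"
    by (simp add: power_mult_distrib mult_ac)
  also have "\<dots> = (1 + y) * (theta m y ^ Q * (1 + y ^ (Q ^ Suc m)))"
    unfolding Suc power_mult_distrib frob by (simp flip: power_mult add: mult.commute)
  finally show ?case by (simp add: mult_ac)
qed simp

lemma one_plus_nz: "v y < 0 \<Longrightarrow> 1 + y \<noteq> 0"
  by (auto simp: add_eq_0_iff)

lemma one_plus_subdegree: "v y < 0 \<Longrightarrow> v (1 + y) = v y"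
  using fls_subdegree_add_eq2[of y 1] by (cases "y = 0") auto

lemma theta_nz: "v y < 0 \<Longrightarrow> theta m y \<noteq> 0"
  by (induction m) (simp_all add: one_plus_nz)

lemma theta_subdegree: "v y < 0 \<Longrightarrow> v (theta m y) = int (code {..<m}) * v y"
proof (induction m)
  case (Suc m)
  have *: "{i. Suc i \<in> {..<Suc m}} = {..<m}" by auto
  have "code {..<Suc m} = 1 + Q * code {..<m}" using code_split[of "{..<Suc m}"] unfolding * by simp
  moreover have "v (theta (Suc m) y) = v (1 + y) + v (theta m y ^ Q)"
    using one_plus_nz[OF Suc.prems] theta_nz[OF Suc.prems] by simp
  ultimately show ?case using Suc
    by (simp add: one_plus_subdegree fls_subdegree_pow algebra_simps)
qed simp

text \<open>The quotient of two nonzero solutions of the equation is fixed by the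
  \<open>Q\<close>-th power. Such a factor has valuation \<open>0\<close> and passes through
  \<open>Q\<close>-th powers, so the ambiguity is harmless in valuation arguments.\<close>

lemma theta_unique:
  assumes "v y < 0" "F \<noteq> 0" "F ^ Q * (1 + y) = F * (1 + y ^ (Q ^ m))"
  obtains \<zeta> where "F = \<zeta> * theta m y" "\<zeta> ^ Q = \<zeta>" "\<zeta> \<noteq> 0"
proof
  let ?t = "theta m y"
  have nz: "?t \<noteq> 0" "1 + y \<noteq> 0" "?t ^ Q \<noteq> 0" using theta_nz one_plus_nz assms(1) by auto
  show "F = F / ?t * ?t" "F / ?t \<noteq> 0" using nz assms(2) by auto
  have "F ^ Q * ?t * (1 + y) = F * ?t * (1 + y ^ (Q ^ m))" using assms(3) by (simp add: mult_ac)
  also have "\<dots> = F * ?t ^ Q * (1 + y)" using theta_eq[of m y] by (simp add: mult_ac)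
  finally have "F ^ Q * ?t = F * ?t ^ Q" using nz by simp
  then show "(F / ?t) ^ Q = F / ?t" using nz by (simp add: power_divide frac_eq_eq)
qed

text \<open>For last digit \<open>0\<close> the factor next to \<open>H ^ Q\<close> is
  \<open>1 + x ^ u\<close>, for last digit \<open>u\<close> it is \<open>\<alpha> ^ u + 1\<close>.
  In both cases the summand \<open>1\<close> turns \<open>H ^ Q\<close> into \<open>H\<close> and
  the other summand is absorbed.\<close>

lemma absorbed_theta_descend:
  assumes "absorbed u (T - 1)" "T = (f + g) * H ^ Q" "f = 1 \<and> (g = x ^ u \<or> g = \<alpha> ^ u) \<or> g = 1 \<and> (f = x ^ u \<or> f = \<alpha> ^ u)"
  shows "absorbed u (H - 1)"
proof -
  obtain h where h: "f + g = 1 + h" "h = x ^ u \<or> h = \<alpha> ^ u" using assms(3) by (auto simp: add.commute)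
  have "H - 1 = (T - 1) + ((H - H ^ Q) + - (h * H ^ Q))"
    unfolding assms(2) h(1) by (simp add: algebra_simps)
  moreover have "absorbed u (- (h * H ^ Q))" using h(2) absorbed_intros(5,6) by blast
  ultimately show ?thesis using absorbed_add[OF assms(1)] absorbed_add[OF absorbed_intros(2)] by metis
qed

text \<open>Induction on \<open>m\<close>, which drops the last digit \<open>j\<close> of
  \<open>b\<close> as long as it is \<open>0\<close> or \<open>u\<close>. Any other \<open>j\<close>
  is confronted with the three classes of valuations from \<open>absorbed_class\<close>. When the
  product is exhausted, a remaining positive exponent would make the valuation positive.\<close>

lemma theta_plausible:
  assumes "u = 1 \<or> u = B" and \<zeta>: "\<zeta> ^ Q = \<zeta>" "\<zeta> \<noteq> 0"
    and "absorbed u (\<zeta> * \<alpha> ^ b * theta m (x ^ u) - 1)"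
  shows "plausible u b"
proof -
  have uQ: "u < Q" "\<not> Q dvd 2 * d * u" "\<not> Q dvd 3 * d * u" "\<not> Q dvd d * u"
  proof -
    show "u < Q" using assms B_less_Q Q_pos by auto
    have n: "\<not> Q dvd n * u" if "\<not> B dvd n" for n
      using assms B_pos that unfolding Q_def by (auto dest: dvd_mult_left)
    show "\<not> Q dvd 2 * d * u" "\<not> Q dvd 3 * d * u" "\<not> Q dvd d * u" using n not_B_dvd by auto
  qed
  have v\<zeta>: "v \<zeta> = 0" by (rule root_of_unity_subdegree[OF \<zeta>(1)])
  have vxu: "v (x ^ u) < 0" using assms B_pos d_pos by (auto simp: vx)
  show ?thesis
    using assms(4)
  proof (induction m arbitrary: b)
    case 0
    have nz: "\<zeta> * \<alpha> ^ b \<noteq> 0" using \<zeta>(2) \<alpha>_nz by simp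
    have "v (\<zeta> * \<alpha> ^ b) = int d * int b" using \<zeta>(2) \<alpha>_nz v\<zeta> by (simp add: v\<alpha>)
    moreover have "v (\<zeta> * \<alpha> ^ b) \<le> 0" using absorbed_class(2)[OF _ uQ(2), of "\<zeta> * \<alpha> ^ b"] 0 by simp
    ultimately have "b = 0" using d_pos by (auto simp: mult_le_0_iff)
    then show ?case by (simp add: plausible.simps)
  next
    case (Suc m)
    define j c where "j = b mod Q" and "c = b div Q"
    define H where "H = \<zeta> * \<alpha> ^ c * theta m (x ^ u)"
    have H_nz: "H \<noteq> 0" unfolding H_def using \<zeta>(2) \<alpha>_nz theta_nz[OF vxu] by simp
    have "\<alpha> ^ b = \<alpha> ^ j * (\<alpha> ^ c) ^ Q"
      unfolding j_def c_def by (simp flip: power_mult power_add add: mult.commute)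
    then have T: "\<zeta> * \<alpha> ^ b * theta (Suc m) (x ^ u) = \<alpha> ^ j * (1 + x ^ u) * H ^ Q" (is "?T = _")
      unfolding H_def using \<zeta>(1) by (simp add: power_mult_distrib mult_ac)
    have \<alpha>x: "\<alpha> ^ n * x ^ n = 1" for n by (simp flip: power_mult_distrib add: x_\<alpha>)
    show ?case
    proof (cases "b = 0 \<or> j = 0 \<or> j = u")
      case True
      show ?thesis
      proof (cases "b = 0")
        case False
        then consider "j = 0" | "j = u" using True by blast
        then have "absorbed u (H - 1)"
        proof cases
          case 1
          then show ?thesis using absorbed_theta_descend[OF Suc(2), of 1 "x ^ u" H] T by simp
        next
          case 2
          then have "?T = (\<alpha> ^ u + 1) * H ^ Q" using T \<alpha>x[of u] by (simp add: algebra_simps)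
          then show ?thesis using absorbed_theta_descend[OF Suc(2), of "\<alpha> ^ u" 1 H] by simp
        qed
        then have "plausible u c" unfolding H_def by (rule Suc.IH)
        then show ?thesis using True False unfolding j_def c_def by (auto simp: plausible.simps[of u b])
      qed (simp add: plausible.simps)
    next
      case False
      have dvdI: "int B dvd int j - int t"
        if "int Q dvd int d * (int j - int t)" for t using B_dvd_int that .
      have "j \<noteq> 2 * u"
      proof
        assume j: "j = 2 * u"
        \<comment> \<open>This digit would pass the divisibility test below, because the leading
          term has valuation in the class of \<open>d * u\<close>. But the second summand is
          absorbed, and the first has valuation in the class of \<open>2 * d * u\<close>, which is
          not allowed.\<close>
        have "?T = \<alpha> ^ (2 * u) * H ^ Q + \<alpha> ^ u * H ^ Q"
        proof -
          have "\<alpha> ^ (2 * u) * x ^ u = \<alpha> ^ u" using \<alpha>x[of u] by (simp add: mult_2 power_add mult.assoc)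
          then show ?thesis unfolding T j by (simp add: distrib_left distrib_right)
        qed
        then have "\<alpha> ^ (2 * u) * H ^ Q - 1 = (?T - 1) + - (\<alpha> ^ u * H ^ Q)" by simp
        then have "absorbed u (\<alpha> ^ (2 * u) * H ^ Q - 1)" using absorbed_add[OF Suc(2) absorbed_intros(6)] by metis
        then have *: "v (\<alpha> ^ (2 * u) * H ^ Q) mod int Q
            \<in> {0, int (d * u) mod int Q, - int (d * u) mod int Q}" by (rule absorbed_class(3)[OF _ uQ(2)])
        have "v (\<alpha> ^ (2 * u) * H ^ Q) = 2 * int (d * u) + int Q * v H"
          using \<alpha>_nz H_nz by (simp add: v\<alpha> fls_subdegree_pow[of H])
        then have "v (\<alpha> ^ (2 * u) * H ^ Q) mod int Q = 2 * int (d * u) mod int Q"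
          by (simp only: mod_mult_self2)
        then have "2 * int (d * u) mod int Q \<in> {0, int (d * u) mod int Q, - int (d * u) mod int Q}"
          using * by simp
        then have "int Q dvd 2 * int (d * u) \<or> int Q dvd 2 * int (d * u) - int (d * u) \<or>
            int Q dvd 2 * int (d * u) - (- int (d * u))"
          by (auto simp only: mod_eq_dvd_iff mod_eq_0_iff_dvd insert_iff empty_iff)
        then have "int Q dvd int (2 * d * u) \<or> int Q dvd int (d * u) \<or> int Q dvd int (3 * d * u)"
          by (simp add: algebra_simps)
        then show False using uQ by (auto simp only: int_dvd_int_iff)
      qed
      moreover have "\<exists>t\<in>{0, u, 2 * u}. int B dvd int j - int t"
      proof -
        \<comment> \<open>The pole of \<open>1 + x ^ u\<close> contributes \<open>- (d * u)\<close>.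
          Hence the classes \<open>0\<close>, \<open>d * u\<close> and \<open>- (d * u)\<close>
          correspond to the digits \<open>u\<close>, \<open>2 * u\<close> and \<open>0\<close>, up
          to the loss caused by the factor \<open>d\<close>.\<close>
        have "v ?T = int d * int j - int (d * u) + int Q * v H"
          unfolding T using \<alpha>_nz H_nz one_plus_nz[OF vxu]
          by (simp add: v\<alpha> one_plus_subdegree[OF vxu] vx fls_subdegree_pow[of H])
        then have "v ?T mod int Q = (int d * int j - int (d * u)) mod int Q"
          by (simp only: mod_mult_self2)
        moreover have "v ?T mod int Q \<in> {0, int (d * u) mod int Q, - int (d * u) mod int Q}"
          by (rule absorbed_class(3)[OF Suc(2) uQ(2)])
        ultimately have "(int d * int j - int (d * u)) mod int Q
            \<in> {0, int (d * u) mod int Q, - int (d * u) mod int Q}" by metis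
        then have "int Q dvd int d * int j - int (d * u) \<or>
            int Q dvd int d * int j - int (d * u) - int (d * u) \<or>
            int Q dvd int d * int j - int (d * u) - (- int (d * u))"
          by (auto simp only: mod_eq_dvd_iff mod_eq_0_iff_dvd insert_iff empty_iff)
        then have "int Q dvd int d * (int j - int u) \<or> int Q dvd int d * (int j - int (2 * u)) \<or>
            int Q dvd int d * (int j - int 0)" by (simp add: algebra_simps)
        then show ?thesis using dvdI by blast
      qed
      ultimately show ?thesis using False unfolding j_def by (simp add: plausible.simps[of u b])
    qed
  qed
qed

lemma theta_complete:
  assumes "S \<subseteq> {..<m}"
  shows "absorbed u (\<alpha> ^ (u * code S) * theta m (x ^ u) - 1)"
  using assms
proof (induction m arbitrary: S)
  case 0
  then show ?case using absorbed_intros(1)[of u 0] zero_pow_Q by simp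
next
  case (Suc m)
  let ?S = "{i. Suc i \<in> S}"
  define H where "H = \<alpha> ^ (u * code ?S) * theta m (x ^ u)"
  have H: "absorbed u (H - 1)" unfolding H_def by (rule Suc.IH) (use Suc.prems in auto)
  have fin: "finite S" using Suc.prems finite_subset by blast
  have \<alpha>x: "\<alpha> ^ u * x ^ u = 1" by (simp flip: power_mult_distrib add: x_\<alpha>)
  define \<epsilon> where "\<epsilon> = \<alpha> ^ (u * of_bool (0 \<in> S))"
  have "\<alpha> ^ (u * code S) = \<epsilon> * (\<alpha> ^ (u * code ?S)) ^ Q"
    unfolding \<epsilon>_def by (subst code_split[OF fin]) (simp flip: power_mult power_add add: algebra_simps)
  then have T: "\<alpha> ^ (u * code S) * theta (Suc m) (x ^ u) = \<epsilon> * (1 + x ^ u) * H ^ Q"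
    unfolding H_def by (simp add: power_mult_distrib mult_ac)
  have "\<exists>h. (h = x ^ u \<or> h = \<alpha> ^ u) \<and> \<epsilon> * (1 + x ^ u) = 1 + h"
    using \<alpha>x unfolding \<epsilon>_def by (cases "0 \<in> S") (auto simp: algebra_simps)
  then obtain h where h: "h = x ^ u \<or> h = \<alpha> ^ u" "\<epsilon> * (1 + x ^ u) = 1 + h" by blast
  have "\<alpha> ^ (u * code S) * theta (Suc m) (x ^ u) - 1 = (H - 1) + ((H ^ Q - H) + h * H ^ Q)"
    unfolding T h(2) by (simp add: algebra_simps)
  moreover have "absorbed u (h * H ^ Q)" using h(1) absorbed_intros(3,4) by blast
  ultimately show ?case using absorbed_add[OF H absorbed_add[OF absorbed_intros(1)]] by metis
qed

text \<open>With \<open>M = x ^ (Q ^ m)\<close>, the element \<open>F\<close> is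
  \<open>theta m (x ^ u)\<close> up to a factor fixed by the \<open>Q\<close>-th power, although
  \<open>m\<close> itself does not occur. \<open>G\<close> is the inverse of
  \<open>y ^ u\<close>.\<close>

definition test :: "nat \<Rightarrow> 'a fls \<Rightarrow> 'a fls \<Rightarrow> bool" where
  "test u M y \<longleftrightarrow> (\<exists>F G. F \<noteq> 0 \<and> G * y ^ u = 1 \<and> F ^ Q * (1 + x ^ u) = F * (1 + M ^ u) \<and> absorbed u (F * G - 1))"

text \<open>The element \<open>y'\<close> represents the complement in \<open>{..<m}\<close>; testing it as well excludes positive powers of
  \<open>\<alpha>\<close>.\<close>

definition is_code :: "'a fls \<Rightarrow> bool" where
  "is_code y \<longleftrightarrow> y \<in> range (\<lambda>n::int. \<alpha> powi n) \<and> (\<exists>M I y'. pow_Q M \<and>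
     I \<in> range (\<lambda>n::int. \<alpha> powi n) \<and> I ^ (Q - 1) * x = M \<and> y' * y = I \<and>
     test 1 M y \<and> test B M y \<and> test 1 M y')"

text \<open>The geometric sum. It ties the representative \<open>I\<close> of \<open>{..<m}\<close>
  to \<open>M = x ^ (Q ^ m)\<close> by an equation with the constant exponent
  \<open>Q - 1\<close>.\<close>

lemma code_lessThan: "code {..<m} * (Q - 1) + 1 = Q ^ m"
proof (induction m)
  case (Suc m)
  have *: "{i. Suc i \<in> {..<Suc m}} = {..<m}" by auto
  have "code {..<Suc m} = 1 + Q * code {..<m}" using code_split[of "{..<Suc m}"] unfolding * by simp
  moreover obtain r where "Q = Suc r" using Q_pos by (cases Q) auto
  ultimately have "code {..<Suc m} * (Q - 1) + 1 = Q * (code {..<m} * (Q - 1) + 1)"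
    by (simp add: algebra_simps)
  then show ?case unfolding Suc by simp
qed simp

lemma testE:
  assumes "test u (x ^ (Q ^ m)) y" "u = 1 \<or> u = B"
  obtains \<zeta> G where "\<zeta> ^ Q = \<zeta>" "\<zeta> \<noteq> 0" "G * y ^ u = 1" "absorbed u (\<zeta> * G * theta m (x ^ u) - 1)"
proof -
  obtain F G where FG: "F \<noteq> 0" "G * y ^ u = 1"
    "F ^ Q * (1 + x ^ u) = F * (1 + (x ^ (Q ^ m)) ^ u)" "absorbed u (F * G - 1)"
    using assms(1) unfolding test_def by blast
  have "v (x ^ u) < 0" using assms(2) B_pos d_pos by (auto simp: vx)
  moreover have "F ^ Q * (1 + x ^ u) = F * (1 + (x ^ u) ^ (Q ^ m))"
    using FG(3) by (simp flip: power_mult add: mult.commute)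
  ultimately obtain \<zeta> where "F = \<zeta> * theta m (x ^ u)" "\<zeta> ^ Q = \<zeta>" "\<zeta> \<noteq> 0"
    using theta_unique FG(1) by metis
  then show ?thesis using that[of \<zeta> G] FG by (simp add: mult_ac)
qed

lemma \<alpha>x_power: "\<alpha> ^ n * x ^ n = 1"
  by (simp flip: power_mult_distrib add: x_\<alpha>)

lemma test_plausible:
  assumes "test u (x ^ (Q ^ m)) (x ^ a)" "u = 1 \<or> u = B"
  shows "plausible u (u * a)"
proof -
  obtain \<zeta> G where *: "\<zeta> ^ Q = \<zeta>" "\<zeta> \<noteq> 0" "G * (x ^ a) ^ u = 1" "absorbed u (\<zeta> * G * theta m (x ^ u) - 1)"
    by (rule testE[OF assms])
  have "(x ^ a) ^ u = x ^ (u * a)" by (simp flip: power_mult add: mult.commute)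
  then have "G * x ^ (u * a) = \<alpha> ^ (u * a) * x ^ (u * a)"
    using *(3) \<alpha>x_power[of "u * a"] by simp
  then have "G = \<alpha> ^ (u * a)" using x_nz by simp
  then show ?thesis using theta_plausible[OF assms(2) *(1,2)] *(4) by simp
qed

text \<open>For smaller \<open>v y\<close> the product of \<open>G\<close> with theta would have
  positive valuation, and \<open>absorbed_class\<close> forbids that. Applied to the complement of
  \<open>y\<close>, the bound becomes \<open>v y \<le> 0\<close>.\<close>

lemma test_bound:
  assumes "test 1 (x ^ (Q ^ m)) y"
  shows "v y \<ge> - int (d * code {..<m})"
proof -
  obtain \<zeta> G where *: "\<zeta> ^ Q = \<zeta>" "\<zeta> \<noteq> 0" "G * y ^ 1 = 1" "absorbed 1 (\<zeta> * G * theta m (x ^ 1) - 1)"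
    using testE[OF assms] by blast
  have vx1: "v (x ^ 1) = - int d" using vx[of 1] by simp
  have "\<not> B dvd 2 * d * 1" using not_B_dvd by simp
  then have nd: "\<not> Q dvd 2 * d * 1" unfolding Q_def by (meson dvd_mult_left)
  have "v \<zeta> = 0" by (rule root_of_unity_subdegree[OF *(1)])
  moreover have "v G = - v y"
  proof -
    have "G \<noteq> 0" "y \<noteq> 0" using *(3) by auto
    then have "v G + v y = v (G * y)" by simp
    then show ?thesis using *(3) by simp
  qed
  moreover have "v (theta m (x ^ 1)) = - int (d * code {..<m})" "theta m (x ^ 1) \<noteq> 0"
    using theta_subdegree[of "x ^ 1" m] theta_nz[of "x ^ 1" m] d_pos unfolding vx1 by simp_all
  moreover have "G \<noteq> 0" using *(3) by auto
  ultimately have "v (\<zeta> * G * theta m (x ^ 1)) = - v y - int (d * code {..<m})" using *(2) by simp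
  then show ?thesis using absorbed_class(2)[OF *(4) nd] by linarith
qed

text \<open>The equation alone has further roots, but an integral power of \<open>\<alpha>\<close>
  is determined by its valuation.\<close>

lemma root_pow_Q:
  assumes "I \<in> range (\<lambda>n::int. \<alpha> powi n)" "I ^ (Q - 1) * x = x ^ (Q ^ m)"
  shows "I = x ^ code {..<m}"
proof -
  obtain n :: int where n: "I = \<alpha> powi n" using assms(1) by blast
  have "I \<noteq> 0" using n \<alpha>_nz by simp
  have "v (I ^ (Q - 1) * x) = v (x ^ (Q ^ m))" using assms(2) by simp
  then have "int (Q - 1) * v I - int d = - (int d * int (Q ^ m))"
    using \<open>I \<noteq> 0\<close> x_nz vx[of 1] by (simp add: fls_subdegree_pow vx)
  also have "int (Q ^ m) = int (code {..<m}) * int (Q - 1) + 1"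
    by (metis code_lessThan of_nat_1 of_nat_add of_nat_mult)
  finally have "int (Q - 1) * v I = int (Q - 1) * - (int d * int (code {..<m}))"
    by (simp add: algebra_simps)
  moreover have "int (Q - 1) \<noteq> 0" using Q_pos by simp
  ultimately have "v I = - (int d * int (code {..<m}))" using mult_left_cancel by blast
  moreover have "v I = n * int d" unfolding n using \<alpha>_nz deg by simp
  ultimately have "int d * n = int d * - int (code {..<m})" by (simp add: mult.commute)
  moreover have "int d \<noteq> 0" using d_pos by simp
  ultimately have "n = - int (code {..<m})" using mult_left_cancel by blast
  then show ?thesis unfolding n x_powi by simp
qed

lemma test_complete:
  assumes "S \<subseteq> {..<m}" "u = 1 \<or> u = B"
  shows "test u (x ^ (Q ^ m)) (x ^ code S)"
  unfolding test_def
proof (intro exI conjI)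
  have "v (x ^ u) < 0" using assms(2) B_pos d_pos by (auto simp: vx)
  then show "theta m (x ^ u) \<noteq> 0" by (rule theta_nz)
  show "\<alpha> ^ (u * code S) * (x ^ code S) ^ u = 1"
    using \<alpha>x_power[of "u * code S"] by (simp add: power_mult mult.commute[of u])
  show "theta m (x ^ u) ^ Q * (1 + x ^ u) = theta m (x ^ u) * (1 + (x ^ (Q ^ m)) ^ u)"
    unfolding theta_eq by (simp flip: power_mult add: mult.commute)
  show "absorbed u (theta m (x ^ u) * \<alpha> ^ (u * code S) - 1)"
    using theta_complete[OF assms(1)] by (simp add: mult.commute)
qed

theorem is_code_iff: "is_code y \<longleftrightarrow> (\<exists>S. finite S \<and> y = x ^ code S)"
proof
  assume "is_code y"
  then obtain M I y' where *: "y \<in> range (\<lambda>n::int. \<alpha> powi n)" "pow_Q M"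
    "I \<in> range (\<lambda>n::int. \<alpha> powi n)" "I ^ (Q - 1) * x = M" "y' * y = I"
    "test 1 M y" "test B M y" "test 1 M y'"
    unfolding is_code_def by blast
  obtain m where m: "M = x ^ (Q ^ m)" using *(2) pow_Q_iff by blast
  have I: "I = x ^ code {..<m}" using root_pow_Q *(3,4) unfolding m by blast
  have "y' \<noteq> 0" "y \<noteq> 0" using *(5) I x_nz by auto
  then have "v y' + v y = - int (d * code {..<m})" using *(5) I vx by (metis fls_subdegree_mult of_nat_mult)
  then have "v y \<le> 0" using test_bound[of m y'] *(8) m by simp
  have "\<exists>a. y = x ^ a"
    using *(1)
  proof (cases rule: range_cases)
    case (1 n)
    then have "n = 0" using \<open>v y \<le> 0\<close> d_pos by (auto simp: v\<alpha> mult_le_0_iff)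
    then show ?thesis using 1 by (intro exI[of _ 0]) simp
  qed auto
  then obtain a where a: "y = x ^ a" by blast
  have "plausible 1 a" using test_plausible[of 1 m a] *(6) unfolding m a by simp
  moreover have "plausible B (B * a)" using test_plausible[of B m a] *(7) unfolding m a by simp
  ultimately have "digital a" by (rule plausible_imp_digital)
  then obtain S where "finite S" "a = code S" using digital_iff_code by auto
  then show "\<exists>S. finite S \<and> y = x ^ code S" using a by auto
next
  assume "\<exists>S. finite S \<and> y = x ^ code S"
  then obtain S where S: "finite S" "y = x ^ code S" by blast
  then obtain m where m: "S \<subseteq> {..<m}" using finite_nat_set_iff_bounded by (metis lessThan_iff subsetI)
  let ?I = "x ^ code {..<m}" and ?y = "x ^ code ({..<m} - S)"
  show "is_code y"
    unfolding is_code_def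
  proof (intro conjI exI)
    show "y \<in> range (\<lambda>n::int. \<alpha> powi n)" "?I \<in> range (\<lambda>n::int. \<alpha> powi n)"
      unfolding S(2) x_powi by blast+
    show "pow_Q (x ^ (Q ^ m))" using pow_Q_iff by blast
    show "?I ^ (Q - 1) * x = x ^ (Q ^ m)"
      using code_lessThan[of m] by (metis Suc_eq_plus1 power_Suc2 power_mult)
    have "({..<m} - S) \<union> S = {..<m}" using m by blast
    then have "code {..<m} = code ({..<m} - S) + code S"
      using code_Un[of "{..<m} - S" S] S(1) by auto
    then show "?y * y = ?I" unfolding S(2) by (simp flip: power_add)
    show "test 1 (x ^ (Q ^ m)) y" "test B (x ^ (Q ^ m)) y"
      unfolding S(2) by (rule test_complete[OF m]; simp)+
    show "test 1 (x ^ (Q ^ m)) ?y" by (rule test_complete) auto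
  qed
qed

section \<open>Translation by a variable amount\<close>

definition is_shift :: "'a fls \<Rightarrow> 'a fls \<Rightarrow> 'a fls \<Rightarrow> bool" where
  "is_shift J a c \<longleftrightarrow> pow_Q J \<and> artin_schreier (J * c ^ Q - x * a ^ Q) \<and> artin_schreier (J * c ^ (Q * Q) - x * a ^ (Q * Q))"

text \<open>Adding one power of \<open>Q\<close> to digits \<open>0\<close> and \<open>1\<close>
  causes no carry, so the lowest nonzero digit is \<open>1\<close>, or \<open>2\<close> if the added
  power meets it.\<close>

lemma digital_plus_power:
  assumes "digital c"
  shows "\<exists>s c'. Q ^ n + c = Q ^ s * c' \<and> (c' mod Q = 1 \<or> c' mod Q = 2)"
  using assms
proof (induction n arbitrary: c)
  case 0
  from 0 have "(1 + c) mod Q = 1 \<or> (1 + c) mod Q = 2"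
    using Q_pos by cases (auto simp: mod_Suc)
  then show ?case by (intro exI[of _ 0] exI[of _ "1 + c"]) simp
next
  case (Suc n)
  from Suc.prems show ?case
  proof cases
    case 1
    then show ?thesis using Q_pos by (intro exI[of _ "Suc n"] exI[of _ 1]) simp
  next
    case (2 e)
    then obtain s c' where "Q ^ n + e = Q ^ s * c'" "c' mod Q = 1 \<or> c' mod Q = 2"
      using Suc.IH by blast
    then show ?thesis using 2
      by (intro exI[of _ "Suc s"] exI[of _ c']) (simp add: algebra_simps flip: distrib_left)
  next
    case (3 e)
    then have "(Q ^ Suc n + c) = 1 + Q * (Q ^ n + e)" by (simp add: algebra_simps)
    moreover have "(1 + Q * (Q ^ n + e)) mod Q = 1" using Q_pos by (simp add: mod_Suc)
    ultimately show ?thesis by (intro exI[of _ 0] exI[of _ "Q ^ Suc n + c"]) simp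
  qed
qed

text \<open>After stripping factors \<open>Q\<close>, both exponents end in the digit
  \<open>1\<close> or \<open>2\<close>. Neither is divisible by \<open>B > 3\<close>, so by
  \<open>artin_schreier_monomials\<close> they must coincide.\<close>

lemma shift_step:
  assumes "artin_schreier (x ^ (Q ^ n + c) - x ^ (Suc (Q * a)))" "digital c"
  shows "\<exists>l. Q ^ n + c = Q ^ l * Suc (Q * a)"
proof -
  obtain s c' where c: "Q ^ n + c = Q ^ s * c'" "c' mod Q = 1 \<or> c' mod Q = 2"
    using digital_plus_power[OF assms(2)] by blast
  have artin_schreier: "artin_schreier (x ^ c' - x ^ Suc (Q * a))"
    by (rule artin_schreier_strip_left[of _ s]) (use assms(1) c in \<open>simp flip: power_mult add: mult.commute\<close>)
  have "c' = Suc (Q * a)"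
  proof (rule ccontr)
    assume n: "c' \<noteq> Suc (Q * a)"
    then have "B dvd max c' (Suc (Q * a))" by (rule B_dvd[OF artin_schreier_monomials[OF artin_schreier]])
    moreover have "\<not> B dvd k" if "k mod Q = 1 \<or> k mod Q = 2" for k
    proof
      assume "B dvd k"
      moreover have "k mod B = (k mod Q) mod B" unfolding Q_def by (simp add: mod_mod_cancel)
      ultimately show False using that B_pos by (auto simp: dvd_eq_mod_eq_0)
    qed
    moreover have "Suc (Q * a) mod Q = 1" using Q_pos by (simp add: mod_Suc)
    ultimately show False using c(2) by (metis max_def)
  qed
  then show ?thesis using c by blast
qed

text \<open>If \<open>c\<close> is the \<open>Q ^ n\<close>-th power of \<open>a\<close>, then
  \<open>J * c ^ e\<close> is that of \<open>x * a ^ e\<close>, so both conditions hold. Conversely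
  each condition, for \<open>e = Q\<close> and \<open>e = Q * Q\<close>, gives an equation of
  exponents up to an unknown power of \<open>Q\<close>, and \<open>shift_equations\<close> combines
  the two. The \<open>Q\<close>-th powers leave the last digit free for the factor \<open>x\<close>,
  so that the exponent of \<open>x * a ^ e\<close> ends in \<open>1\<close>.\<close>

theorem is_shift_iff:
  assumes "finite S" "finite T"
  shows "is_shift J (x ^ code S) (x ^ code T) \<longleftrightarrow> (\<exists>n. J = x ^ code {n} \<and> T = (+) n ` S)"
proof
  let ?a = "code S" and ?c = "code T"
  assume sh: "is_shift J (x ^ ?a) (x ^ ?c)"
  obtain n where n: "J = x ^ (Q ^ n)" using sh pow_Q_iff unfolding is_shift_def by blast
  have dc: "digital ?c" using assms(2) digital_iff_code by blast
  have "\<exists>l. Q ^ n + Q * ?c = Q ^ l * Suc (Q * ?a)"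
    by (rule shift_step) (use sh n dc in \<open>auto simp: is_shift_def digital.intros simp flip: power_mult power_add
      simp: mult.commute\<close>)
  then obtain l where l: "Q ^ n + Q * ?c = Q ^ l * Suc (Q * ?a)" by blast
  have "\<exists>l. Q ^ n + Q * (Q * ?c) = Q ^ l * Suc (Q * (Q * ?a))"
    by (rule shift_step) (use sh n dc in \<open>auto simp: is_shift_def digital.intros simp flip: power_mult power_add
      simp: mult_ac\<close>)
  then obtain k where k: "Q ^ n + Q * (Q * ?c) = Q ^ k * Suc (Q * (Q * ?a))" by blast
  have "?c = Q ^ n * ?a" by (rule shift_equations[OF _ l k]) (use Q_pos in simp)
  then have "code T = code ((+) n ` S)" by (simp add: code_shift)
  then have "T = (+) n ` S" using code_inj[of T "(+) n ` S"] assms by simp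
  then show "\<exists>n. J = x ^ code {n} \<and> T = (+) n ` S" using n by (intro exI[of _ n]) (simp add: code_def)
next
  assume "\<exists>n. J = x ^ code {n} \<and> T = (+) n ` S"
  then obtain n where n: "J = x ^ (Q ^ n)" "T = (+) n ` S" unfolding code_def by auto
  have c: "code T = Q ^ n * code S" unfolding n(2) by (rule code_shift)
  have "J * (x ^ code T) ^ e = (x * (x ^ code S) ^ e) ^ (Q ^ n)" for e
    unfolding n(1) c by (simp add: power_mult_distrib) (simp flip: power_mult add: mult_ac)
  then show "is_shift J (x ^ code S) (x ^ code T)"
    unfolding is_shift_def using artin_schreier_pow pow_Q_iff n(1) by auto
qed

end

subsection \<open>Existential definability\<close>

primrec rename_trm :: "(nat \<Rightarrow> nat) \<Rightarrow> trm \<Rightarrow> trm" where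
  "rename_trm r (Var n) = Var (r n)"
| "rename_trm r TZero = TZero"
| "rename_trm r TOne = TOne"
| "rename_trm r TConst = TConst"
| "rename_trm r (TAdd s t) = TAdd (rename_trm r s) (rename_trm r t)"
| "rename_trm r (TMul s t) = TMul (rename_trm r s) (rename_trm r t)"

primrec rename_fm :: "(nat \<Rightarrow> nat) \<Rightarrow> fm \<Rightarrow> fm" where
  "rename_fm r (FEq s t) = FEq (rename_trm r s) (rename_trm r t)"
| "rename_fm r (FPred t) = FPred (rename_trm r t)"
| "rename_fm r (FNot \<phi>) = FNot (rename_fm r \<phi>)"
| "rename_fm r (FAnd \<phi> \<psi>) = FAnd (rename_fm r \<phi>) (rename_fm r \<psi>)"
| "rename_fm r (FOr \<phi> \<psi>) = FOr (rename_fm r \<phi>) (rename_fm r \<psi>)"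
| "rename_fm r (FEx n \<phi>) = FEx n \<phi>"
| "rename_fm r (FAll n \<phi>) = FAll n \<phi>"

lemma tval_rename: "tval c e (rename_trm r t) = tval c (\<lambda>i. e (r i)) t"
  by (induction t) auto

lemma sat_rename: "quantifier_free \<phi> \<Longrightarrow> sat c P e (rename_fm r \<phi>) = sat c P (\<lambda>i. e (r i)) \<phi>"
  by (induction \<phi>) (auto simp: tval_rename)

lemma quantifier_free_rename: "quantifier_free \<phi> \<Longrightarrow> quantifier_free (rename_fm r \<phi>)"
  by (induction \<phi>) auto

primrec trm_pow :: "trm \<Rightarrow> nat \<Rightarrow> trm" where
  "trm_pow t 0 = TOne"
| "trm_pow t (Suc n) = TMul t (trm_pow t n)"

lemma tval_trm_pow: "tval c e (trm_pow t n) = tval c e t ^ n" for c :: "'b::comm_semiring_1"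
  by (induction n) auto

text \<open>Even-numbered variables are free, odd-numbered ones are bound by the existential quantifiers.\<close>

definition merge :: "(nat \<Rightarrow> 'b) \<Rightarrow> (nat \<Rightarrow> 'b) \<Rightarrow> nat \<Rightarrow> 'b" where
  "merge e e' n = (if even n then e (n div 2) else e' (n div 2))"

context laurent_frobenius
begin

definition "powers = range (\<lambda>n::int. \<alpha> powi n)"

text \<open>The language has neither subtraction nor a constant for \<open>x = 1/\<alpha>\<close>.\<close>

definition rational :: "((nat \<Rightarrow> 'a fls) \<Rightarrow> 'a fls) \<Rightarrow> bool" where
  "rational f \<longleftrightarrow> (\<exists>k s t. \<forall>e. \<alpha> ^ k * f e = tval \<alpha> e s - tval \<alpha> e t)"

lemma rationalI: "(\<And>e. \<alpha> ^ k * f e = tval \<alpha> e s - tval \<alpha> e t) \<Longrightarrow> rational f"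
  unfolding rational_def by blast

lemma rational_var: "rational (\<lambda>e. e i)"
  by (rule rationalI[of 0 _ "Var i" TZero]) simp
lemma rat_0: "rational (\<lambda>e. 0)"
  by (rule rationalI[of 0 _ TZero TZero]) simp
lemma rat_1: "rational (\<lambda>e. 1)"
  by (rule rationalI[of 0 _ TOne TZero]) simp
lemma rational_\<alpha>: "rational (\<lambda>e. \<alpha>)"
  by (rule rationalI[of 0 _ TConst TZero]) simp
lemma rational_x: "rational (\<lambda>e. x)"
  by (rule rationalI[of 1 _ TOne TZero]) (simp add: x_\<alpha>)

lemma rational_add:
  assumes "rational f" "rational g"
  shows "rational (\<lambda>e. f e + g e)"
proof -
  obtain k s t k' s' t' where *: "\<And>e. \<alpha> ^ k * f e = tval \<alpha> e s - tval \<alpha> e t"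
    "\<And>e. \<alpha> ^ k' * g e = tval \<alpha> e s' - tval \<alpha> e t'" using assms unfolding rational_def by blast
  show ?thesis
  proof (rule rationalI[of "k + k'" _ "TAdd (TMul (trm_pow TConst k') s) (TMul (trm_pow TConst k) s')"
      "TAdd (TMul (trm_pow TConst k') t) (TMul (trm_pow TConst k) t')"])
    fix e
    have "\<alpha> ^ (k + k') * (f e + g e) = \<alpha> ^ k' * (\<alpha> ^ k * f e) + \<alpha> ^ k * (\<alpha> ^ k' * g e)"
      by (simp add: power_add algebra_simps)
    then show "\<alpha> ^ (k + k') * (f e + g e) =
        tval \<alpha> e (TAdd (TMul (trm_pow TConst k') s) (TMul (trm_pow TConst k) s')) -
        tval \<alpha> e (TAdd (TMul (trm_pow TConst k') t) (TMul (trm_pow TConst k) t'))"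
      unfolding * by (simp add: tval_trm_pow algebra_simps)
  qed
qed

lemma rational_minus: "rational f \<Longrightarrow> rational (\<lambda>e. - f e)"
proof -
  assume "rational f"
  then obtain k s t where *: "\<And>e. \<alpha> ^ k * f e = tval \<alpha> e s - tval \<alpha> e t" unfolding rational_def by blast
  show ?thesis by (rule rationalI[of k _ t s]) (simp add: *)
qed

lemma rational_diff: "rational f \<Longrightarrow> rational g \<Longrightarrow> rational (\<lambda>e. f e - g e)"
  using rational_add[OF _ rational_minus, of f g] by simp

lemma rational_mult:
  assumes "rational f" "rational g"
  shows "rational (\<lambda>e. f e * g e)"
proof -
  obtain k s t k' s' t' where *: "\<And>e. \<alpha> ^ k * f e = tval \<alpha> e s - tval \<alpha> e t"
    "\<And>e. \<alpha> ^ k' * g e = tval \<alpha> e s' - tval \<alpha> e t'" using assms unfolding rational_def by blast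
  show ?thesis
  proof (rule rationalI[of "k + k'" _ "TAdd (TMul s s') (TMul t t')" "TAdd (TMul s t') (TMul t s')"])
    fix e
    have "\<alpha> ^ (k + k') * (f e * g e) = (\<alpha> ^ k * f e) * (\<alpha> ^ k' * g e)"
      by (simp add: power_add algebra_simps)
    then show "\<alpha> ^ (k + k') * (f e * g e) =
        tval \<alpha> e (TAdd (TMul s s') (TMul t t')) - tval \<alpha> e (TAdd (TMul s t') (TMul t s'))"
      unfolding * by (simp add: algebra_simps)
  qed
qed

lemma rational_power: "rational f \<Longrightarrow> rational (\<lambda>e. f e ^ n)"
  by (induction n) (simp_all add: rat_1 rational_mult)

lemma rational_rename: "rational f \<Longrightarrow> rational (\<lambda>e. f (\<lambda>i. e (r i)))"
proof -
  assume "rational f"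
  then obtain k s t where *: "\<And>e. \<alpha> ^ k * f e = tval \<alpha> e s - tval \<alpha> e t" unfolding rational_def by blast
  show ?thesis by (rule rationalI[of k _ "rename_trm r s" "rename_trm r t"]) (simp add: * tval_rename)
qed

lemmas rational_intros = rational_var rat_0 rat_1 rational_\<alpha> rational_x rational_add rational_diff rational_mult rational_power

text \<open>All odd-numbered variables are quantified at once through \<open>e'\<close>. Closure
  properties then only rename variables and need not count quantifiers.\<close>

definition field_definable :: "((nat \<Rightarrow> 'a fls) \<Rightarrow> bool) \<Rightarrow> bool" where
  "field_definable P \<longleftrightarrow> (\<exists>\<phi>. quantifier_free \<phi> \<and> (\<forall>e. P e \<longleftrightarrow> (\<exists>e'. sat \<alpha> powers (merge e e') \<phi>)))"

lemma field_definable_sat: "quantifier_free \<phi> \<Longrightarrow> (\<And>e. P e = sat \<alpha> powers e \<phi>) \<Longrightarrow> field_definable P"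
  unfolding field_definable_def
  by (rule exI[of _ "rename_fm (\<lambda>n. 2 * n) \<phi>"])
    (simp add: quantifier_free_rename sat_rename merge_def)

lemma field_definable_rename:
  assumes "field_definable P"
  shows "field_definable (\<lambda>e. P (\<lambda>i. e (r i)))"
proof -
  obtain \<phi> where \<phi>: "quantifier_free \<phi>" "\<And>e. P e \<longleftrightarrow> (\<exists>e'. sat \<alpha> powers (merge e e') \<phi>)"
    using assms unfolding field_definable_def by blast
  let ?r = "\<lambda>n. if even n then 2 * r (n div 2) else n"
  have "(\<lambda>i. merge e e' (?r i)) = merge (\<lambda>i. e (r i)) e'" for e e' :: "nat \<Rightarrow> 'a fls"
    by (auto simp: merge_def)
  then show ?thesis unfolding field_definable_def
    by (intro exI[of _ "rename_fm ?r \<phi>"]) (simp add: quantifier_free_rename sat_rename \<phi>)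
qed

lemma field_definable_conj:
  assumes "field_definable P" "field_definable R"
  shows "field_definable (\<lambda>e. P e \<and> R e)"
proof -
  obtain \<phi> \<psi> where \<phi>: "quantifier_free \<phi>" "\<And>e. P e \<longleftrightarrow> (\<exists>e'. sat \<alpha> powers (merge e e') \<phi>)"
    and \<psi>: "quantifier_free \<psi>" "\<And>e. R e \<longleftrightarrow> (\<exists>e'. sat \<alpha> powers (merge e e') \<psi>)"
    using assms unfolding field_definable_def by blast
  \<comment> \<open>The bound variables of the two formulas are kept apart: the one with index
    \<open>i\<close> becomes \<open>2 * i\<close> for \<open>\<phi>\<close> and
    \<open>2 * i + 1\<close> for \<open>\<psi>\<close>.\<close>
  let ?r = "\<lambda>n. if even n then n else 2 * (2 * (n div 2)) + 1"
  let ?s = "\<lambda>n. if even n then n else 2 * (2 * (n div 2) + 1) + 1"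
  have r: "(\<lambda>i. merge e e' (?r i)) = merge e (\<lambda>i. e' (2 * i))"
    and s: "(\<lambda>i. merge e e' (?s i)) = merge e (\<lambda>i. e' (2 * i + 1))" for e e' :: "nat \<Rightarrow> 'a fls"
    by (auto simp: merge_def)
  show ?thesis
    unfolding field_definable_def
  proof (intro exI[of _ "FAnd (rename_fm ?r \<phi>) (rename_fm ?s \<psi>)"] conjI allI)
    fix e
    show "(P e \<and> R e) \<longleftrightarrow> (\<exists>e'. sat \<alpha> powers (merge e e') (FAnd (rename_fm ?r \<phi>) (rename_fm ?s \<psi>)))"
      (is "?L \<longleftrightarrow> ?R")
    proof
      assume ?L
      then obtain e1 e2 where "sat \<alpha> powers (merge e e1) \<phi>" "sat \<alpha> powers (merge e e2) \<psi>" using \<phi> \<psi> by blast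
      then show ?R
        by (intro exI[of _ "merge e1 e2"]) (simp add: sat_rename \<phi>(1) \<psi>(1) r s, simp add: merge_def)
    qed (auto simp: sat_rename \<phi> \<psi> r s)
  qed (simp add: quantifier_free_rename \<phi> \<psi>)
qed

lemma field_definable_ex:
  assumes "field_definable (\<lambda>e. P (\<lambda>i. e (Suc i)) (e 0))"
  shows "field_definable (\<lambda>e. \<exists>y. P e y)"
proof -
  obtain \<phi> where \<phi>: "quantifier_free \<phi>"
    "\<And>e. P (\<lambda>i. e (Suc i)) (e 0) \<longleftrightarrow> (\<exists>e'. sat \<alpha> powers (merge e e') \<phi>)"
    using assms unfolding field_definable_def by blast
  have P: "P e y \<longleftrightarrow> (\<exists>e'. sat \<alpha> powers (merge (case_nat y e) e') \<phi>)" for e y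
    using \<phi>(2)[of "case_nat y e"] by simp
  \<comment> \<open>Free variable \<open>0\<close> becomes bound variable \<open>0\<close>; the
    other free indices move down by one and the bound ones move up by one.\<close>
  let ?r = "\<lambda>n. if n = 0 then 1 else if even n then n - 2 else n + 2"
  have r: "(\<lambda>i. merge e e' (?r i)) = merge (case_nat (e' 0) e) (\<lambda>i. e' (Suc i))"
    for e e' :: "nat \<Rightarrow> 'a fls"
  proof
    fix i
    show "merge e e' (?r i) = merge (case_nat (e' 0) e) (\<lambda>i. e' (Suc i)) i"
    proof (cases "even i \<and> i \<noteq> 0")
      case True
      then obtain k where "i = 2 * Suc k" by (metis evenE mult_0_right not0_implies_Suc)
      then show ?thesis by (simp add: merge_def)
    qed (auto simp: merge_def)
  qed
  show ?thesis
    unfolding field_definable_def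
  proof (intro exI[of _ "rename_fm ?r \<phi>"] conjI allI)
    fix e
    show "(\<exists>y. P e y) \<longleftrightarrow> (\<exists>e'. sat \<alpha> powers (merge e e') (rename_fm ?r \<phi>))" (is "?L \<longleftrightarrow> ?R")
    proof
      assume ?L
      then obtain y e' where "sat \<alpha> powers (merge (case_nat y e) e') \<phi>" using P by blast
      then show ?R
        unfolding sat_rename[OF \<phi>(1)] r by (intro exI[of _ "case_nat y e'"]) simp
    qed (auto simp: sat_rename[OF \<phi>(1)] r P)
  qed (simp add: quantifier_free_rename \<phi>)
qed

lemma field_definable_cong: "field_definable P \<Longrightarrow> (\<And>e. P e = R e) \<Longrightarrow> field_definable R"
  by (simp add: field_definable_def)

lemma field_definable_eq:
  assumes "rational f" "rational g"
  shows "field_definable (\<lambda>e. f e = g e)"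
proof -
  obtain k s t where *: "\<And>e. \<alpha> ^ k * (f e - g e) = tval \<alpha> e s - tval \<alpha> e t"
    using rational_diff[OF assms] unfolding rational_def by blast
  have "f e = g e \<longleftrightarrow> \<alpha> ^ k * (f e - g e) = 0" for e using \<alpha>_nz by simp
  then show ?thesis by (intro field_definable_sat[of "FEq s t"]) (simp_all add: *)
qed

text \<open>The predicate applies to terms, but a rational \<open>f\<close> is a difference of terms
  only after multiplication by a power of \<open>\<alpha>\<close>. So its value is named by a
  variable first.\<close>

lemma field_definable_member:
  assumes "rational f"
  shows "field_definable (\<lambda>e. f e \<in> powers)"
proof -
  have "field_definable (\<lambda>e. \<exists>y. y = f e \<and> y \<in> powers)"
    by (intro field_definable_ex field_definable_conj field_definable_eq rational_var rational_rename[OF assms] field_definable_sat[of "FPred (Var 0)" "\<lambda>e. e 0 \<in> powers"]) auto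
  then show ?thesis by (rule field_definable_cong) auto
qed

lemma field_definable_nonzero:
  assumes "rational f"
  shows "field_definable (\<lambda>e. f e \<noteq> 0)"
proof -
  have "field_definable (\<lambda>e. \<exists>y. y * f e = 1)"
    by (intro field_definable_ex field_definable_eq rational_intros rational_rename[OF assms])
  then show ?thesis
    by (rule field_definable_cong) (metis left_inverse mult_zero_right zero_neq_one)
qed

lemma kd_W:
  assumes "rational f"
  shows "field_definable (\<lambda>e. artin_schreier (f e))"
  unfolding artin_schreier_def by (intro field_definable_ex field_definable_eq rational_intros rational_rename[OF assms])

lemma kd_E:
  assumes "rational f"
  shows "field_definable (\<lambda>e. absorbed u (f e))"
  unfolding absorbed_def by (intro field_definable_ex field_definable_eq rational_intros rational_rename[OF assms])

lemma field_definable_pow_Q: "rational f \<Longrightarrow> field_definable (\<lambda>e. pow_Q (f e))"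
  unfolding pow_Q_def powers_def[symmetric]
  by (intro field_definable_conj field_definable_member kd_W rational_intros)

lemma field_definable_test:
  assumes "rational f" "rational g"
  shows "field_definable (\<lambda>e. test u (f e) (g e))"
  unfolding test_def
  by (intro field_definable_ex field_definable_conj field_definable_nonzero field_definable_eq kd_E rational_intros rational_rename[OF assms(1)] rational_rename[OF assms(2)])

lemma field_definable_is_code:
  assumes "rational f"
  shows "field_definable (\<lambda>e. is_code (f e))"
  unfolding is_code_def powers_def[symmetric]
  by (intro field_definable_ex field_definable_conj field_definable_member field_definable_eq field_definable_pow_Q field_definable_test rational_intros rational_rename[OF assms] assms)

lemma field_definable_is_shift:
  assumes "rational f" "rational g" "rational h"
  shows "field_definable (\<lambda>e. is_shift (f e) (g e) (h e))"
  unfolding is_shift_def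
  by (intro field_definable_conj field_definable_pow_Q kd_W rational_intros assms)

section \<open>The dictionary between finite sets and field elements\<close>

definition enc :: "nat set \<Rightarrow> 'a fls" where "enc S = x ^ code S"

definition set_definable :: "((nat \<Rightarrow> nat set) \<Rightarrow> bool) \<Rightarrow> bool" where
  "set_definable R \<longleftrightarrow> (\<exists>P. field_definable P \<and> (\<forall>e. (\<forall>i. finite (e i)) \<longrightarrow> (R e \<longleftrightarrow> P (\<lambda>i. enc (e i)))))"

lemma set_definableI: "field_definable P \<Longrightarrow> (\<And>e. (\<And>i. finite (e i)) \<Longrightarrow> R e \<longleftrightarrow> P (\<lambda>i. enc (e i))) \<Longrightarrow> set_definable R"
  unfolding set_definable_def by blast

lemma x_pow_inj: "x ^ m = x ^ n \<longleftrightarrow> m = n"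
proof
  assume "x ^ m = x ^ n"
  then have "- (int d * int m) = - (int d * int n)" using vx by metis
  then show "m = n" using d_pos by auto
qed simp

text \<open>A quantifier over finite sets becomes a field quantifier relativized to
  \<open>is_code\<close>; this is the reason why codes must be recognized existentially.
  \<open>Suc\<close> on sets is the \<open>Q\<close>-th power.\<close>

sublocale sets: set_definability set_definable
proof
  fix R S :: "(nat \<Rightarrow> nat set) \<Rightarrow> bool" assume "set_definable R" "set_definable S"
  then obtain P P' where "field_definable P" "\<And>e. (\<And>i. finite (e i)) \<Longrightarrow> R e \<longleftrightarrow> P (\<lambda>i. enc (e i))"
    "field_definable P'" "\<And>e. (\<And>i. finite (e i)) \<Longrightarrow> S e \<longleftrightarrow> P' (\<lambda>i. enc (e i))" unfolding set_definable_def by blast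
  then show "set_definable (\<lambda>e. R e \<and> S e)" by (intro set_definableI[OF field_definable_conj[of P P']]) auto
next
  fix R S :: "(nat \<Rightarrow> nat set) \<Rightarrow> bool" assume "set_definable R" "\<And>e. (\<And>i. finite (e i)) \<Longrightarrow> R e = S e"
  then show "set_definable S" by (simp add: set_definable_def)
next
  show "set_definable (\<lambda>_. True)" by (rule set_definableI[OF field_definable_eq[OF rat_0 rat_0]]) simp
next
  fix R :: "(nat \<Rightarrow> nat set) \<Rightarrow> nat set \<Rightarrow> bool" assume "set_definable (\<lambda>e. R (\<lambda>i. e (Suc i)) (e 0))"
  then obtain P where P: "field_definable P"
    "\<And>e. (\<And>i. finite (e i)) \<Longrightarrow> R (\<lambda>i. e (Suc i)) (e 0) \<longleftrightarrow> P (\<lambda>i. enc (e i))"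
    unfolding set_definable_def by blast
  have RP: "R e S \<longleftrightarrow> P (case_nat (enc S) (\<lambda>i. enc (e i)))" if "\<And>i. finite (e i)" "finite S" for e S
  proof -
    have "(\<lambda>i. enc (case_nat S e i)) = case_nat (enc S) (\<lambda>i. enc (e i))"
      by (auto split: nat.splits)
    then show ?thesis using P(2)[of "case_nat S e"] that by (auto split: nat.splits)
  qed
  have "case_nat (e 0) (\<lambda>i. e (Suc i)) = e" for e :: "nat \<Rightarrow> 'a fls"
    by (auto split: nat.splits)
  then have "field_definable (\<lambda>e. \<exists>y. is_code y \<and> P (case_nat y e))"
    by (intro field_definable_ex field_definable_conj field_definable_is_code rational_var) (simp add: P(1))
  then show "set_definable (\<lambda>e. \<exists>S. finite S \<and> R e S)"
    by (rule set_definableI) (auto simp: is_code_iff RP enc_def)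
next
  fix i j k
  have "field_definable (\<lambda>e. e i = e j * e k)" by (intro field_definable_eq rational_intros)
  then show "set_definable (\<lambda>e. e i = e j \<union> e k \<and> e j \<inter> e k = {})"
    by (rule set_definableI) (simp add: enc_def x_pow_inj code_Un_iff flip: power_add)
next
  fix i j
  have "field_definable (\<lambda>e. e i = e j ^ Q)" by (intro field_definable_eq rational_intros)
  then show "set_definable (\<lambda>e. e i = Suc ` e j)"
    by (rule set_definableI) (simp add: enc_def x_pow_inj mult.commute code_inj flip: power_mult code_Suc)
next
  fix i j k
  have "field_definable (\<lambda>e. is_shift (e i) (e j) (e k))" by (intro field_definable_is_shift rational_intros)
  then show "set_definable (\<lambda>e. \<exists>w. e i = {w} \<and> e k = (+) w ` e j)"
    by (rule set_definableI) (simp add: enc_def is_shift_iff x_pow_inj code_inj)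
next
  fix i
  have "field_definable (\<lambda>e. e i = x)" by (intro field_definable_eq rational_intros)
  moreover have "x = x ^ code {0}" unfolding code_def by simp
  ultimately show "set_definable (\<lambda>e. e i = {0})"
    by (intro set_definableI[of "\<lambda>e. e i = x"]) (metis (no_types) enc_def x_pow_inj code_inj finite.emptyI finite.insertI)+
qed

end

subsection \<open>Diagonalization\<close>

definition computable :: "nat \<Rightarrow> (nat list \<Rightarrow> nat) \<Rightarrow> bool" where
  "computable k F \<longleftrightarrow> (\<exists>f. \<forall>xs. length xs = k \<longrightarrow> rec_eval f xs (F xs))"

lemma computable_nth: "i < k \<Longrightarrow> computable k (\<lambda>xs. xs ! i)"
  unfolding computable_def by (intro exI[of _ "RProj i"]) (simp add: rec_eval.proj)

lemma computable_hd: "0 < k \<Longrightarrow> computable k hd"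
  unfolding computable_def
  by (intro exI[of _ "RProj 0"] allI impI) (metis hd_conv_nth length_greater_0_conv rec_eval.proj)

lemma computable_comp1:
  assumes "computable 1 F" "computable k G"
  shows "computable k (\<lambda>xs. F [G xs])"
proof -
  obtain f g where "\<And>xs. length xs = 1 \<Longrightarrow> rec_eval f xs (F xs)"
    "\<And>xs. length xs = k \<Longrightarrow> rec_eval g xs (G xs)" using assms unfolding computable_def by blast
  then show ?thesis unfolding computable_def
    by (intro exI[of _ "RComp f [g]"]) (auto intro!: rec_eval.comp[of _ _ "[G _]"])
qed

lemma computable_comp2:
  assumes "computable 2 F" "computable k G" "computable k H"
  shows "computable k (\<lambda>xs. F [G xs, H xs])"
proof -
  obtain f g h where "\<And>xs. length xs = 2 \<Longrightarrow> rec_eval f xs (F xs)"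
    "\<And>xs. length xs = k \<Longrightarrow> rec_eval g xs (G xs)" "\<And>xs. length xs = k \<Longrightarrow> rec_eval h xs (H xs)"
    using assms unfolding computable_def by blast
  then show ?thesis unfolding computable_def
    by (intro exI[of _ "RComp f [g, h]"]) (auto intro!: rec_eval.comp[of _ _ "[G _, H _]"])
qed

lemma computable_prec:
  assumes "computable k F" "computable (Suc (Suc k)) G"
    and "\<And>xs. H (0 # xs) = F xs" "\<And>n xs. H (Suc n # xs) = G (n # H (n # xs) # xs)"
  shows "computable (Suc k) H"
proof -
  obtain f g where f: "\<And>xs. length xs = k \<Longrightarrow> rec_eval f xs (F xs)"
    and g: "\<And>xs. length xs = Suc (Suc k) \<Longrightarrow> rec_eval g xs (G xs)"
    using assms unfolding computable_def by blast
  have "rec_eval (RPrec f g) (n # xs) (H (n # xs))" if "length xs = k" for n xs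
  proof (induction n)
    case 0
    then show ?case using f that assms(3) by (auto intro: rec_eval.prec_0)
  next
    case (Suc n)
    then show ?case using g[of "n # H (n # xs) # xs"] that assms(4) by (auto intro: rec_eval.prec_Suc)
  qed
  then show ?thesis unfolding computable_def
    by (intro exI[of _ "RPrec f g"]) (auto simp: length_Suc_conv)
qed

lemma computable_Suc: "computable k F \<Longrightarrow> computable k (\<lambda>xs. Suc (F xs))"
proof -
  have "computable 1 (\<lambda>xs. Suc (hd xs))"
    unfolding computable_def
    by (intro exI[of _ RSucc]) (auto simp: length_Suc_conv intro: rec_eval.succ)
  then show "computable k F \<Longrightarrow> computable k (\<lambda>xs. Suc (F xs))"
    using computable_comp1[of "\<lambda>xs. Suc (hd xs)" k F] by simp
qed

lemma computable_const: "computable k (\<lambda>_. c)"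
proof (induction c)
  case 0
  show ?case unfolding computable_def by (intro exI[of _ RZero]) (simp add: rec_eval.zero)
qed (rule computable_Suc)

lemma computable_add: "computable k F \<Longrightarrow> computable k G \<Longrightarrow> computable k (\<lambda>xs. F xs + G xs)"
proof -
  have "computable (Suc 1) (\<lambda>xs. hd xs + hd (tl xs))"
  proof (rule computable_prec)
    show "computable 1 hd" by (rule computable_hd) simp
    show "computable (Suc (Suc 1)) (\<lambda>xs. Suc (xs ! 1))"
      by (intro computable_Suc computable_nth) simp
  qed simp_all
  then have "computable 2 (\<lambda>xs. hd xs + hd (tl xs))" by (simp add: numeral_2_eq_2)
  then show "computable k F \<Longrightarrow> computable k G \<Longrightarrow> computable k (\<lambda>xs. F xs + G xs)"
    using computable_comp2[of "\<lambda>xs. hd xs + hd (tl xs)" k F G] by simp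
qed

lemma computable_pair:
  assumes "computable k F" "computable k G"
  shows "computable k (\<lambda>xs. prod_encode (F xs, G xs))"
proof -
  have "computable (Suc 0) (\<lambda>xs. triangle (hd xs))"
  proof (rule computable_prec)
    show "computable 0 (\<lambda>_. 0)" by (rule computable_const)
    show "computable (Suc (Suc 0)) (\<lambda>xs. xs ! 1 + Suc (xs ! 0))"
      by (intro computable_add computable_Suc computable_nth) simp_all
  qed simp_all
  then have "computable k (\<lambda>xs. triangle (hd [F xs + G xs]))"
    by (intro computable_comp1[of "\<lambda>xs. triangle (hd xs)"] computable_add assms) simp
  then show ?thesis unfolding prod_encode_def using computable_add assms(1) by simp
qed

text \<open>Binding every index below \<open>j\<close> makes the code of the closed formula a
  primitive recursion in \<open>j\<close>, whichever variables occur.\<close>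

primrec wrap :: "nat \<Rightarrow> fm \<Rightarrow> fm" where
  "wrap 0 \<phi> = \<phi>"
| "wrap (Suc j) \<phi> = FEx j (wrap j \<phi>)"

lemma wrap_eq_foldr: "wrap j \<phi> = foldr FEx (rev [0..<j]) \<phi>"
  by (induction j) auto

lemma free_vars_wrap: "free_vars (wrap j \<phi>) = free_vars \<phi> - {..<j}"
  by (induction j) (simp_all add: lessThan_Suc Diff_insert[symmetric])

lemma sat_wrap: "sat c P e (wrap j \<phi>) \<longleftrightarrow> (\<exists>e'. (\<forall>i\<ge>j. e' i = e i) \<and> sat c P e' \<phi>)"
proof (induction j arbitrary: e)
  case 0
  have "(\<forall>i\<ge>0. e' i = e i) \<longleftrightarrow> e' = e" for e' by auto
  then show ?case by simp
next
  case (Suc j)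
  have eq: "(\<exists>y. \<forall>i\<ge>j. e' i = (e(j := y)) i) \<longleftrightarrow> (\<forall>i\<ge>Suc j. e' i = e i)" for e'
  proof
    assume "\<forall>i\<ge>Suc j. e' i = e i"
    then show "\<exists>y. \<forall>i\<ge>j. e' i = (e(j := y)) i"
      by (intro exI[of _ "e' j"]) (auto simp: Suc_le_eq)
  qed auto
  have "sat c P e (wrap (Suc j) \<phi>) \<longleftrightarrow>
      (\<exists>e'. (\<exists>y. \<forall>i\<ge>j. e' i = (e(j := y)) i) \<and> sat c P e' \<phi>)"
    unfolding wrap.simps sat.simps Suc.IH by blast
  then show ?case unfolding eq .
qed

lemma tvars_le_code: "n \<in> tvars t \<Longrightarrow> n \<le> trm_code t"
proof (induction t)
  case (TAdd s t)
  then show ?case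
    using le_prod_encode_2[of "prod_encode (trm_code s, trm_code t)" 4]
      le_prod_encode_1[of "trm_code s" "trm_code t"] le_prod_encode_2[of "trm_code t" "trm_code s"]
    by fastforce
next
  case (TMul s t)
  then show ?case
    using le_prod_encode_2[of "prod_encode (trm_code s, trm_code t)" 5]
      le_prod_encode_1[of "trm_code s" "trm_code t"] le_prod_encode_2[of "trm_code t" "trm_code s"]
    by fastforce
qed (auto simp: le_prod_encode_2)

lemma free_vars_le_code: "n \<in> free_vars \<phi> \<Longrightarrow> n \<le> fm_code \<phi>"
proof (induction \<phi>)
  case (FEq s t)
  then have "n \<le> trm_code s \<or> n \<le> trm_code t" using tvars_le_code by auto
  then show ?case by (auto intro: le_trans[OF _ le_prod_encode_2] le_trans[OF _ le_prod_encode_1])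
next
  case (FPred t)
  then show ?case using tvars_le_code by (auto intro: le_trans[OF _ le_prod_encode_2])
qed (auto intro: le_trans[OF _ le_prod_encode_2] le_trans[OF _ le_prod_encode_1]
    le_trans[OF le_trans[OF _ le_prod_encode_1] le_prod_encode_2]
    le_trans[OF le_trans[OF _ le_prod_encode_2] le_prod_encode_2])

context laurent_frobenius
begin

text \<open>A closed term for the inverse of \<open>enc {..<n}\<close>; the inverse, because
  \<open>\<alpha>\<close> and not \<open>x\<close> is a constant of the language. The recursion
  prepends the digit \<open>1\<close> at the lowest position.\<close>

primrec numeral_trm :: "nat \<Rightarrow> trm" where
  "numeral_trm 0 = TOne"
| "numeral_trm (Suc n) = TMul TConst (trm_pow (numeral_trm n) Q)"

lemma tvars_trm_pow: "tvars (trm_pow t n) \<subseteq> tvars t"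
  by (induction n) auto

lemma tvars_numeral_trm: "tvars (numeral_trm n) = {}"
  by (induction n) (use tvars_trm_pow in fastforce)+

lemma tval_numeral_trm: "tval \<alpha> e (numeral_trm n) = \<alpha> ^ code {..<n}"
proof (induction n)
  case (Suc n)
  have *: "{i. Suc i \<in> {..<Suc n}} = {..<n}" by auto
  have "code {..<Suc n} = Suc (Q * code {..<n})" using code_split[of "{..<Suc n}"] unfolding * by simp
  then show ?case by (simp add: tval_trm_pow Suc mult.commute flip: power_mult)
qed simp

text \<open>Used with \<open>n = fm_code \<phi>\<close>, which is also a bound for the variables of \<open>\<phi>\<close>.\<close>

definition diag :: "nat \<Rightarrow> fm \<Rightarrow> fm" where
  "diag n \<phi> = wrap (Suc n) (FAnd (FEq (Var 0) (numeral_trm n)) \<phi>)"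

definition wrap_code :: "nat \<Rightarrow> nat \<Rightarrow> nat" where
  "wrap_code j c = rec_nat c (\<lambda>j r. prod_encode (5, prod_encode (j, r))) j"

lemma fm_code_wrap: "fm_code (wrap j \<phi>) = wrap_code j (fm_code \<phi>)"
  by (induction j) (simp_all add: wrap_code_def)

lemma computable_trm_pow:
  "\<exists>G. computable (Suc 0) (\<lambda>xs. G (hd xs)) \<and> (\<forall>t. trm_code (trm_pow t n) = G (trm_code t))"
proof (induction n)
  case 0
  show ?case by (rule exI[of _ "\<lambda>_. trm_code TOne"]) (simp add: computable_const)
next
  case (Suc n)
  then obtain G where G: "computable (Suc 0) (\<lambda>xs. G (hd xs))" "\<And>t. trm_code (trm_pow t n) = G (trm_code t)"
    by blast
  have "computable (Suc 0) (\<lambda>xs. prod_encode (5, prod_encode (hd xs, G (hd xs))))"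
    by (intro computable_pair computable_const computable_hd G(1)) simp
  then show ?case using G(2)
    by (intro exI[of _ "\<lambda>c. prod_encode (5, prod_encode (c, G c))"]) simp
qed

text \<open>The matrix \<open>\<phi>\<close> enters the code of the diagonal sentence only through
  its own code, which is the input \<open>n\<close>. The code of the numeral and the quantifier
  prefix are primitive recursive in \<open>n\<close>.\<close>

lemma computable_diag:
  obtains g where "\<And>n \<phi>. n = fm_code \<phi> \<Longrightarrow> rec_eval g [n] (fm_code (diag n \<phi>))"
proof -
  obtain G where G: "computable (Suc 0) (\<lambda>xs. G (hd xs))"
    "\<And>t. trm_code (trm_pow t Q) = G (trm_code t)"
    using computable_trm_pow by blast
  define N where "N n = trm_code (numeral_trm n)" for n
  have N: "computable (Suc 0) (\<lambda>xs. N (hd xs))"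
  proof (rule computable_prec)
    show "computable 0 (\<lambda>_. trm_code TOne)" by (rule computable_const)
    have "computable (Suc (Suc 0)) (\<lambda>xs. G (hd [xs ! 1]))"
      by (rule computable_comp1[of "\<lambda>xs. G (hd xs)"]) (use G in \<open>auto intro: computable_nth\<close>)
    then show "computable (Suc (Suc 0)) (\<lambda>xs. prod_encode (5, prod_encode (trm_code TConst, G (xs ! 1))))"
      by (intro computable_pair computable_const) simp
  qed (simp_all add: N_def G(2))
  have wrap: "computable (Suc (Suc 0)) (\<lambda>xs. wrap_code (hd xs) (hd (tl xs)))"
  proof (rule computable_prec)
    show "computable (Suc 0) hd" by (rule computable_hd) simp
    show "computable (Suc (Suc (Suc 0))) (\<lambda>xs. prod_encode (5, prod_encode (xs ! 0, xs ! 1)))"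
      by (intro computable_pair computable_const computable_nth) simp_all
  qed (simp_all add: wrap_code_def)
  define s where "s n = wrap_code (Suc n)
    (prod_encode (3, prod_encode (prod_encode (0, prod_encode (trm_code (Var 0), N n)), n)))" for n
  have hd: "computable (Suc 0) hd" by (rule computable_hd) simp
  have "computable (Suc 0) (\<lambda>xs. s (hd xs))"
    unfolding s_def
    using computable_comp2[of "\<lambda>xs. wrap_code (hd xs) (hd (tl xs))", OF _ computable_Suc[OF hd]
        computable_pair[OF computable_const computable_pair[OF computable_pair[OF computable_const
          computable_pair[OF computable_const N]] hd]]] wrap
    by (simp add: numeral_2_eq_2)
  then obtain g where "\<And>xs. length xs = Suc 0 \<Longrightarrow> rec_eval g xs (s (hd xs))"
    unfolding computable_def by blast
  then have "rec_eval g [n] (s n)" for n by (metis length_Cons list.sel(1) list.size(3))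
  moreover have "s n = fm_code (diag n \<phi>)" if "n = fm_code \<phi>" for n \<phi>
    unfolding s_def diag_def fm_code_wrap N_def using that by simp
  ultimately show ?thesis using that by metis
qed

lemma diag_existential:
  assumes "quantifier_free \<phi>"
  shows "existential_sentence (diag (fm_code \<phi>) \<phi>)"
  unfolding existential_sentence_def
proof
  have "i \<le> fm_code \<phi>" if "i \<in> free_vars \<phi>" for i using free_vars_le_code that by blast
  then have "free_vars \<phi> \<subseteq> {..<Suc (fm_code \<phi>)}" by (auto simp: less_Suc_eq_le)
  then show "free_vars (diag (fm_code \<phi>) \<phi>) = {}"
    unfolding diag_def free_vars_wrap by (auto simp: tvars_numeral_trm)
  show "\<exists>ns \<psi>. quantifier_free \<psi> \<and> diag (fm_code \<phi>) \<phi> = foldr FEx ns \<psi>"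
    unfolding diag_def wrap_eq_foldr using assms
    by (metis quantifier_free.simps(1,4))
qed

text \<open>All variables of the matrix are at most \<open>fm_code \<phi>\<close>, so the prefix
  binds them all and the truth of the sentence is satisfiability of the matrix.\<close>

lemma diag_true:
  assumes "quantifier_free \<phi>"
  shows "(\<forall>e. sat \<alpha> powers e (diag (fm_code \<phi>) \<phi>)) \<longleftrightarrow>
    (\<exists>e. e 0 = \<alpha> ^ code {..<fm_code \<phi>} \<and> sat \<alpha> powers e \<phi>)"
proof -
  let ?n = "fm_code \<phi>"
  let ?\<psi> = "FAnd (FEq (Var 0) (numeral_trm ?n)) \<phi>"
  have "sat \<alpha> powers e' ?\<psi> \<longleftrightarrow> sat \<alpha> powers (\<lambda>i. if i < Suc ?n then e' i else e i) ?\<psi>" for e e'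
  proof (rule sat_cong)
    fix i assume "i \<in> free_vars ?\<psi>"
    then have "i \<le> ?n" using free_vars_le_code by (auto simp: tvars_numeral_trm)
    then show "e' i = (if i < Suc ?n then e' i else e i)" by simp
  qed
  note eq = this
  have "sat \<alpha> powers e (diag ?n \<phi>) \<longleftrightarrow> (\<exists>e'. sat \<alpha> powers e' ?\<psi>)" for e
  proof
    assume "\<exists>e'. sat \<alpha> powers e' ?\<psi>"
    then obtain e' where "sat \<alpha> powers (\<lambda>i. if i < Suc ?n then e' i else e i) ?\<psi>" using eq by blast
    then show "sat \<alpha> powers e (diag ?n \<phi>)"
      unfolding diag_def sat_wrap
      by (intro exI[of _ "\<lambda>i. if i < Suc ?n then e' i else e i"] conjI) auto
  qed (auto simp: diag_def sat_wrap)
  then show ?thesis by (simp add: tval_numeral_trm)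
qed

text \<open>The constructed \<open>\<sigma>\<close> is true exactly if \<open>f\<close> returns
  \<open>0\<close> on its code, whereas a correct \<open>f\<close> returns \<open>0\<close> exactly
  if \<open>\<sigma>\<close> is false.\<close>

theorem undecidable:
  "\<not> decidable_within (fm_code ` {\<sigma>. existential_sentence \<sigma>}) (fm_code ` Th_ex \<alpha> powers)"
proof
  assume "decidable_within (fm_code ` {\<sigma>. existential_sentence \<sigma>}) (fm_code ` Th_ex \<alpha> powers)"
  then obtain f where f: "\<And>\<sigma>. existential_sentence \<sigma> \<Longrightarrow>
      rec_eval f [fm_code \<sigma>] (if fm_code \<sigma> \<in> fm_code ` Th_ex \<alpha> powers then 1 else 0)"
    unfolding decidable_within_def by blast
  obtain g where g: "\<And>n \<phi>. n = fm_code \<phi> \<Longrightarrow> rec_eval g [n] (fm_code (diag n \<phi>))"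
    by (rule computable_diag) blast
  obtain R where R: "set_definable R" "\<And>e n. (\<And>i. finite (e i)) \<Longrightarrow> e 0 = {..<n} \<Longrightarrow>
      R e \<longleftrightarrow> rec_eval (RComp f [g]) [n] 0"
    by (rule sets.set_definable_rec_eval) blast
  obtain P where P: "field_definable P" "\<And>e. (\<And>i. finite (e i)) \<Longrightarrow> R e \<longleftrightarrow> P (\<lambda>i. enc (e i))"
    using R(1) unfolding set_definable_def by blast
  have PR: "P (\<lambda>_. enc {..<n}) \<longleftrightarrow> rec_eval (RComp f [g]) [n] 0" for n
    using P(2)[of "\<lambda>_. {..<n}"] R(2)[of "\<lambda>_. {..<n}"] by simp
  \<comment> \<open>The numeral supplies the inverse of the code of \<open>{..<n}\<close>, so the
    code itself is recovered as \<open>y\<close>. The constant assignment is enough because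
    \<open>R\<close> depends on the set at index \<open>0\<close> alone.\<close>
  have "field_definable (\<lambda>e. \<exists>y. y * e 0 = 1 \<and> P (\<lambda>_. y))"
    by (intro field_definable_ex field_definable_conj field_definable_eq rational_intros field_definable_rename[OF P(1), of "\<lambda>_. 0"])
  then obtain \<phi> where \<phi>: "quantifier_free \<phi>"
    "\<And>e. (\<exists>y. y * e 0 = 1 \<and> P (\<lambda>_. y)) \<longleftrightarrow> (\<exists>e'. sat \<alpha> powers (merge e e') \<phi>)"
    unfolding field_definable_def by blast
  \<comment> \<open>The fixed point: \<open>n\<close> is both the number named inside the sentence
    and the code of its matrix.\<close>
  define n where "n = fm_code \<phi>"
  define \<sigma> where "\<sigma> = diag n \<phi>"
  have ex: "existential_sentence \<sigma>" unfolding \<sigma>_def n_def by (rule diag_existential[OF \<phi>(1)])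
  have inv: "y * \<alpha> ^ k = 1 \<longleftrightarrow> y = x ^ k" for y k
    using \<alpha>x_power[of k] \<alpha>_nz by (metis mult.commute mult_cancel_right power_not_zero)
  have "(\<forall>e. sat \<alpha> powers e \<sigma>) \<longleftrightarrow> (\<exists>e. e 0 = \<alpha> ^ code {..<n} \<and> sat \<alpha> powers e \<phi>)"
    unfolding \<sigma>_def n_def by (rule diag_true[OF \<phi>(1)])
  also have "\<dots> \<longleftrightarrow> (\<exists>e e'. e 0 = \<alpha> ^ code {..<n} \<and> sat \<alpha> powers (merge e e') \<phi>)"
  proof
    assume "\<exists>e. e 0 = \<alpha> ^ code {..<n} \<and> sat \<alpha> powers e \<phi>"
    then obtain e where e: "e 0 = \<alpha> ^ code {..<n}" "sat \<alpha> powers e \<phi>" by blast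
    have "merge (\<lambda>i. e (2 * i)) (\<lambda>i. e (2 * i + 1)) = e" by (auto simp: merge_def)
    then show "\<exists>e e'. e 0 = \<alpha> ^ code {..<n} \<and> sat \<alpha> powers (merge e e') \<phi>"
      using e by (intro exI[of _ "\<lambda>i. e (2 * i)"] exI[of _ "\<lambda>i. e (2 * i + 1)"]) simp
  next
    assume "\<exists>e e'. e 0 = \<alpha> ^ code {..<n} \<and> sat \<alpha> powers (merge e e') \<phi>"
    then obtain e e' where e: "e 0 = \<alpha> ^ code {..<n}" "sat \<alpha> powers (merge e e') \<phi>" by blast
    then show "\<exists>e. e 0 = \<alpha> ^ code {..<n} \<and> sat \<alpha> powers e \<phi>"
      by (intro exI[of _ "merge e e'"]) (simp add: merge_def)
  qed
  also have "\<dots> \<longleftrightarrow> (\<exists>e :: nat \<Rightarrow> 'a fls. e 0 = \<alpha> ^ code {..<n} \<and> (\<exists>y. y * e 0 = 1 \<and> P (\<lambda>_. y)))"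
    unfolding \<phi>(2) by blast
  also have "\<dots> \<longleftrightarrow> P (\<lambda>_. enc {..<n})"
    unfolding enc_def using inv by (auto intro!: exI[of _ "\<lambda>_. \<alpha> ^ code {..<n}"])
  also have "\<dots> \<longleftrightarrow> rec_eval (RComp f [g]) [n] 0" by (rule PR)
  also have "\<dots> \<longleftrightarrow> rec_eval f [fm_code \<sigma>] 0"
  proof
    assume "rec_eval (RComp f [g]) [n] 0"
    then obtain y where "rec_eval g [n] y" "rec_eval f [y] 0"
      by cases (auto simp: list_all2_Cons1)
    then show "rec_eval f [fm_code \<sigma>] 0"
      using rec_eval_deterministic g[OF n_def] unfolding \<sigma>_def by blast
  next
    assume "rec_eval f [fm_code \<sigma>] 0"
    then show "rec_eval (RComp f [g]) [n] 0"
      using g[OF n_def] unfolding \<sigma>_def by (auto intro!: rec_eval.comp[of _ _ "[fm_code (diag n \<phi>)]"])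
  qed
  finally have "fm_code \<sigma> \<in> fm_code ` Th_ex \<alpha> powers \<longleftrightarrow> rec_eval f [fm_code \<sigma>] 0"
    using ex by (auto simp: Th_ex_def fm_code_eq_iff)
  then show False using f[OF ex] rec_eval_deterministic by fastforce
qed

end

section \<open>Finite fields and the choice of B\<close>

lemma finite_field_pow_card: "c ^ CARD('a) = c" for c :: "'a::{field,finite}"
proof (cases "c = 0")
  case False
  have "(\<Prod>y\<in>UNIV - {0}. c * y) = \<Prod>(UNIV - {0})"
    by (rule prod.reindex_bij_witness[of _ "\<lambda>y. y / c" "\<lambda>y. c * y"]) (use False in auto)
  then have "c ^ card (UNIV - {0 :: 'a}) = 1" by (simp add: prod.distrib)
  then show ?thesis
    by (metis card_Suc_Diff1 finite_class.finite_UNIV iso_tuple_UNIV_I mult.right_neutral power_Suc)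
next
  case True
  then show ?thesis by (simp add: finite_UNIV_card_ge_0)
qed

lemma CHAR_dvd_CARD_field: "CHAR('a::{field,finite}) dvd CARD('a)"
proof -
  have "(\<Sum>y\<in>UNIV. y + 1 :: 'a) = \<Sum>UNIV"
    by (rule sum.reindex_bij_witness[of _ "\<lambda>y. y - 1" "\<lambda>y. y + 1"]) auto
  then have "of_nat CARD('a) = (0 :: 'a)" by (simp add: sum.distrib)
  then show ?thesis by (simp only: of_nat_eq_0_iff_char_dvd)
qed

text \<open>As \<open>d < p ^ e\<close>, fewer than \<open>e\<close> of the \<open>e + e\<close>
  factors \<open>p\<close> can come from \<open>d\<close>.\<close>

lemma prime_power_dvd_half:
  fixes p d n e :: nat
  assumes "prime p" "0 < d" "d < p ^ e" "p ^ e * p ^ e dvd d * n"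
  shows "p ^ e dvd n"
proof (cases "n = 0")
  case False
  have "multiplicity p d < e"
  proof (rule ccontr)
    assume "\<not> multiplicity p d < e"
    then have "p ^ e dvd d" by (intro multiplicity_dvd') simp
    then show False using assms(2,3) by (auto dest: dvd_imp_le)
  qed
  moreover have "e + e \<le> multiplicity p (d * n)"
    using assms(1,2,4) False by (intro multiplicity_geI) (auto simp: power_add)
  moreover have "multiplicity p (d * n) = multiplicity p d + multiplicity p n"
    using assms(1,2) False by (intro prime_elem_multiplicity_mult_distrib) auto
  ultimately show ?thesis by (intro multiplicity_dvd') simp
qed simp

theorem theorem9:
  fixes p q :: nat and \<alpha> :: "'a::{field,finite} fls"
  assumes "prime p"
    and "\<exists>k>0. q = p ^ k"
    and "CARD('a) = q"
    and "\<alpha> \<noteq> 0"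
    and "fls_subdegree \<alpha> > 0"
  shows "\<not> decidable_within (fm_code ` {\<sigma>. existential_sentence \<sigma>})
           (fm_code ` Th_ex \<alpha> (range (\<lambda>n::int. \<alpha> powi n)))"
proof -
  obtain k where k: "0 < k" "q = p ^ k" using assms(2) by blast
  define d where "d = nat (fls_subdegree \<alpha>)"
  have d: "fls_subdegree \<alpha> = int d" "0 < d" using assms(5) unfolding d_def by auto
  have "CHAR('a) > 0" by (rule finite_imp_CHAR_pos) simp
  then have "prime CHAR('a)" by (rule prime_CHAR_semidom)
  moreover have "CHAR('a) dvd p ^ k" using CHAR_dvd_CARD_field[where 'a = 'a] assms(3) k by simp
  ultimately have char: "CHAR('a) = p"
    using assms(1) by (meson prime_dvd_power primes_dvd_imp_eq)
  \<comment> \<open>The exponent makes \<open>B = q ^ (3 * d)\<close>. A power of \<open>q\<close>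
    fixes the constants, a power of \<open>p\<close> is additive, and the exponent
    \<open>3 * d\<close> gives \<open>B > 3 * d\<close>.\<close>
  define e where "e = k * (3 * d)"
  define B where "B = p ^ e"
  have Bq: "B = q ^ (3 * d)" unfolding B_def e_def k(2) by (simp add: power_mult)
  have Q: "B * B = p ^ (e + e)" "B * B = q ^ (3 * d + 3 * d)"
    by (simp_all only: B_def power_add) (simp only: Bq[symmetric] B_def)
  have "2 \<le> q" using assms(1) k by (metis One_nat_def Suc_leI le_trans numeral_2_eq_2 prime_ge_2_nat self_le_power prime_gt_0_nat)
  then have "3 * d < q ^ (3 * d)"
    by (meson less_le_trans less_exp power_mono zero_le)
  then have "3 * d < B" unfolding Bq .
  interpret laurent_frobenius \<alpha> d B "B * B"
  proof
    show "(f + g) ^ (B * B) = f ^ (B * B) + g ^ (B * B)" for f g :: "'a fls"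
      by (rule freshmans_dream'[where n = "e + e"]) (use assms(1) char Q(1) in auto)
    show "c ^ (B * B) = c" for c :: 'a
    proof -
      have "c ^ q ^ n = c" for n
        by (induction n) (simp_all add: power_mult finite_field_pow_card[where 'a = 'a, unfolded assms(3)])
      then show ?thesis unfolding Q(2) .
    qed
    show "B dvd n" if "B * B dvd d * n" for n
      using prime_power_dvd_half[OF assms(1) d(2), of e n] that \<open>3 * d < B\<close> unfolding B_def by simp
  qed (use d \<open>3 * d < B\<close> in auto)
  show ?thesis using undecidable unfolding powers_def .
qed

end
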